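(* Let $b_1$ be in the closed unit ball of $H^\infty(\mathbb{C}_+)$. Then the following are equivalent: (i) the operator $f\mapsto f'$ is a bounded operator from $\mathcal{H}(b_1)$ into $H^2(\mathbb{C}_+)$; (ii) $b_1$ is an inner function and $b_1'\in H^\infty(\mathbb{C}_+)$.
   Context: $\mathbb{C}_+=\{z\in\mathbb{C}:\operatorname{Im}z>0\}$ is the upper half plane, and $H^2(\mathbb{C}_+)$, $H^\infty(\mathbb{C}_+)$ are the classical Hardy spaces of $\mathbb{C}_+$, also viewed as closed subspaces of $L^2(\mathbb{R})$, $L^\infty(\mathbb{R})$ via boundary values. A function $b_1$ in the closed unit ball of $H^\infty(\mathbb{C}_+)$ is inner if $|b_1|=1$ almost everywhere on $\mathbb{R}$. De Branges--Rovnyak space of the upper half plane: for $\varphi\in L^\infty(\mathbb{R})$, the Toeplitz operator on $H^2(\mathbb{C}_+)$ is $T_\varphi f=P_+(\varphi f)$, where $P_+$ is the orthogonal projection of $L^2(\mathbb{R})$ onto $H^2(\mathbb{C}_+)$. For $b_1$ in the closed unit ball of $H^\infty(\mathbb{C}_+)$, $\mathcal{H}(b_1):=(Id-T_{b_1}T_{\overline{b_1}})^{1/2}H^2(\mathbb{C}_+)$, which is a Hilbert space with the inner product $$\langle(Id-T_{b_1}T_{\overline{b_1}})^{1/2}f,(Id-T_{b_1}T_{\overline{b_1}})^{1/2}g\rangle_{b_1}=\langle f,g\rangle_2\qquad\text{for } f,g\perp\ker(Id-T_{b_1}T_{\overline{b_1}})^{1/2}.$$ Boundedness in (i) is with respect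 to the norm of $\mathcal{H}(b_1)$ induced by this inner product and the norm of $H^2(\mathbb{C}_+)$. *)

theory Defs
  imports "HOL-Complex_Analysis.Complex_Analysis"
begin

definition UHP :: "complex set" where
  "UHP = {z. Im z > 0}"

text \<open>Boundary values are vertical limits; they exist almost everywhere for functions in
  the Hardy spaces below. Where the limit does not exist, the value is irrelevant (a null set).\<close>

definition bdry :: "(complex \<Rightarrow> complex) \<Rightarrow> real \<Rightarrow> complex" where
  "bdry f x = Lim (at_right 0) (\<lambda>y. f (Complex x y))"

definition Hinf :: "(complex \<Rightarrow> complex) set" where
  "Hinf = {f. f holomorphic_on UHP \<and> bounded (f ` UHP)}"

definition Hinf_norm :: "(complex \<Rightarrow> complex) \<Rightarrow> real" where
  "Hinf_norm f = (SUP z\<in>UHP. cmod (f z))"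

definition Hinf_unit_ball :: "(complex \<Rightarrow> complex) set" where
  "Hinf_unit_ball = {b \<in> Hinf. Hinf_norm b \<le> 1}"

definition inner_function :: "(complex \<Rightarrow> complex) \<Rightarrow> bool" where
  "inner_function b \<longleftrightarrow>
     b \<in> Hinf_unit_ball \<and> (AE x in lborel. cmod (bdry b x) = 1)"

text \<open>Elements of \<open>H2\<close> are represented by total functions that vanish off the upper half
  plane, so that equality in \<open>H2\<close> is equality of functions. Operators and descriptions
  on \<open>H2\<close> below rely on this; \<open>Hinf\<close> needs no such normalisation.\<close>

definition H2 :: "(complex \<Rightarrow> complex) set" where
  "H2 = {f. f holomorphic_on UHP \<and> (\<forall>z. z \<notin> UHP \<longrightarrow> f z = 0) \<and>
            (SUP y\<in>{0<..}. \<integral>\<^sup>+x. ennreal ((cmod (f (Complex x y)))\<^sup>2) \<partial>lborel) < \<infinity>}"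

definition L2_inner :: "(real \<Rightarrow> complex) \<Rightarrow> (real \<Rightarrow> complex) \<Rightarrow> complex" where
  "L2_inner g h = (LINT x|lborel. g x * cnj (h x))"

definition H2_inner :: "(complex \<Rightarrow> complex) \<Rightarrow> (complex \<Rightarrow> complex) \<Rightarrow> complex" where
  "H2_inner f g = L2_inner (bdry f) (bdry g)"

definition H2_norm :: "(complex \<Rightarrow> complex) \<Rightarrow> real" where
  "H2_norm f = sqrt (Re (H2_inner f f))"

text \<open>The orthogonal projection of \<open>L\<^sup>2\<close> of the real line onto \<open>H2\<close>, meaningful for
  square-integrable arguments.\<close>

definition P_plus :: "(real \<Rightarrow> complex) \<Rightarrow> (complex \<Rightarrow> complex)" where
  "P_plus g = (THE f. f \<in> H2 \<and>
     (\<forall>h\<in>H2. L2_inner (\<lambda>x. g x - bdry f x) (bdry h) = 0))"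

definition toeplitz :: "(real \<Rightarrow> complex) \<Rightarrow> (complex \<Rightarrow> complex) \<Rightarrow> (complex \<Rightarrow> complex)" where
  "toeplitz \<phi> f = P_plus (\<lambda>x. \<phi> x * bdry f x)"

definition bounded_operator ::
  "(complex \<Rightarrow> complex) set \<Rightarrow> ((complex \<Rightarrow> complex) \<Rightarrow> real) \<Rightarrow>
   (complex \<Rightarrow> complex) set \<Rightarrow> ((complex \<Rightarrow> complex) \<Rightarrow> real) \<Rightarrow>
   ((complex \<Rightarrow> complex) \<Rightarrow> (complex \<Rightarrow> complex)) \<Rightarrow> bool" where
  "bounded_operator X NX Y NY T \<longleftrightarrow>
     (\<forall>f\<in>X. T f \<in> Y) \<and>
     (\<forall>f\<in>X. \<forall>g\<in>X. T (\<lambda>z. f z + g z) = (\<lambda>z. T f z + T g z)) \<and>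
     (\<forall>c. \<forall>f\<in>X. T (\<lambda>z. c * f z) = (\<lambda>z. c * T f z)) \<and>
     (\<exists>C. \<forall>f\<in>X. NY (T f) \<le> C * NX f)"

definition positive_operator :: "((complex \<Rightarrow> complex) \<Rightarrow> (complex \<Rightarrow> complex)) \<Rightarrow> bool" where
  "positive_operator T \<longleftrightarrow>
     bounded_operator H2 H2_norm H2 H2_norm T \<and>
     (\<forall>f\<in>H2. H2_inner (T f) f \<in> \<real> \<and> 0 \<le> Re (H2_inner (T f) f))"

text \<open>The positive square root of a positive operator on \<open>H2\<close>; \<open>extensional\<close> only fixes the
  values off \<open>H2\<close>, to make it unique.\<close>

definition op_sqrt ::
  "((complex \<Rightarrow> complex) \<Rightarrow> (complex \<Rightarrow> complex)) \<Rightarrow>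
   ((complex \<Rightarrow> complex) \<Rightarrow> (complex \<Rightarrow> complex))" where
  "op_sqrt A = (THE S. S \<in> extensional H2 \<and> positive_operator S \<and> (\<forall>f\<in>H2. S (S f) = A f))"

definition dBR_sqrt :: "(complex \<Rightarrow> complex) \<Rightarrow> (complex \<Rightarrow> complex) \<Rightarrow> (complex \<Rightarrow> complex)" where
  "dBR_sqrt b = op_sqrt
     (\<lambda>f z. f z - toeplitz (bdry b) (toeplitz (\<lambda>x. cnj (bdry b x)) f) z)"

definition dBR_space :: "(complex \<Rightarrow> complex) \<Rightarrow> (complex \<Rightarrow> complex) set" where
  "dBR_space b = dBR_sqrt b ` H2"

text \<open>The unique preimage orthogonal to the kernel, through which the inner product of the
  de Branges--Rovnyak space is transported from \<open>H2\<close>.\<close>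

definition dBR_preimage :: "(complex \<Rightarrow> complex) \<Rightarrow> (complex \<Rightarrow> complex) \<Rightarrow> (complex \<Rightarrow> complex)" where
  "dBR_preimage b u = (THE f. f \<in> H2 \<and> dBR_sqrt b f = u \<and>
     (\<forall>k\<in>H2. dBR_sqrt b k = (\<lambda>z. 0) \<longrightarrow> H2_inner f k = 0))"

definition dBR_inner ::
  "(complex \<Rightarrow> complex) \<Rightarrow> (complex \<Rightarrow> complex) \<Rightarrow> (complex \<Rightarrow> complex) \<Rightarrow> complex" where
  "dBR_inner b u v = H2_inner (dBR_preimage b u) (dBR_preimage b v)"

definition dBR_norm :: "(complex \<Rightarrow> complex) \<Rightarrow> (complex \<Rightarrow> complex) \<Rightarrow> real" where
  "dBR_norm b u = sqrt (Re (dBR_inner b u u))"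

text \<open>The complex derivative, normalised to vanish off the upper half plane as \<open>H2\<close> requires.\<close>

definition hp_deriv :: "(complex \<Rightarrow> complex) \<Rightarrow> (complex \<Rightarrow> complex)" where
  "hp_deriv f = (\<lambda>z. if z \<in> UHP then deriv f z else 0)"

end

theory Submission
  imports Defs
begin

text \<open>The reproducing kernel of $\mathcal H(b)$ at $w = x + iy$ is
  $k_w(z) = (1 - \overline{b(w)} b(z))\, c_w(z)$, with $c_w$ the kernel of $H^2$, and
  $\|k_w\|_b^2 = u / (4 \pi y)$ where $u = 1 - |b(w)|^2$. If differentiation is bounded with norm $C$,
  then $|k_w'(w)| = |\langle k_w', c_w \rangle| \le C \|k_w\|_b \|c_w\|_2$ reads
  $|u/(2y) + i\, \overline{b(w)} b'(w)| \le C \sqrt u$. As $2 \,\mathrm{Re}(i \bar b b') = \partial_y |b|^2$,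
  this is a differential inequality along vertical lines, which gives $u = O(y)$ uniformly in $x$;
  so $b$ is inner, and the same inequality then bounds $b'$ near the real line.

  Conversely let $b$ be inner with $|b'| \le K$. Then $\mathcal H(b) = H^2 \ominus b H^2$ isometrically, and
  for $f$ in this space
  \[ f'(w) = \frac{1}{2 \pi i} \int f(t) \left(\frac{1 - b(w) \overline{b(t)}}{t - w}\right)^2 dt, \]
  where the square has modulus at most $\min(K^2, 4/|t - w|^2)$. It is thus dominated by an integrable
  convolution kernel, and Young's inequality bounds $f'$ in $H^2$.

  The boundary theory of $H^2$ rests on the fact that $\langle f(\cdot + ia), f(\cdot + ib) \rangle$ depends
  on $a + b$ only: the line norms are therefore monotone and the lines converge in $L^2$. The weak
  type maximal inequality turns this into vertical convergence almost everywhere.\<close>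

text \<open>Projection, square root and preimage are defined by \<open>THE\<close>, so existence and
  uniqueness must be proved before anything can be computed; this is why \<open>H2\<close> is made a
  complete inner product space. For general b only special elements of H(b) are needed: with S the
  square root of I - T_b T_b^*, the preimage of S^2 x orthogonal to ker S is S x, so the squared
  norm of S^2 x is <S^2 x, x>, and k_w = S^2 c_w. For inner b, T_b^* T_b = I makes I - T_b T_b^* a
  projection, which is its own positive root. Two obstacles shape (i) => (ii). Differentiating sqrt
  (u / y) requires u > 0; if u vanishes at a point, the maximum principle makes b constant. And the
  kernel inequality controls cnj b * b' rather than b', so a strip with |b| >= 1/2 is needed; the
  growth bound u = O(y) supplies it, and above the strip Cauchy's inequality takes over. In (ii) =>
  (i) the obstacle is that the kernel 1 / (t - w)^2 has L^1 norm pi / Im w, which blows up at the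
  real line; orthogonality to b H^2 allows a bounded replacement.\<close>

section \<open>Real Hilbert spaces: Riesz representation and positive square roots\<close>

text \<open>Dividing by t > 0 and letting t tend to 0 leaves a <= 0: the first-order condition
  behind the variational arguments of \<open>Riesz_representation\<close> and
  \<open>positive_form_zero\<close>.\<close>

lemma bounded_above_of_quadratic:
  fixes a b :: real
  assumes "\<And>t. 0 \<le> t \<Longrightarrow> 2 * t * a \<le> t\<^sup>2 * b"
  shows "a \<le> 0"
proof (rule ccontr)
  assume a: "\<not> a \<le> 0"
  \<comment> \<open>With this t one has t * b <= a, against 2 * a <= t * b; the \<open>+ 1\<close>
    keeps the denominator positive when b = 0.\<close>
  define t where "t = a / (\<bar>b\<bar> + 1)"
  have t: "t > 0" using a by (simp add: t_def add_pos_nonneg)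
  have "2 * a \<le> t * b" using assms[of t] t by (simp add: power2_eq_square)
  also have "\<dots> \<le> t * (\<bar>b\<bar> + 1)" using t by (intro mult_left_mono) auto
  also have "\<dots> = a" by (simp add: t_def add_nonneg_eq_0_iff)
  finally show False using a by simp
qed

text \<open>The minimiser of the functional $\|x\|^2 / 2 - \varphi(x)$ represents $\varphi$.\<close>

lemma Riesz_representation:
  fixes \<phi> :: "'a::{real_inner,complete_space} \<Rightarrow> real"
  assumes "bounded_linear \<phi>"
  shows "\<exists>v. \<forall>x. \<phi> x = inner v x"
proof -
  interpret bounded_linear \<phi> by fact
  define J where "J x = inner x x - 2 * \<phi> x" for x
  obtain K where K: "\<And>x. \<bar>\<phi> x\<bar> \<le> norm x * K" using bounded by auto
  have lower: "- K\<^sup>2 \<le> J x" for x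
  proof -
    have "2 * \<phi> x \<le> 2 * (norm x * K)" using K[of x] by simp
    moreover have "0 \<le> (norm x - K)\<^sup>2" by simp
    ultimately show ?thesis
      by (simp add: J_def power2_norm_eq_inner[symmetric] power2_eq_square algebra_simps)
  qed
  define m where "m = Inf (range J)"
  have m_le: "m \<le> J x" for x
    unfolding m_def by (intro cInf_lower) (auto intro!: bdd_belowI2[of _ "- K\<^sup>2"] lower)
  have "\<exists>x. J x < m + 1 / real (Suc n)" for n
  proof (rule ccontr)
    assume "\<not> ?thesis"
    hence "m + 1 / real (Suc n) \<le> Inf (range J)" by (intro cInf_greatest) (auto simp: not_less)
    thus False by (simp add: m_def)
  qed
  then obtain u where u: "\<And>n. J (u n) < m + 1 / real (Suc n)" by metis
  \<comment> \<open>Parallelogram law. The linear part of \<open>J\<close> cancels, and the value at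
    the midpoint is at least \<open>m\<close>, so near-minimisers are close to each other.\<close>
  have par: "(norm (x - y))\<^sup>2 = 2 * J x + 2 * J y - 4 * J ((1/2) *\<^sub>R (x + y))" for x y
    by (simp add: J_def power2_norm_eq_inner inner_diff_left inner_diff_right inner_add_left
        inner_add_right scaleR add inner_commute algebra_simps)
  have dist: "(norm (u i - u j))\<^sup>2 \<le> 2 / real (Suc i) + 2 / real (Suc j)" for i j
    using par[of "u i" "u j"] u[of i] u[of j] m_le[of "(1/2) *\<^sub>R (u i + u j)"] by simp
  have "Cauchy u"
  proof (rule CauchyI)
    fix e :: real assume e: "e > 0"
    obtain N where N: "4 / e\<^sup>2 < real N" using reals_Archimedean2 by blast
    show "\<exists>M. \<forall>i\<ge>M. \<forall>j\<ge>M. norm (u i - u j) < e"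
    proof (intro exI allI impI)
      fix i j assume ij: "N \<le> i" "N \<le> j"
      have "(norm (u i - u j))\<^sup>2 \<le> 2 / real (Suc N) + 2 / real (Suc N)"
        using dist[of i j] ij by (smt (verit) frac_le of_nat_0_less_iff of_nat_mono Suc_le_mono zero_less_Suc)
      also have "\<dots> = 4 / real (Suc N)" by simp
      also have "\<dots> < e\<^sup>2" using N e by (simp add: field_simps) (smt (verit) zero_less_power)
      finally show "norm (u i - u j) < e" using e by (simp add: power_less_imp_less_base)
    qed
  qed
  then obtain v where v: "u \<longlonglongrightarrow> v" using Cauchy_convergent convergent_def by blast
  have "(\<lambda>n. J (u n)) \<longlonglongrightarrow> J v"
    unfolding J_def by (intro tendsto_intros v tendsto)
  moreover have "(\<lambda>n. m + 1 / real (Suc n)) \<longlonglongrightarrow> m + 0"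
    by (intro tendsto_intros lim_1_over_n[THEN LIMSEQ_Suc])
  ultimately have "J v \<le> m + 0" by (rule LIMSEQ_le) (meson u less_imp_le)
  hence vmin: "J v \<le> J x" for x using m_le[of x] by simp
  \<comment> \<open>First variation of \<open>J\<close> at \<open>v\<close> in direction
    \<open>x\<close>; the direction \<open>- x\<close> gives the opposite inequality.\<close>
  have half: "\<phi> x - inner v x \<le> 0" for x
  proof (rule bounded_above_of_quadratic)
    fix t :: real
    have "J v \<le> J (v + t *\<^sub>R x)" by (rule vmin)
    thus "2 * t * (\<phi> x - inner v x) \<le> t\<^sup>2 * inner x x"
      by (simp add: J_def inner_add_left inner_add_right scaleR add inner_commute
          algebra_simps power2_eq_square)
  qed
  have "\<phi> x = inner v x" for x using half[of x] half[of "- x"] by (simp add: neg)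
  thus ?thesis by blast
qed

text \<open>Along y - t S y the form is nonnegative, its constant term is 0 and its linear
  coefficient is -2 |S y|^2; for small t > 0 this forces S y = 0.\<close>

lemma positive_form_zero:
  fixes S :: "'a::real_inner \<Rightarrow> 'a"
  assumes lin: "linear S" and sym: "\<And>x y. inner (S x) y = inner x (S y)"
    and pos: "\<And>x. 0 \<le> inner (S x) x" and 0: "inner (S y) y = 0"
  shows "S y = 0"
proof -
  interpret linear S by fact
  let ?z = "S y"
  have "inner ?z ?z \<le> 0"
  proof (rule bounded_above_of_quadratic)
    fix t :: real
    have "0 \<le> inner (S (y - t *\<^sub>R ?z)) (y - t *\<^sub>R ?z)" by (rule pos)
    also have "\<dots> = - 2 * t * inner ?z ?z + t\<^sup>2 * inner (S ?z) ?z"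
      using 0 by (simp add: diff scale inner_diff_left inner_diff_right sym[of ?z y]
          algebra_simps power2_eq_square)
    finally show "2 * t * inner ?z ?z \<le> t\<^sup>2 * inner (S ?z) ?z" by simp
  qed
  thus ?thesis by (metis inner_eq_zero_iff inner_ge_zero order_antisym)
qed

text \<open>For y = S x - R x, commutation and equal squares give S y + R y = 0, so the nonnegative
  numbers <S y, y> and <R y, y> add up to 0. Then S y = R y = 0, and |y|^2 = <x, S y - R y> = 0. In
  \<open>op_sqrt_exists_unique\<close> the commutation comes from the last conclusion of
  \<open>contraction_sqrt_exists\<close>.\<close>

lemma positive_sqrt_unique:
  fixes S R :: "'a::real_inner \<Rightarrow> 'a"
  assumes S: "linear S" "\<And>x y. inner (S x) y = inner x (S y)" "\<And>x. 0 \<le> inner (S x) x"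
    and R: "linear R" "\<And>x y. inner (R x) y = inner x (R y)" "\<And>x. 0 \<le> inner (R x) x"
    and comm: "\<And>x. S (R x) = R (S x)" and sq: "\<And>x. S (S x) = R (R x)"
  shows "S x = R x"
proof -
  interpret S: linear S by fact
  interpret R: linear R by fact
  define y where "y = S x - R x"
  have "S y + R y = 0" by (simp add: y_def S.diff R.diff comm sq)
  hence "inner (S y) y + inner (R y) y = 0" by (metis inner_add_left inner_zero_left)
  hence "inner (S y) y = 0" "inner (R y) y = 0" using S(3)[of y] R(3)[of y] by auto
  hence "S y = 0" "R y = 0" using positive_form_zero S R by metis+
  have "inner y y = inner x (S y) - inner x (R y)"
    using S(2)[of x y] R(2)[of x y] by (subst (1) y_def) (simp add: inner_diff_left)
  also have "\<dots> = 0" using \<open>S y = 0\<close> \<open>R y = 0\<close> by simp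
  finally show ?thesis by (simp add: y_def)
qed

text \<open>The equation (1 - Y)^2 = 1 - B, read as the fixed point equation Y = (B + Y^2) / 2 and
  iterated from 0. The iterates are polynomials in B with nonnegative coefficients, so norm bounds
  can be read off at B = 1, which is \<open>sqrt_scalar\<close>.\<close>

primrec sqrt_iter :: "('a::real_vector \<Rightarrow> 'a) \<Rightarrow> nat \<Rightarrow> 'a \<Rightarrow> 'a" where
  "sqrt_iter B 0 x = 0"
| "sqrt_iter B (Suc n) x = (1/2) *\<^sub>R (B x + sqrt_iter B n (sqrt_iter B n x))"

primrec sqrt_scalar :: "nat \<Rightarrow> real" where
  "sqrt_scalar 0 = 0"
| "sqrt_scalar (Suc n) = (1 + (sqrt_scalar n)\<^sup>2) / 2"

lemma sqrt_scalar_bounds: "0 \<le> sqrt_scalar n" "sqrt_scalar n \<le> 1"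
  by (induction n) (auto simp: power_le_one)

lemma sqrt_scalar_mono: "sqrt_scalar n \<le> sqrt_scalar (Suc n)"
proof -
  have "0 \<le> (sqrt_scalar n - 1)\<^sup>2" by simp
  thus ?thesis by (simp add: power2_eq_square algebra_simps)
qed

lemma linear_sqrt_iter: "linear B \<Longrightarrow> linear (sqrt_iter B n)"
proof (induction n)
  case 0
  thus ?case by (auto intro!: linearI)
next
  case (Suc n)
  then interpret l: linear "sqrt_iter B n" by simp
  interpret B: linear B by fact
  show ?case by (rule linearI) (auto simp: l.add l.scale B.add B.scale algebra_simps)
qed

lemma sqrt_iter_commute:
  assumes "linear B" "linear T" "\<And>x. T (B x) = B (T x)"
  shows "T (sqrt_iter B n x) = sqrt_iter B n (T x)"
proof (induction n arbitrary: x)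
  interpret T: linear T by fact
  { case 0 show ?case by (simp add: T.zero) }
  { case (Suc n) thus ?case by (simp add: T.add T.scale assms(3)) }
qed

lemma sqrt_iter_symmetric:
  fixes B :: "'a::real_inner \<Rightarrow> 'a"
  assumes "\<And>x y. inner (B x) y = inner x (B y)"
  shows "inner (sqrt_iter B n x) y = inner x (sqrt_iter B n y)"
  by (induction n arbitrary: x y) (simp_all add: inner_add_left inner_add_right assms)

lemma sqrt_iter_norm:
  fixes B :: "'a::real_inner \<Rightarrow> 'a"
  assumes "\<And>x. norm (B x) \<le> norm x"
  shows "norm (sqrt_iter B n x) \<le> sqrt_scalar n * norm x"
proof (induction n arbitrary: x)
  case (Suc n)
  have "norm (sqrt_iter B n (sqrt_iter B n x)) \<le> sqrt_scalar n * (sqrt_scalar n * norm x)"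
    by (rule order_trans[OF Suc mult_left_mono[OF Suc]]) (rule sqrt_scalar_bounds)
  hence "norm (B x + sqrt_iter B n (sqrt_iter B n x)) \<le> (1 + (sqrt_scalar n)\<^sup>2) * norm x"
    using assms[of x] norm_triangle_ineq[of "B x" "sqrt_iter B n (sqrt_iter B n x)"]
    by (simp add: algebra_simps power2_eq_square)
  thus ?case by simp
qed simp

text \<open>Commuting iterates satisfy Z^2 - Y^2 = (Z + Y) (Z - Y), and the scalar iteration obeys
  the same identity; so each increment is bounded by a scalar increment, and these
  telescope.\<close>

lemma sqrt_iter_diff_norm:
  fixes B :: "'a::real_inner \<Rightarrow> 'a"
  assumes lin: "linear B" and nB: "\<And>x. norm (B x) \<le> norm x"
  shows "norm (sqrt_iter B (Suc n) x - sqrt_iter B n x)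
           \<le> (sqrt_scalar (Suc n) - sqrt_scalar n) * norm x"
proof (induction n arbitrary: x)
  case 0
  thus ?case using nB[of x] by simp
next
  case (Suc n)
  let ?Y = "sqrt_iter B n" and ?Z = "sqrt_iter B (Suc n)"
  interpret Y: linear ?Y by (rule linear_sqrt_iter[OF lin])
  interpret Z: linear ?Z by (rule linear_sqrt_iter[OF lin])
  have comm: "?Z (?Y x) = ?Y (?Z x)" for x
    by (intro sqrt_iter_commute lin linear_sqrt_iter sqrt_iter_commute[symmetric] refl)
  define d where "d = ?Z x - ?Y x"
  have eq: "sqrt_iter B (Suc (Suc n)) x - ?Z x = (1/2) *\<^sub>R (?Z d + ?Y d)"
  proof -
    have "?Z d + ?Y d = ?Z (?Z x) - ?Y (?Y x)"
      by (simp only: d_def Z.diff Y.diff comm) simp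
    moreover have "?Z x = (1/2) *\<^sub>R (B x + ?Y (?Y x))" by simp
    ultimately show ?thesis
      by (simp only: sqrt_iter.simps(2)[of B "Suc n"] scaleR_diff_right[symmetric]) simp
  qed
  let ?p = "sqrt_scalar n" and ?q = "sqrt_scalar (Suc n)"
  have "norm (?Z d + ?Y d) \<le> (?q + ?p) * norm d"
    using norm_triangle_ineq[of "?Z d" "?Y d"] sqrt_iter_norm[OF nB, of n d]
      sqrt_iter_norm[OF nB, of "Suc n" d] by (simp only: distrib_right)
  also have "\<dots> \<le> (?q + ?p) * ((?q - ?p) * norm x)"
    unfolding d_def using Suc sqrt_scalar_bounds(1)[of n] sqrt_scalar_bounds(1)[of "Suc n"]
    by (intro mult_left_mono) (simp_all only: add_nonneg_nonneg)
  also have "\<dots> = (?q\<^sup>2 - ?p\<^sup>2) * norm x" by (simp only: power2_eq_square) algebra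
  finally have "norm (sqrt_iter B (Suc (Suc n)) x - ?Z x) \<le> (?q\<^sup>2 - ?p\<^sup>2) / 2 * norm x"
    unfolding eq by simp
  also have "(?q\<^sup>2 - ?p\<^sup>2) / 2 = sqrt_scalar (Suc (Suc n)) - ?q"
    by (simp only: sqrt_scalar.simps(2)[of "Suc n"] sqrt_scalar.simps(2)[of n] diff_divide_distrib[symmetric]) simp
  finally show ?case .
qed

text \<open>The iteration $Y_{n+1} = (B + Y_n^2)/2$ is dominated by its scalar version at $B = 1$, hence
  converges strongly to some $Y$ with $(I - Y)^2 = I - B$.\<close>

lemma contraction_sqrt_exists:
  fixes B :: "'a::{real_inner,complete_space} \<Rightarrow> 'a"
  assumes lin: "linear B" and nB: "\<And>x. norm (B x) \<le> norm x"
    and sym: "\<And>x y. inner (B x) y = inner x (B y)"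
  obtains S where "linear S" "\<And>x. norm (S x) \<le> 2 * norm x" "\<And>x y. inner (S x) y = inner x (S y)"
    "\<And>x. 0 \<le> inner (S x) x" "\<And>x. S (S x) = x - B x"
    "\<And>T x. \<lbrakk>bounded_linear T; \<And>x. T (B x) = B (T x)\<rbrakk> \<Longrightarrow> T (S x) = S (T x)"
proof -
  have ql: "convergent sqrt_scalar"
    by (rule Bseq_mono_convergent)
       (auto intro!: BseqI'[of _ 1] sqrt_scalar_mono monoI lift_Suc_mono_le[of sqrt_scalar] simp: sqrt_scalar_bounds)
  have telescope: "norm (sqrt_iter B (m + k) x - sqrt_iter B m x) \<le> (sqrt_scalar (m + k) - sqrt_scalar m) * norm x" for m k x
  proof (induction k)
    case (Suc k)
    have "norm (sqrt_iter B (m + Suc k) x - sqrt_iter B m x)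
      \<le> norm (sqrt_iter B (Suc (m + k)) x - sqrt_iter B (m + k) x) + norm (sqrt_iter B (m + k) x - sqrt_iter B m x)"
      by (metis add_Suc_right norm_diff_triangle_ineq diff_add_cancel add_diff_eq diff_add_eq norm_triangle_ineq)
    also have "\<dots> \<le> (sqrt_scalar (Suc (m + k)) - sqrt_scalar (m + k)) * norm x + (sqrt_scalar (m + k) - sqrt_scalar m) * norm x"
      by (intro add_mono Suc sqrt_iter_diff_norm lin nB)
    finally show ?case by (simp only: add_Suc_right) (simp only: algebra_simps)
  qed simp
  have "convergent (\<lambda>n. sqrt_iter B n x)" for x
  proof (rule Cauchy_convergent, rule CauchyI')
    fix e :: real assume e: "e > 0"
    have "Cauchy sqrt_scalar" using ql by (rule convergent_Cauchy)
    then obtain M where M: "\<And>i j. i \<ge> M \<Longrightarrow> j \<ge> M \<Longrightarrow> \<bar>sqrt_scalar i - sqrt_scalar j\<bar> < e / (norm x + 1)"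
      using e unfolding Cauchy_def dist_real_def by (metis norm_ge_zero add_nonneg_pos divide_pos_pos zero_less_one)
    show "\<exists>M. \<forall>m\<ge>M. \<forall>n>m. dist (sqrt_iter B m x) (sqrt_iter B n x) < e"
    proof (intro exI allI impI)
      fix m n assume mn: "M \<le> m" "m < n"
      then obtain k where k: "n = m + k" using less_imp_add_positive by blast
      have "dist (sqrt_iter B m x) (sqrt_iter B n x) \<le> (sqrt_scalar (m + k) - sqrt_scalar m) * norm x"
        using telescope[of m k x] by (simp add: dist_norm norm_minus_commute k)
      also have "\<dots> \<le> e / (norm x + 1) * norm x"
        using M[of "m + k" m] mn by (intro mult_right_mono) auto
      also have "\<dots> < e" using e by (simp add: divide_less_eq add_nonneg_pos)
      finally show "dist (sqrt_iter B m x) (sqrt_iter B n x) < e" .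
    qed
  qed
  then obtain Y where Y: "\<And>x. (\<lambda>n. sqrt_iter B n x) \<longlonglongrightarrow> Y x" unfolding convergent_def by metis
  interpret B: linear B by fact
  have linY: "linear Y"
  proof (rule linearI)
    fix x y show "Y (x + y) = Y x + Y y"
      by (rule LIMSEQ_unique[OF Y]) (use tendsto_add[OF Y[of x] Y[of y]] in \<open>simp add: linear_add[OF linear_sqrt_iter[OF lin]]\<close>)
  next
    fix r x show "Y (r *\<^sub>R x) = r *\<^sub>R Y x"
      by (rule LIMSEQ_unique[OF Y]) (use tendsto_scaleR[OF tendsto_const Y[of x]] in \<open>simp add: linear_scale[OF linear_sqrt_iter[OF lin]]\<close>)
  qed
  interpret Y: linear Y by fact
  have itn: "norm (sqrt_iter B n x) \<le> norm x" for n x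
    using sqrt_iter_norm[OF nB, of n x] mult_right_mono[OF sqrt_scalar_bounds(2)[of n] norm_ge_zero[of x]] by linarith
  have nY: "norm (Y x) \<le> norm x" for x
    by (rule LIMSEQ_le_const2[OF tendsto_norm[OF Y]]) (auto intro: itn)
  have symY: "inner (Y x) y = inner x (Y y)" for x y
    by (rule LIMSEQ_unique[of "\<lambda>n. inner (sqrt_iter B n x) y"])
       (intro tendsto_intros Y, simp only: sqrt_iter_symmetric[OF sym], intro tendsto_intros Y)
  \<comment> \<open>The operator varies together with the vector here: the uniform contraction bound
    on the iterates allows the moving argument to be replaced by its limit.\<close>
  have YY: "(\<lambda>n. sqrt_iter B n (sqrt_iter B n x)) \<longlonglongrightarrow> Y (Y x)" for x
  proof -
    have "(\<lambda>n. sqrt_iter B n x - Y x) \<longlonglongrightarrow> 0" using Y[of x] by (simp add: LIM_zero)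
    hence "(\<lambda>n. sqrt_iter B n (sqrt_iter B n x - Y x)) \<longlonglongrightarrow> 0"
      by (rule Lim_null_comparison[rotated, OF tendsto_norm_zero]) (simp add: itn)
    hence "(\<lambda>n. sqrt_iter B n (sqrt_iter B n x - Y x) + sqrt_iter B n (Y x)) \<longlonglongrightarrow> 0 + Y (Y x)"
      by (intro tendsto_add Y)
    thus ?thesis by (simp add: linear_diff[OF linear_sqrt_iter[OF lin]])
  qed
  have fixp: "Y x = (1/2) *\<^sub>R (B x + Y (Y x))" for x
  proof (rule LIMSEQ_unique[OF LIMSEQ_Suc[OF Y]])
    show "(\<lambda>n. sqrt_iter B (Suc n) x) \<longlonglongrightarrow> (1/2) *\<^sub>R (B x + Y (Y x))"
      by (simp only: sqrt_iter.simps) (intro tendsto_intros YY)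
  qed
  show ?thesis
  proof (rule that[of "\<lambda>x. x - Y x"])
    show "linear (\<lambda>x. x - Y x)" by (rule linearI) (simp_all add: Y.add Y.scale algebra_simps)
    show "norm (x - Y x) \<le> 2 * norm x" for x using nY[of x] norm_triangle_ineq4[of x "Y x"] by linarith
    show "inner (x - Y x) y = inner x (y - Y y)" for x y by (simp add: inner_diff_left inner_diff_right symY)
    show "0 \<le> inner (x - Y x) x" for x
    proof -
      have "inner (Y x) x \<le> norm (Y x) * norm x" by (rule norm_cauchy_schwarz)
      also have "\<dots> \<le> norm x * norm x" by (intro mult_right_mono nY) simp
      finally show ?thesis by (simp add: inner_diff_left power2_norm_eq_inner[symmetric] power2_eq_square)
    qed
    show "x - Y x - Y (x - Y x) = x - B x" for x
    proof -
      have "2 *\<^sub>R Y x = B x + Y (Y x)" using arg_cong[OF fixp[of x], of "\<lambda>v. 2 *\<^sub>R v"] by simp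
      hence "Y x + Y x = B x + Y (Y x)" by (simp add: scaleR_2)
      thus ?thesis by (simp add: Y.diff algebra_simps)
    qed
    fix T :: "'a \<Rightarrow> 'a" and x assume T: "bounded_linear T" "\<And>x. T (B x) = B (T x)"
    interpret T: bounded_linear T by fact
    have "(\<lambda>n. T (sqrt_iter B n x)) \<longlonglongrightarrow> T (Y x)" by (intro T.tendsto Y)
    moreover have "T (sqrt_iter B n x) = sqrt_iter B n (T x)" for n
      by (intro sqrt_iter_commute lin T) (rule T.linear_axioms)
    ultimately have "T (Y x) = Y (T x)" using Y[of "T x"] LIMSEQ_unique by auto
    thus "T (x - Y x) = T x - Y (T x)" by (simp add: T.diff)
  qed
qed

subsection \<open>Square integrable functions\<close>

lemma borel_measurable_cnj [measurable]:
  "f \<in> borel_measurable M \<Longrightarrow> (\<lambda>x. cnj (f x)) \<in> borel_measurable M"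
  by (rule measurable_compose[OF _ borel_measurable_continuous_onI]) (auto intro: continuous_intros)

definition square_integrable :: "(real \<Rightarrow> complex) \<Rightarrow> bool" where
  "square_integrable g \<longleftrightarrow> g \<in> borel_measurable borel \<and> integrable lborel (\<lambda>x. (cmod (g x))\<^sup>2)"

definition L2_norm :: "(real \<Rightarrow> complex) \<Rightarrow> real" where
  "L2_norm g = sqrt (LINT x|lborel. (cmod (g x))\<^sup>2)"

lemma square_integrable_measurable [measurable_dest]:
  "square_integrable g \<Longrightarrow> g \<in> borel_measurable borel"
  by (simp add: square_integrable_def)

lemma L2_norm_nonneg [simp]: "0 \<le> L2_norm g"
  by (simp add: L2_norm_def)

lemma L2_norm_power2: "(L2_norm g)\<^sup>2 = (LINT x|lborel. (cmod (g x))\<^sup>2)"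
  by (simp add: L2_norm_def)

lemma integrable_mult_square_integrable:
  assumes g: "square_integrable g" and h: "square_integrable h"
  shows "integrable lborel (\<lambda>x. cmod (g x) * cmod (h x))" "integrable lborel (\<lambda>x. g x * h x)"
    "integrable lborel (\<lambda>x. g x * cnj (h x))"
proof -
  note [measurable] = square_integrable_measurable[OF g] square_integrable_measurable[OF h]
  have int: "integrable lborel (\<lambda>x. (cmod (g x))\<^sup>2 + (cmod (h x))\<^sup>2)"
    using g h by (simp add: square_integrable_def)
  have le: "cmod (g x) * cmod (h x) \<le> (cmod (g x))\<^sup>2 + (cmod (h x))\<^sup>2" for x
  proof -
    have "0 \<le> (cmod (g x) - cmod (h x))\<^sup>2" "0 \<le> cmod (g x) * cmod (h x)" by simp_all
    thus ?thesis unfolding power2_diff by linarith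
  qed
  show "integrable lborel (\<lambda>x. cmod (g x) * cmod (h x))"
    by (rule Bochner_Integration.integrable_bound[OF int]) (auto simp: le)
  show "integrable lborel (\<lambda>x. g x * h x)" "integrable lborel (\<lambda>x. g x * cnj (h x))"
    by (rule Bochner_Integration.integrable_bound[OF int]; auto simp: le norm_mult)+
qed

lemma square_integrable_add:
  assumes g: "square_integrable g" and h: "square_integrable h"
  shows "square_integrable (\<lambda>x. g x + h x)"
proof -
  note [measurable] = square_integrable_measurable[OF g] square_integrable_measurable[OF h]
  have int: "integrable lborel (\<lambda>x. 2 * ((cmod (g x))\<^sup>2 + (cmod (h x))\<^sup>2))"
    using g h by (simp add: square_integrable_def)
  have "(cmod (g x + h x))\<^sup>2 \<le> 2 * ((cmod (g x))\<^sup>2 + (cmod (h x))\<^sup>2)" for x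
  proof -
    have "(cmod (g x + h x))\<^sup>2 \<le> (cmod (g x) + cmod (h x))\<^sup>2"
      by (intro power_mono norm_triangle_ineq) simp
    moreover have "0 \<le> (cmod (g x) - cmod (h x))\<^sup>2" by simp
    ultimately show ?thesis by (simp add: power2_eq_square algebra_simps)
  qed
  thus ?thesis unfolding square_integrable_def
    by (auto intro!: Bochner_Integration.integrable_bound[OF int])
qed

lemma square_integrable_bounded_mult:
  assumes g: "square_integrable g" and p[measurable]: "p \<in> borel_measurable borel"
    and bd: "AE x in lborel. cmod (p x) \<le> K"
  shows "square_integrable (\<lambda>x. p x * g x)"
proof -
  note [measurable] = square_integrable_measurable[OF g]
  have int: "integrable lborel (\<lambda>x. K\<^sup>2 * (cmod (g x))\<^sup>2)"
    using g by (simp add: square_integrable_def)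
  have "AE x in lborel. norm ((cmod (p x * g x))\<^sup>2) \<le> norm (K\<^sup>2 * (cmod (g x))\<^sup>2)"
    using bd
  proof eventually_elim
    case (elim x)
    thus ?case by (simp add: norm_mult power_mult_distrib) (intro mult_right_mono power_mono, auto)
  qed
  thus ?thesis unfolding square_integrable_def
    by (auto intro!: Bochner_Integration.integrable_bound[OF int])
qed

lemma square_integrable_cmult: "square_integrable g \<Longrightarrow> square_integrable (\<lambda>x. c * g x)"
  by (rule square_integrable_bounded_mult[of _ _ "cmod c"]) auto

lemma square_integrable_zero [simp]: "square_integrable (\<lambda>x. 0)"
  by (simp add: square_integrable_def)

lemma square_integrable_diff:
  "\<lbrakk>square_integrable g; square_integrable h\<rbrakk> \<Longrightarrow> square_integrable (\<lambda>x. g x - h x)"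
  using square_integrable_add[OF _ square_integrable_cmult[of h "-1"], of g] by simp

lemma L2_inner_AE_cong:
  assumes m [measurable]: "g \<in> borel_measurable borel" "g' \<in> borel_measurable borel"
    "h \<in> borel_measurable borel" "h' \<in> borel_measurable borel"
   and "AE x in lborel. g x = g' x" "AE x in lborel. h x = h' x"
  shows "L2_inner g h = L2_inner g' h'"
proof -
  have "AE x in lborel. g x * cnj (h x) = g' x * cnj (h' x)" using assms(5,6) by auto
  thus ?thesis unfolding L2_inner_def by (intro integral_cong_AE) measurable
qed

lemma L2_inner_add_left:
  "\<lbrakk>square_integrable f; square_integrable g; square_integrable h\<rbrakk>
    \<Longrightarrow> L2_inner (\<lambda>x. f x + g x) h = L2_inner f h + L2_inner g h"
  by (simp add: L2_inner_def integrable_mult_square_integrable distrib_right)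

lemma L2_inner_diff_left:
  "\<lbrakk>square_integrable f; square_integrable g; square_integrable h\<rbrakk>
    \<Longrightarrow> L2_inner (\<lambda>x. f x - g x) h = L2_inner f h - L2_inner g h"
  by (simp add: L2_inner_def integrable_mult_square_integrable left_diff_distrib)

lemma L2_inner_cmult_left: "L2_inner (\<lambda>x. c * f x) h = c * L2_inner f h"
  by (simp add: L2_inner_def mult.assoc)

lemma L2_inner_cnj: "cnj (L2_inner f h) = L2_inner h f"
  using Bochner_Integration.integral_cnj[of lborel "\<lambda>x. f x * cnj (h x)"]
  by (simp add: L2_inner_def mult.commute)

lemma L2_inner_add_right:
  "\<lbrakk>square_integrable f; square_integrable g; square_integrable h\<rbrakk>
    \<Longrightarrow> L2_inner h (\<lambda>x. f x + g x) = L2_inner h f + L2_inner h g"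
  by (metis L2_inner_add_left L2_inner_cnj complex_cnj_add)

lemma L2_inner_self: "L2_inner f f = complex_of_real ((L2_norm f)\<^sup>2)"
proof -
  have "f x * cnj (f x) = complex_of_real ((cmod (f x))\<^sup>2)" for x by (rule complex_norm_square[symmetric, unfolded of_real_power[symmetric]])
  thus ?thesis unfolding L2_norm_power2 L2_inner_def by (simp only: integral_complex_of_real)
qed

lemma L2_Cauchy_Schwarz_abs:
  assumes g: "square_integrable g" and h: "square_integrable h"
  shows "(LINT x|lborel. cmod (g x) * cmod (h x)) \<le> L2_norm g * L2_norm h"
proof -
  note [measurable] = square_integrable_measurable[OF g] square_integrable_measurable[OF h]
  let ?I = "LINT x|lborel. cmod (g x) * cmod (h x)"
  have "(\<integral>\<^sup>+x. ennreal (cmod (g x)) * ennreal (cmod (h x)) \<partial>lborel)\<^sup>2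
      \<le> (\<integral>\<^sup>+x. (ennreal (cmod (g x)))\<^sup>2 \<partial>lborel) * (\<integral>\<^sup>+x. (ennreal (cmod (h x)))\<^sup>2 \<partial>lborel)"
    by (rule Cauchy_Schwarz_nn_integral) auto
  moreover have "(\<integral>\<^sup>+x. ennreal (cmod (g x)) * ennreal (cmod (h x)) \<partial>lborel) = ennreal ?I"
    by (subst nn_integral_eq_integral[symmetric])
       (auto intro: integrable_mult_square_integrable g h simp: ennreal_mult)
  moreover have "(\<integral>\<^sup>+x. (ennreal (cmod (g x)))\<^sup>2 \<partial>lborel) = ennreal ((L2_norm g)\<^sup>2)"
    unfolding L2_norm_power2 using g
    by (subst nn_integral_eq_integral[symmetric]) (auto simp: ennreal_power square_integrable_def)
  moreover have "(\<integral>\<^sup>+x. (ennreal (cmod (h x)))\<^sup>2 \<partial>lborel) = ennreal ((L2_norm h)\<^sup>2)"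
    unfolding L2_norm_power2 using h
    by (subst nn_integral_eq_integral[symmetric]) (auto simp: ennreal_power square_integrable_def)
  ultimately have "(ennreal ?I)\<^sup>2 \<le> ennreal ((L2_norm g)\<^sup>2) * ennreal ((L2_norm h)\<^sup>2)" by simp
  hence "ennreal (?I\<^sup>2) \<le> ennreal ((L2_norm g * L2_norm h)\<^sup>2)"
    by (simp add: ennreal_power ennreal_mult[symmetric] power_mult_distrib)
  hence "?I\<^sup>2 \<le> (L2_norm g * L2_norm h)\<^sup>2" by (subst (asm) ennreal_le_iff) auto
  thus ?thesis by (rule power2_le_imp_le) auto
qed

lemma L2_Cauchy_Schwarz:
  assumes g: "square_integrable g" and h: "square_integrable h"
  shows "cmod (L2_inner g h) \<le> L2_norm g * L2_norm h"
proof -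
  have "cmod (L2_inner g h) \<le> (LINT x|lborel. cmod (g x * cnj (h x)))"
    unfolding L2_inner_def by (rule integral_norm_bound)
  also have "\<dots> \<le> L2_norm g * L2_norm h"
    using L2_Cauchy_Schwarz_abs[OF g h] by (simp add: norm_mult)
  finally show ?thesis .
qed

lemma L2_norm_add_power2:
  assumes g: "square_integrable g" and h: "square_integrable h"
  shows "(L2_norm (\<lambda>x. g x + h x))\<^sup>2 = (L2_norm g)\<^sup>2 + (L2_norm h)\<^sup>2 + 2 * Re (L2_inner g h)"
proof -
  let ?s = "\<lambda>x. g x + h x"
  have "complex_of_real ((L2_norm ?s)\<^sup>2) = L2_inner g g + L2_inner h g + (L2_inner g h + L2_inner h h)"
    unfolding L2_inner_self[symmetric]
    by (simp add: L2_inner_add_left L2_inner_add_right square_integrable_add g h)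
  hence "Re (complex_of_real ((L2_norm ?s)\<^sup>2)) = Re (L2_inner g g + L2_inner h g + (L2_inner g h + L2_inner h h))"
    by simp
  thus ?thesis using L2_inner_cnj[of g h, symmetric] by (simp add: L2_inner_self)
qed

lemma L2_norm_diff_power2:
  assumes g: "square_integrable g" and h: "square_integrable h"
  shows "(L2_norm (\<lambda>x. g x - h x))\<^sup>2 = (L2_norm g)\<^sup>2 + (L2_norm h)\<^sup>2 - 2 * Re (L2_inner g h)"
proof -
  have "L2_norm (\<lambda>x. - h x) = L2_norm h" by (simp add: L2_norm_def)
  moreover have "L2_inner g (\<lambda>x. - h x) = - L2_inner g h" by (simp add: L2_inner_def)
  ultimately show ?thesis
    using L2_norm_add_power2[OF g square_integrable_cmult[OF h, of "-1"]] by simp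
qed

lemma L2_norm_triangle:
  assumes g: "square_integrable g" and h: "square_integrable h"
  shows "L2_norm (\<lambda>x. g x + h x) \<le> L2_norm g + L2_norm h"
proof (rule power2_le_imp_le)
  have "Re (L2_inner g h) \<le> L2_norm g * L2_norm h"
    using complex_Re_le_cmod[of "L2_inner g h"] L2_Cauchy_Schwarz[OF g h] by linarith
  thus "(L2_norm (\<lambda>x. g x + h x))\<^sup>2 \<le> (L2_norm g + L2_norm h)\<^sup>2"
    by (simp add: L2_norm_add_power2[OF g h] power2_sum)
qed auto

lemma L2_norm_AE_cong:
  assumes [measurable]: "g \<in> borel_measurable borel" "h \<in> borel_measurable borel"
   and "AE x in lborel. g x = h x"
  shows "L2_norm g = L2_norm h"
  unfolding L2_norm_def using assms(3) by (intro arg_cong[of _ _ sqrt] integral_cong_AE) auto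

lemma nn_integral_square_integrable:
  "square_integrable g \<Longrightarrow> (\<integral>\<^sup>+x. ennreal ((cmod (g x))\<^sup>2) \<partial>lborel) = ennreal ((L2_norm g)\<^sup>2)"
  unfolding L2_norm_power2 square_integrable_def by (intro nn_integral_eq_integral) auto

lemma square_integrableI:
  assumes [measurable]: "g \<in> borel_measurable borel"
    and "(\<integral>\<^sup>+x. ennreal ((cmod (g x))\<^sup>2) \<partial>lborel) \<le> ennreal (C\<^sup>2)" and "0 \<le> C"
  shows "square_integrable g" "L2_norm g \<le> C"
proof -
  show *: "square_integrable g" unfolding square_integrable_def
    using assms(2) by (auto intro!: integrableI_bounded simp: less_top[symmetric] top_unique)
  show "L2_norm g \<le> C" using assms(2,3) nn_integral_square_integrable[OF *]
    by (auto intro: power2_le_imp_le)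
qed

text \<open>Young's inequality for L^1 convolved with L^2: split k as sqrt k * sqrt k in
  Cauchy-Schwarz for fixed x, then integrate over x and exchange the integrals. Extended nonnegative
  integrals put the exchange in Tonelli's form.\<close>

lemma convolution_L2_bound:
  fixes F k :: "real \<Rightarrow> real"
  assumes F[measurable]: "F \<in> borel_measurable borel" and k[measurable]: "k \<in> borel_measurable borel"
    and pos: "\<And>x. 0 \<le> F x" "\<And>x. 0 \<le> k x"
  shows "(\<integral>\<^sup>+x. (\<integral>\<^sup>+t. ennreal (F t * k (t - x)) \<partial>lborel)\<^sup>2 \<partial>lborel)
     \<le> (\<integral>\<^sup>+t. ennreal (k t) \<partial>lborel)\<^sup>2 * (\<integral>\<^sup>+t. ennreal ((F t)\<^sup>2) \<partial>lborel)"
proof -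
  let ?K = "\<integral>\<^sup>+t. ennreal (k t) \<partial>lborel"
  have shift: "(\<integral>\<^sup>+t. ennreal (k (t - x)) \<partial>lborel) = ?K" for x
    using nn_integral_real_affine[of "\<lambda>t. ennreal (k (t - x))" 1 x] by simp
  have shift': "(\<integral>\<^sup>+x. ennreal (k (t - x)) \<partial>lborel) = ?K" for t
    using nn_integral_real_affine[of "\<lambda>x. ennreal (k (t - x))" "-1" t] by simp
  have "(\<integral>\<^sup>+t. ennreal (F t * k (t - x)) \<partial>lborel)\<^sup>2 \<le> ?K * (\<integral>\<^sup>+t. ennreal ((F t)\<^sup>2 * k (t - x)) \<partial>lborel)" for x
  proof -
    have "(\<integral>\<^sup>+t. ennreal (sqrt (k (t - x))) * ennreal (F t * sqrt (k (t - x))) \<partial>lborel)\<^sup>2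
      \<le> (\<integral>\<^sup>+t. (ennreal (sqrt (k (t - x))))\<^sup>2 \<partial>lborel) * (\<integral>\<^sup>+t. (ennreal (F t * sqrt (k (t - x))))\<^sup>2 \<partial>lborel)"
      by (rule Cauchy_Schwarz_nn_integral) auto
    moreover have "ennreal (sqrt (k (t - x))) * ennreal (F t * sqrt (k (t - x))) = ennreal (F t * k (t - x))" for t
      using pos by (simp add: ennreal_mult[symmetric])
    ultimately show ?thesis
      using pos by (simp add: ennreal_power power_mult_distrib shift)
  qed
  hence "(\<integral>\<^sup>+x. (\<integral>\<^sup>+t. ennreal (F t * k (t - x)) \<partial>lborel)\<^sup>2 \<partial>lborel)
    \<le> (\<integral>\<^sup>+x. ?K * (\<integral>\<^sup>+t. ennreal ((F t)\<^sup>2 * k (t - x)) \<partial>lborel) \<partial>lborel)"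
    by (intro nn_integral_mono)
  also have "\<dots> = ?K * (\<integral>\<^sup>+x. (\<integral>\<^sup>+t. ennreal ((F t)\<^sup>2 * k (t - x)) \<partial>lborel) \<partial>lborel)"
    by (intro nn_integral_cmult) measurable
  also have "(\<integral>\<^sup>+x. (\<integral>\<^sup>+t. ennreal ((F t)\<^sup>2 * k (t - x)) \<partial>lborel) \<partial>lborel)
     = (\<integral>\<^sup>+t. (\<integral>\<^sup>+x. ennreal ((F t)\<^sup>2 * k (t - x)) \<partial>lborel) \<partial>lborel)"
    by (intro lborel_pair.Fubini') measurable
  also have "\<dots> = (\<integral>\<^sup>+t. ennreal ((F t)\<^sup>2) * ?K \<partial>lborel)"
    using pos by (simp add: ennreal_mult nn_integral_cmult shift')
  also have "\<dots> = (\<integral>\<^sup>+t. ennreal ((F t)\<^sup>2) \<partial>lborel) * ?K"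
    by (intro nn_integral_multc) measurable
  finally show ?thesis by (simp add: power2_eq_square algebra_simps)
qed

subsection \<open>The maximal inequality\<close>

text \<open>Vitali covering: disjoint balls on which the average of g exceeds \<mu>, whose fivefold
  enlargements cover the exceptional set; hence the constant 5. The conclusion is about a Borel
  cover \<open>U\<close>, which is what monotonicity of the measure requires.\<close>

lemma Hardy_Littlewood_weak_type:
  fixes g :: "real \<Rightarrow> real"
  assumes int: "integrable lborel g" and pos: "\<And>x. 0 \<le> g x" and mu: "\<mu> > 0"
  obtains U where "U \<in> sets borel"
    "{x. \<exists>r>0. 2 * r * \<mu> < (LINT t|lborel. indicator (cball x r) t * g t)} \<subseteq> U"
    "emeasure lborel U \<le> ennreal (5 / \<mu> * (LINT t|lborel. g t))"
proof -
  let ?E = "{x. \<exists>r>0. 2 * r * \<mu> < (LINT t|lborel. indicator (cball x r) t * g t)}"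
  let ?I = "LINT t|lborel. g t"
  have inti: "integrable lborel (\<lambda>t. indicator A t * g t)" if "A \<in> sets borel" for A
    using integrable_mult_indicator[OF _ int, of A] that by simp
  define P where "P x s \<longleftrightarrow> s > 0 \<and> 2 * s * \<mu> < (LINT t|lborel. indicator (cball x s) t * g t)" for x s
  define r where "r x = (SOME s. P x s)" for x
  have r: "r x > 0 \<and> 2 * r x * \<mu> < (LINT t|lborel. indicator (cball x (r x)) t * g t)" if "x \<in> ?E" for x
  proof -
    have "\<exists>s. P x s" using that by (auto simp: P_def)
    hence "P x (r x)" unfolding r_def by (rule someI_ex)
    thus ?thesis by (simp add: P_def)
  qed
  \<comment> \<open>The covering lemma asks for uniformly bounded radii; they are bounded because
    the whole integral is finite.\<close>
  have rI: "r x \<le> ?I / (2 * \<mu>)" if "x \<in> ?E" for x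
  proof -
    have "2 * r x * \<mu> \<le> (LINT t|lborel. indicator (cball x (r x)) t * g t)" using r[OF that] by simp
    also have "\<dots> \<le> ?I" by (intro integral_mono inti int) (auto simp: indicator_def pos)
    finally show ?thesis using mu by (simp add: field_simps)
  qed
  have "x \<in> (\<Union>x\<in>?E. cball x (r x))" if "x \<in> ?E" for x
    using that r[OF that] by (intro UN_I[of x]) auto
  hence "?E \<subseteq> (\<Union>x\<in>?E. cball x (r x))" by blast
  moreover have "\<And>x. x \<in> ?E \<Longrightarrow> 0 < r x \<and> r x \<le> ?I / (2 * \<mu>)" using r rI by blast
  ultimately obtain C where C: "countable C" "C \<subseteq> ?E"
     "pairwise (\<lambda>i j. disjnt (cball i (r i)) (cball j (r j))) C" "?E \<subseteq> (\<Union>i\<in>C. cball i (5 * r i))"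
    by (rule Vitali_covering_lemma_cballs[where a = "\<lambda>x. x"]) blast
  define J where "J = to_nat_on C ` C"
  define e where "e = from_nat_into C"
  have e: "e n \<in> C" if "n \<in> J" for n
    using that C(1) by (auto simp: J_def e_def)
  have e_inj: "n = m" if "n \<in> J" "m \<in> J" "e n = e m" for n m
    using that C(1) by (auto simp: J_def e_def)
  define A where "A n = (if n \<in> J then cball (e n) (5 * r (e n)) else {})" for n
  define D where "D n = (if n \<in> J then cball (e n) (r (e n)) else {})" for n
  define \<nu> where "\<nu> = density lborel (\<lambda>t. ennreal (g t))"
  have [measurable]: "g \<in> borel_measurable borel" using int by auto
  have AU: "(\<Union>i\<in>C. cball i (5 * r i)) = (\<Union>n. A n)"
  proof (intro equalityI subsetI)
    fix x assume "x \<in> (\<Union>i\<in>C. cball i (5 * r i))"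
    then obtain i where "i \<in> C" "x \<in> cball i (5 * r i)" by blast
    thus "x \<in> (\<Union>n. A n)" using C(1)
      by (intro UN_I[of "to_nat_on C i"]) (auto simp: A_def J_def e_def)
  qed (auto simp: A_def dest!: e split: if_splits)
  have A_sets: "range A \<subseteq> sets lborel" by (auto simp: A_def)
  \<comment> \<open>The enlarged ball has length 10 r = 5 * 2 r, and 2 r \<mu> is below the integral
    of g over the original ball.\<close>
  have each: "emeasure lborel (A n) \<le> ennreal (5 / \<mu>) * emeasure \<nu> (D n)" for n
  proof (cases "n \<in> J")
    case True
    define i where "i = e n"
    have ri: "r i > 0" "2 * r i * \<mu> < (LINT t|lborel. indicator (cball i (r i)) t * g t)"
      using r[of i] e[OF True] C(2) unfolding i_def by blast+
    have "emeasure lborel (A n) = ennreal (10 * r i)"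
      using ri True by (simp add: cball_eq_atLeastAtMost A_def i_def)
    also have "\<dots> \<le> ennreal (5 / \<mu> * (LINT t|lborel. indicator (cball i (r i)) t * g t))"
      using ri mu by (intro ennreal_leI) (simp add: field_simps)
    also have "\<dots> = ennreal (5 / \<mu>) * ennreal (LINT t|lborel. indicator (cball i (r i)) t * g t)"
      using mu by (intro ennreal_mult) (auto intro!: integral_nonneg_AE simp: pos)
    also have "ennreal (LINT t|lborel. indicator (cball i (r i)) t * g t)
        = (\<integral>\<^sup>+t. ennreal (indicator (cball i (r i)) t * g t) \<partial>lborel)"
      by (intro nn_integral_eq_integral[symmetric] inti) (auto simp: pos)
    also have "\<dots> = emeasure \<nu> (D n)"
      using True by (auto simp: \<nu>_def emeasure_density D_def i_def indicator_def intro!: nn_integral_cong)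
    finally show ?thesis .
  qed (simp add: A_def D_def)
  have disj: "disjoint_family D"
    unfolding disjoint_family_on_def
  proof (intro ballI impI)
    fix m n :: nat assume mn: "m \<noteq> n"
    show "D m \<inter> D n = {}"
    proof (cases "m \<in> J \<and> n \<in> J")
      case True
      hence "e m \<noteq> e n" "e m \<in> C" "e n \<in> C" using e e_inj mn by blast+
      thus ?thesis using C(3) True by (auto simp: pairwise_def disjnt_def D_def)
    qed (auto simp: D_def)
  qed
  show ?thesis
  proof (rule that[OF _ C(4)])
    show "(\<Union>i\<in>C. cball i (5 * r i)) \<in> sets borel" using C(1) by (intro sets.countable_UN') auto
    have "emeasure lborel (\<Union>i\<in>C. cball i (5 * r i)) \<le> (\<Sum>n. emeasure lborel (A n))"
      unfolding AU by (rule emeasure_subadditive_countably[OF A_sets])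
    also have "\<dots> \<le> (\<Sum>n. ennreal (5 / \<mu>) * emeasure \<nu> (D n))"
      by (intro suminf_le summableI each)
    also have "\<dots> = ennreal (5 / \<mu>) * (\<Sum>n. emeasure \<nu> (D n))" by (rule ennreal_suminf_cmult)
    also have "(\<Sum>n. emeasure \<nu> (D n)) = emeasure \<nu> (\<Union>n. D n)"
      by (intro suminf_emeasure disj) (auto simp: \<nu>_def D_def)
    also have "\<dots> \<le> emeasure \<nu> UNIV" by (intro emeasure_mono) (auto simp: \<nu>_def)
    also have "\<dots> = ennreal ?I"
      using int pos by (simp add: \<nu>_def emeasure_density nn_integral_eq_integral)
    also have "ennreal (5 / \<mu>) * ennreal ?I = ennreal (5 / \<mu> * ?I)"
      using mu by (intro ennreal_mult[symmetric]) (simp_all add: integral_nonneg_AE pos)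
    finally show "emeasure lborel (\<Union>i\<in>C. cball i (5 * r i)) \<le> ennreal (5 / \<mu> * ?I)"
      by (simp add: mult_left_mono)
  qed
qed

section \<open>Poisson kernel and its domination by dyadic averages\<close>

lemma arctan_has_bochner_integral: "has_bochner_integral lborel (\<lambda>x::real. 1 / (1 + x\<^sup>2)) pi"
proof (rule has_bochner_integral_nn_integral)
  have m[measurable]: "(\<lambda>x::real. 1 / (1 + x\<^sup>2)) \<in> borel_measurable borel" by measurable
  have half: "(\<integral>\<^sup>+x. ennreal (1 / (1 + x\<^sup>2)) * indicator {0..} x \<partial>lborel) = ennreal (pi / 2)"
  proof (subst nn_integral_FTC_atLeast[of "\<lambda>x. 1 / (1 + x\<^sup>2)" 0 arctan "pi / 2"])
    fix x :: real
    show "DERIV arctan x :> 1 / (1 + x\<^sup>2)" using DERIV_arctan[of x] by (simp add: inverse_eq_divide)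
  qed (auto intro: tendsto_arctan_at_top)
  have half': "(\<integral>\<^sup>+x. ennreal (1 / (1 + x\<^sup>2)) * indicator {..0} x \<partial>lborel) = ennreal (pi / 2)"
    unfolding half[symmetric]
    by (subst nn_integral_real_affine[where c = "-1" and t = 0]) (auto intro!: nn_integral_cong simp: indicator_def)
  have "(\<integral>\<^sup>+x. ennreal (1 / (1 + x\<^sup>2)) \<partial>lborel)
    = (\<integral>\<^sup>+x. ennreal (1 / (1 + x\<^sup>2)) * indicator {0..} x + ennreal (1 / (1 + x\<^sup>2)) * indicator {..0} x \<partial>lborel)"
    by (rule nn_integral_cong_AE) (rule AE_mp[OF AE_lborel_singleton[of 0]], auto simp: indicator_def)
  also have "\<dots> = ennreal (pi / 2) + ennreal (pi / 2)" by (simp add: nn_integral_add half half')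
  also have "\<dots> = ennreal pi" by (simp add: ennreal_plus[symmetric] del: ennreal_plus)
  finally show "(\<integral>\<^sup>+x. ennreal (1 / (1 + x\<^sup>2)) \<partial>lborel) = ennreal pi" .
qed auto

lemma Poisson_kernel_has_bochner_integral:
  fixes s u :: real
  assumes s: "s > 0"
  shows "has_bochner_integral lborel (\<lambda>t. s / ((t - u)\<^sup>2 + s\<^sup>2)) pi"
proof -
  have "has_bochner_integral lborel (\<lambda>t. 1 / (1 + (- u / s + 1 / s * t)\<^sup>2)) (pi /\<^sub>R \<bar>1 / s\<bar>)"
    using lborel_has_bochner_integral_real_affine_iff[of "1 / s" "\<lambda>x. 1 / (1 + x\<^sup>2)" pi "- u / s"]
      arctan_has_bochner_integral s by simp
  from has_bochner_integral_mult_right[OF this, of "1 / s"]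
  have "has_bochner_integral lborel (\<lambda>t. 1 / s * (1 / (1 + (- u / s + 1 / s * t)\<^sup>2))) pi"
    using s by simp
  moreover have "1 / s * (1 / (1 + (- u / s + 1 / s * t)\<^sup>2)) = s / ((t - u)\<^sup>2 + s\<^sup>2)" for t
  proof -
    have "- u / s + 1 / s * t = (t - u) / s" by (simp add: diff_divide_distrib)
    hence "1 + (- u / s + 1 / s * t)\<^sup>2 = ((t - u)\<^sup>2 + s\<^sup>2) / s\<^sup>2"
      using s by (simp add: power_divide add_divide_distrib)
    thus ?thesis using s by (simp add: power2_eq_square)
  qed
  ultimately show ?thesis by simp
qed

text \<open>Take the least k whose interval [-2^k s, 2^k s] contains t: unless k = 0, minimality
  gives |t| >= 2^(k-1) s, and this makes the kernel at most 4 / (s 4^k).\<close>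

lemma Poisson_kernel_dyadic:
  fixes t s :: real
  assumes s: "s > 0"
  obtains k :: nat where "\<bar>t\<bar> \<le> 2 ^ k * s" "s / (t\<^sup>2 + s\<^sup>2) \<le> 4 / (s * 4 ^ k)"
proof -
  have "\<exists>k::nat. \<bar>t\<bar> / s < 2 ^ k" by (rule real_arch_pow) simp
  hence ex: "\<exists>k::nat. \<bar>t\<bar> \<le> 2 ^ k * s" using s by (auto simp: field_simps intro: less_imp_le)
  define k where "k = (LEAST k::nat. \<bar>t\<bar> \<le> 2 ^ k * s)"
  have k: "\<bar>t\<bar> \<le> 2 ^ k * s" unfolding k_def using ex by (rule LeastI_ex)
  have "s * s * 4 ^ k \<le> 4 * (t\<^sup>2 + s\<^sup>2)"
  proof (cases k)
    case 0
    thus ?thesis by (simp add: power2_eq_square)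
  next
    case (Suc j)
    hence "\<not> \<bar>t\<bar> \<le> 2 ^ j * s" using not_less_Least[of j "\<lambda>k. \<bar>t\<bar> \<le> 2 ^ k * s"] by (simp add: k_def)
    hence "(2 ^ j * s)\<^sup>2 \<le> \<bar>t\<bar>\<^sup>2" using s by (intro power_mono) auto
    moreover have "(2 ^ j * s)\<^sup>2 = 4 ^ j * (s * s)"
      by (simp add: power_mult_distrib power2_eq_square flip: power_mult_distrib)
    ultimately have "4 ^ j * (s * s) \<le> t\<^sup>2" by simp
    moreover have "s * s * 4 ^ Suc j = 4 * (4 ^ j * (s * s))" by simp
    moreover have "0 \<le> s\<^sup>2" by simp
    ultimately show ?thesis unfolding Suc distrib_left by linarith
  qed
  hence "s / (t\<^sup>2 + s\<^sup>2) \<le> 4 / (s * 4 ^ k)"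
    using s by (simp add: divide_simps add_nonneg_pos)
  thus ?thesis using k that by blast
qed

text \<open>The kernel is below the sum over k of 4 / (s 4^k) times the indicator of the ball of
  radius 2^k s. Each ball contributes at most 4 / (s 4^k) * 2 (2^k s) \<mu> = 8 \<mu> / 2^k, and the
  geometric series sums to 16 \<mu>.\<close>

lemma Poisson_integral_le_averages:
  fixes g :: "real \<Rightarrow> real"
  assumes int: "integrable lborel g" and pos: "\<And>x. 0 \<le> g x" and s: "s > 0" and mu: "\<mu> \<ge> 0"
    and avg: "\<And>r. r > 0 \<Longrightarrow> (LINT t|lborel. indicator (cball u r) t * g t) \<le> 2 * r * \<mu>"
  shows "(LINT t|lborel. g t * (s / ((t - u)\<^sup>2 + s\<^sup>2))) \<le> 16 * \<mu>"
proof -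
  have m[measurable]: "g \<in> borel_measurable borel" using int by auto
  have inti: "integrable lborel (\<lambda>t. indicator A t * g t)" if "A \<in> sets borel" for A
    using integrable_mult_indicator[OF _ int, of A] that by simp
  let ?c = "\<lambda>k::nat. 4 / (s * 4 ^ k)"
  have "(\<integral>\<^sup>+t. ennreal (g t * (s / ((t - u)\<^sup>2 + s\<^sup>2))) \<partial>lborel)
     \<le> (\<integral>\<^sup>+t. (\<Sum>k. ennreal (?c k * (indicator (cball u (2 ^ k * s)) t * g t))) \<partial>lborel)"
  proof (rule nn_integral_mono)
    fix t
    obtain k where k: "\<bar>t - u\<bar> \<le> 2 ^ k * s" "s / ((t - u)\<^sup>2 + s\<^sup>2) \<le> ?c k"
      using Poisson_kernel_dyadic[OF s] by blast
    define a where "a k = ennreal (?c k * (indicator (cball u (2 ^ k * s)) t * g t))" for k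
    have ind: "indicator (cball u (2 ^ k * s)) t = (1::real)"
      using k(1) by (simp add: dist_real_def abs_minus_commute)
    have "ennreal (g t * (s / ((t - u)\<^sup>2 + s\<^sup>2))) \<le> ennreal (g t * ?c k)"
      by (intro ennreal_leI mult_left_mono k pos)
    also have "\<dots> = a k" unfolding a_def ind by (simp only: mult_1 mult.commute)
    also have "\<dots> \<le> (\<Sum>k. a k)" using sum_le_suminf[OF summableI, of "{k}" a] by simp
    also have "\<dots> = (\<Sum>k. ennreal (?c k * (indicator (cball u (2 ^ k * s)) t * g t)))" unfolding a_def ..
    finally show "ennreal (g t * (s / ((t - u)\<^sup>2 + s\<^sup>2))) \<le> \<dots>" .
  qed
  also have "\<dots> = (\<Sum>k. \<integral>\<^sup>+t. ennreal (?c k * (indicator (cball u (2 ^ k * s)) t * g t)) \<partial>lborel)"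
    by (rule nn_integral_suminf)
       (intro measurable_compose[OF _ measurable_ennreal] borel_measurable_integrable integrable_mult_right inti; simp)
  also have "\<dots> \<le> (\<Sum>k. ennreal (8 * \<mu> * (1 / 2) ^ k))"
  proof (intro suminf_le summableI)
    fix k
    have "(\<integral>\<^sup>+t. ennreal (?c k * (indicator (cball u (2 ^ k * s)) t * g t)) \<partial>lborel)
       = ennreal (LINT t|lborel. ?c k * (indicator (cball u (2 ^ k * s)) t * g t))"
      using s pos by (intro nn_integral_eq_integral integrable_mult_right inti AE_I2 mult_nonneg_nonneg) auto
    also have "\<dots> = ennreal (?c k * (LINT t|lborel. indicator (cball u (2 ^ k * s)) t * g t))"
      by (simp only: integral_mult_right_zero)
    also have "\<dots> \<le> ennreal (?c k * (2 * (2 ^ k * s) * \<mu>))"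
      using s by (intro ennreal_leI mult_left_mono avg divide_nonneg_nonneg mult_nonneg_nonneg mult_pos_pos) simp_all
    also have "?c k * (2 * (2 ^ k * s) * \<mu>) = 8 * \<mu> * (1 / 2) ^ k"
    proof -
      have "(4::real) ^ k = 2 ^ k * 2 ^ k" by (simp add: power_mult_distrib[symmetric])
      thus ?thesis using s by (simp add: divide_simps)
    qed
    finally show "(\<integral>\<^sup>+t. ennreal (?c k * (indicator (cball u (2 ^ k * s)) t * g t)) \<partial>lborel) \<le> ennreal (8 * \<mu> * (1 / 2) ^ k)" .
  qed
  also have "\<dots> = ennreal (16 * \<mu>)"
  proof -
    have "(\<lambda>k. 8 * \<mu> * (1 / 2) ^ k) sums (8 * \<mu> * 2)"
      using geometric_sums[of "1/2::real"] by (intro sums_mult) simp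
    thus ?thesis using mu by (intro suminf_ennreal_eq) (auto simp: mult.commute)
  qed
  finally have "(\<integral>\<^sup>+t. ennreal (g t * (s / ((t - u)\<^sup>2 + s\<^sup>2))) \<partial>lborel) \<le> ennreal (16 * \<mu>)" .
  moreover have "(LINT t|lborel. g t * (s / ((t - u)\<^sup>2 + s\<^sup>2)))
     = enn2real (\<integral>\<^sup>+t. ennreal (g t * (s / ((t - u)\<^sup>2 + s\<^sup>2))) \<partial>lborel)"
    using s pos by (intro integral_eq_nn_integral) (auto intro!: divide_nonneg_nonneg mult_nonneg_nonneg)
  ultimately show ?thesis using mu by (simp add: enn2real_leI)
qed

subsection \<open>Lines in the upper half plane\<close>

lemma UHP_iff [simp]: "z \<in> UHP \<longleftrightarrow> Im z > 0"
  by (simp add: UHP_def)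

lemma open_UHP: "open UHP"
  unfolding UHP_def by (rule open_halfspace_Im_gt)

lemma convex_UHP: "convex UHP"
  unfolding UHP_def by (rule convex_halfspace_Im_gt)

lemma cball_subset_UHP: "r < Im w \<Longrightarrow> cball w r \<subseteq> UHP"
proof
  fix z assume r: "r < Im w" and z: "z \<in> cball w r"
  have "\<bar>Im (w - z)\<bar> \<le> dist w z" by (metis abs_Im_le_cmod dist_norm)
  thus "z \<in> UHP" using r z by auto
qed

definition line :: "(complex \<Rightarrow> complex) \<Rightarrow> real \<Rightarrow> real \<Rightarrow> complex" where
  "line f y = (\<lambda>x. f (Complex x y))"

lemma continuous_on_Complex_line: "continuous_on A (\<lambda>x. Complex x y)"
  unfolding Complex_eq by (intro continuous_intros)

lemma continuous_on_line:
  assumes "continuous_on S f" "\<And>x. x \<in> A \<Longrightarrow> Complex x y \<in> S"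
  shows "continuous_on A (line f y)"
  unfolding line_def
  by (rule continuous_on_compose2[OF assms(1) continuous_on_Complex_line]) (use assms(2) in auto)

lemma continuous_line_UHP: "f holomorphic_on UHP \<Longrightarrow> y > 0 \<Longrightarrow> continuous_on A (line f y)"
  by (rule continuous_on_line[OF holomorphic_on_imp_continuous_on]) auto

lemma measurable_line_UHP: "f holomorphic_on UHP \<Longrightarrow> y > 0 \<Longrightarrow> line f y \<in> borel_measurable borel"
  by (intro borel_measurable_continuous_onI continuous_line_UHP)

text \<open>The function is close to its horizontal averages: their derivatives, which are its
  horizontal difference quotients, are controlled by Cauchy's inequality.\<close>

lemma line_bound_imp_pointwise_bound:
  assumes hol: "f holomorphic_on UHP" and w: "Im w > 0"
    and line: "\<And>y. y > 0 \<Longrightarrow> square_integrable (line f y) \<and> L2_norm (line f y) \<le> C"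
  shows "cmod (f w) \<le> 3 * C / sqrt (Im w)"
proof -
  define R where "R = Im w"
  have R: "R > 0" using w by (simp add: R_def)
  have C: "C \<ge> 0" using line[of 1] L2_norm_nonneg[of "line f 1"] by linarith
  \<comment> \<open>A primitive turns horizontal averages of f into differences \<Phi>(v + t) -
    \<Phi>(v), which are holomorphic in v.\<close>
  obtain \<Phi> where "\<And>x. x \<in> UHP \<Longrightarrow> (\<Phi> has_field_derivative f x) (at x within UHP)"
    using holomorphic_convex_primitive'[OF convex_UHP open_UHP hol] by blast
  hence \<Phi>: "\<And>z. Im z > 0 \<Longrightarrow> (\<Phi> has_field_derivative f z) (at z)"
    using at_within_open[OF _ open_UHP] by fastforce
  have FTC: "(LINT x|lborel. indicator {Re v..Re v + t} x *\<^sub>R line f (Im v) x) = \<Phi> (v + of_real t) - \<Phi> v"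
    if v: "Im v > 0" and t: "t \<ge> 0" for v t
  proof -
    have "(LINT x|lborel. indicator {Re v..Re v + t} x *\<^sub>R line f (Im v) x)
       = \<Phi> (Complex (Re v + t) (Im v)) - \<Phi> (Complex (Re v) (Im v))"
    proof (rule integral_FTC_Icc)
      fix x show "((\<lambda>x. \<Phi> (Complex x (Im v))) has_vector_derivative line f (Im v) x) (at x within {Re v..Re v + t})"
      proof -
        have "((\<lambda>x. Complex x (Im v)) has_vector_derivative 1) (at x within {Re v..Re v + t})"
          unfolding Complex_eq by (auto intro!: derivative_eq_intros)
        from field_vector_diff_chain_within[OF this, of \<Phi> "f (Complex x (Im v))"]
        have "((\<Phi> \<circ> (\<lambda>x. Complex x (Im v))) has_vector_derivative f (Complex x (Im v))) (at x within {Re v..Re v + t})"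
          using \<Phi>[of "Complex x (Im v)"] v by (simp add: has_field_derivative_at_within)
        thus ?thesis by (simp add: line_def comp_def)
      qed
    qed (use t v in \<open>auto intro: continuous_line_UHP[OF hol]\<close>)
    moreover have "Complex (Re v + t) (Im v) = v + of_real t" by (simp add: complex_eq_iff)
    ultimately show ?thesis by simp
  qed
  have avg: "cmod (\<Phi> (v + of_real t) - \<Phi> v) \<le> sqrt t * C" if v: "Im v > 0" and t: "t \<ge> 0" for v t
  proof -
    define h where "h x = complex_of_real (indicator {Re v..Re v + t} x)" for x
    have m[measurable]: "h \<in> borel_measurable borel" unfolding h_def by measurable
    have "(\<integral>\<^sup>+x. ennreal ((cmod (h x))\<^sup>2) \<partial>lborel) = (\<integral>\<^sup>+x. indicator {Re v..Re v + t} x \<partial>lborel)"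
      by (intro nn_integral_cong) (auto simp: h_def indicator_def)
    also have "\<dots> = ennreal ((sqrt t)\<^sup>2)" using t by simp
    finally have "square_integrable h" "L2_norm h \<le> sqrt t"
      using square_integrableI[OF m, of "sqrt t"] t by auto
    moreover have "L2_inner (line f (Im v)) h = \<Phi> (v + of_real t) - \<Phi> v"
      unfolding FTC[OF v t, symmetric] L2_inner_def h_def
      by (simp add: scaleR_conv_of_real mult.commute)
    ultimately have "cmod (\<Phi> (v + of_real t) - \<Phi> v) \<le> L2_norm (line f (Im v)) * L2_norm h"
      using L2_Cauchy_Schwarz[of "line f (Im v)" h] line[OF v] by simp
    also have "\<dots> \<le> C * sqrt t"
      using line[OF v] \<open>L2_norm h \<le> sqrt t\<close> C by (intro mult_mono) auto
    finally show ?thesis by (simp add: mult.commute)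
  qed
  \<comment> \<open>A minimiser of |f| on a segment of length \<open>R\<close>: its value is at most
    the quadratic mean there, hence at most C / sqrt R.\<close>
  obtain x0 where x0: "x0 \<in> {Re w..Re w + R}"
      "\<And>x. x \<in> {Re w..Re w + R} \<Longrightarrow> cmod (line f R x0) \<le> cmod (line f R x)"
  proof -
    have "\<exists>x\<in>{Re w..Re w + R}. \<forall>y\<in>{Re w..Re w + R}. cmod (line f R x) \<le> cmod (line f R y)"
      using R by (intro continuous_attains_inf continuous_intros continuous_line_UHP hol) auto
    thus ?thesis using that by blast
  qed
  have "R * (cmod (line f R x0))\<^sup>2 = (LINT x|lborel. indicator {Re w..Re w + R} x * (cmod (line f R x0))\<^sup>2)"
    using R by simp
  also have "\<dots> \<le> (LINT x|lborel. (cmod (line f R x))\<^sup>2)"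
  proof (rule integral_mono)
    show "integrable lborel (\<lambda>x. indicator {Re w..Re w + R} x * (cmod (line f R x0))\<^sup>2)"
      using R by (intro integrable_mult_left) (auto simp: integrable_indicator_iff)
    show "integrable lborel (\<lambda>x. (cmod (line f R x))\<^sup>2)"
      using line[OF R] by (simp add: square_integrable_def)
  qed (use x0 in \<open>auto simp: indicator_def intro!: power_mono\<close>)
  also have "\<dots> \<le> C\<^sup>2"
    using line[OF R] by (simp add: L2_norm_power2[symmetric] power_mono)
  finally have "(cmod (line f R x0))\<^sup>2 \<le> (C / sqrt R)\<^sup>2" using R by (simp add: power_divide field_simps)
  hence near: "cmod (line f R x0) \<le> C / sqrt R" using C R by (auto intro: power2_le_imp_le)
  define t where "t = x0 - Re w"
  have t: "0 \<le> t" "t \<le> R" using x0(1) by (auto simp: t_def)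
  have wt: "w + of_real t = Complex x0 R" by (simp add: complex_eq_iff t_def R_def)
  \<comment> \<open>\<open>F\<close> is bounded by sqrt t * C and has derivative f(v + t) - f(v).
    Cauchy's inequality on the disc of radius R / 2 compares f at \<open>w\<close> with f at the
    minimiser, at cost 2 C / sqrt R; together with C / sqrt R this is the factor 3.\<close>
  define F where "F v = \<Phi> (v + of_real t) - \<Phi> v" for v
  have F': "(F has_field_derivative (f (v + of_real t) - f v)) (at v)" if "Im v > 0" for v
    unfolding F_def using that
    by (auto intro!: derivative_eq_intros DERIV_chain2[OF \<Phi>])
  have "norm ((deriv ^^ 1) F w) \<le> fact 1 * (sqrt t * C) / (R / 2) ^ 1"
  proof (rule Cauchy_inequality)
    have sub: "cball w (R / 2) \<subseteq> UHP" using R by (intro cball_subset_UHP) (simp add: R_def)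
    have hF: "F holomorphic_on UHP" unfolding holomorphic_on_open[OF open_UHP] by (metis F' UHP_iff)
    show "F holomorphic_on ball w (R / 2)" by (rule holomorphic_on_subset[OF hF]) (use sub in auto)
    show "continuous_on (cball w (R / 2)) F"
      by (rule holomorphic_on_imp_continuous_on[OF holomorphic_on_subset[OF hF sub]])
    fix x assume "norm (w - x) = R / 2"
    hence "x \<in> UHP" using sub by (auto simp: dist_norm)
    thus "norm (F x) \<le> sqrt t * C" unfolding F_def using avg t by simp
  qed (use R in simp)
  moreover have "deriv F w = f (w + of_real t) - f w" using F'[OF w] by (rule DERIV_imp_deriv)
  ultimately have "cmod (f (w + of_real t) - f w) \<le> sqrt t * C / (R / 2)" by simp
  also have "\<dots> \<le> sqrt R * C / (R / 2)" using t R C by (intro divide_right_mono mult_right_mono) auto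
  also have "\<dots> = 2 * C / sqrt R" using R by (simp add: field_simps)
  finally have "cmod (f w) \<le> C / sqrt R + 2 * C / sqrt R"
    using near norm_triangle_ineq4[of "f (w + of_real t)" "f (w + of_real t) - f w"]
    by (simp add: wt line_def)
  thus ?thesis using R by (simp add: R_def add_divide_distrib[symmetric])
qed

section \<open>Contour shifts between horizontal lines\<close>

lemma integral_indicator_LIMSEQ:
  fixes g :: "real \<Rightarrow> complex"
  assumes "integrable lborel g"
  shows "(\<lambda>n. LINT x|lborel. indicator {- real n..real n} x *\<^sub>R g x) \<longlonglongrightarrow> (LINT x|lborel. g x)"
proof (rule integral_dominated_convergence[where w = "\<lambda>x. cmod (g x)"])
  show "AE x in lborel. (\<lambda>n. indicator {- real n..real n} x *\<^sub>R g x) \<longlonglongrightarrow> g x"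
  proof (rule AE_I2)
    fix x :: real
    obtain N where N: "\<bar>x\<bar> \<le> real N" using real_arch_simple by blast
    have "eventually (\<lambda>n. indicator {- real n..real n} x *\<^sub>R g x = g x) sequentially"
      using eventually_ge_at_top[of N]
    proof eventually_elim
      case (elim n)
      hence "real N \<le> real n" by simp
      thus ?case using N by (auto simp: indicator_def)
    qed
    thus "(\<lambda>n. indicator {- real n..real n} x *\<^sub>R g x) \<longlonglongrightarrow> g x" by (rule tendsto_eventually)
  qed
qed (use assms in \<open>auto simp: indicator_def\<close>)

text \<open>The factor $1/(1 + ((z - ic)/N)^2)$ supplies the decay that closes the contour at infinity;
  it tends to $1$ boundedly as $N \to \infty$.\<close>

lemma strip_decay_factor_bound:
  assumes N: "N > 0" and s: "c \<le> Im z" "Im z - c \<le> N / 2"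
  shows "1/2 + (Re z)\<^sup>2 / N\<^sup>2 \<le> cmod (1 + ((z - \<i> * of_real c) / of_real N)\<^sup>2)"
proof -
  have "(Im z - c)\<^sup>2 \<le> (N / 2)\<^sup>2" using s N by (intro power_mono) auto
  hence "(Im z - c)\<^sup>2 / N\<^sup>2 \<le> 1/4" using N by (simp add: divide_simps power_divide)
  moreover have "Re (1 + ((z - \<i> * of_real c) / of_real N)\<^sup>2) = 1 + (Re z)\<^sup>2 / N\<^sup>2 - (Im z - c)\<^sup>2 / N\<^sup>2"
  proof -
    have "Re (((z - \<i> * of_real c) / of_real N)\<^sup>2) = (Re z / N)\<^sup>2 - ((Im z - c) / N)\<^sup>2"
      by (simp add: power2_eq_square diff_divide_distrib)
    thus ?thesis by (simp add: power_divide)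
  qed
  ultimately show ?thesis using complex_Re_le_cmod[of "1 + ((z - \<i> * of_real c) / of_real N)\<^sup>2"] by linarith
qed

text \<open>Cauchy's theorem on rectangles between Re z = -n and Re z = n, by way of a primitive on
  the closed convex strip; the vertical sides have fixed length and the integrand there is O(1 /
  n^2).\<close>

lemma strip_integral_eq_decay:
  assumes cd: "c < d" and cont: "continuous_on {z. c \<le> Im z \<and> Im z \<le> d} h"
    and hol: "h holomorphic_on {z. c < Im z \<and> Im z < d}"
    and decay: "\<And>z. \<lbrakk>c \<le> Im z; Im z \<le> d; Re z \<noteq> 0\<rbrakk> \<Longrightarrow> cmod (h z) \<le> K / (Re z)\<^sup>2"
    and ic: "integrable lborel (line h c)" and id: "integrable lborel (line h d)"
  shows "(LINT x|lborel. line h c x) = (LINT x|lborel. line h d x)"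
proof -
  let ?S = "{z. c \<le> Im z \<and> Im z \<le> d}"
  have convS: "convex ?S"
    using convex_Int[OF convex_halfspace_Im_ge convex_halfspace_Im_le] by (simp add: Collect_conj_eq)
  have int: "c < Im x \<and> Im x < d" if "x \<in> interior ?S" for x
  proof -
    obtain e where e: "e > 0" "cball x e \<subseteq> ?S" using \<open>x \<in> interior ?S\<close> mem_interior_cball by blast
    have "x + \<i> * of_real e \<in> cball x e" "x - \<i> * of_real e \<in> cball x e"
      using e(1) by (auto simp: dist_norm norm_mult)
    hence "x + \<i> * of_real e \<in> ?S" "x - \<i> * of_real e \<in> ?S" using e(2) by blast+
    thus ?thesis using e(1) by simp
  qed
  have oS: "open {z. c < Im z \<and> Im z < d}"
    using open_Int[OF open_halfspace_Im_gt open_halfspace_Im_lt] by (simp add: Collect_conj_eq)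
  obtain \<Phi> where \<Phi>: "\<And>x. x \<in> ?S \<Longrightarrow> (\<Phi> has_field_derivative h x) (at x within ?S)"
  proof (rule holomorphic_convex_primitive[OF convS finite.emptyI cont])
    show "h field_differentiable at x" if "x \<in> interior ?S - {}" for x
      using holomorphic_on_imp_differentiable_at[OF hol oS] int that by auto
  qed blast
  have FTC: "(LINT x|lborel. indicator {- real n..real n} x *\<^sub>R line h y x) = \<Phi> (Complex (real n) y) - \<Phi> (Complex (- real n) y)"
    if y: "c \<le> y" "y \<le> d" for y n
  proof (rule integral_FTC_Icc)
    fix x :: real
    have "((\<lambda>x. Complex x y) has_vector_derivative 1) (at x within {- real n..real n})"
      unfolding Complex_eq by (auto intro!: derivative_eq_intros)
    from field_vector_diff_chain_within[OF this, of \<Phi> "h (Complex x y)"]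
    have "((\<Phi> \<circ> (\<lambda>x. Complex x y)) has_vector_derivative h (Complex x y)) (at x within {- real n..real n})"
      using DERIV_subset[OF \<Phi>, of "Complex x y" "(\<lambda>x. Complex x y) ` {- real n..real n}"] y
      by (simp add: image_subset_iff)
    thus "((\<lambda>x. \<Phi> (Complex x y)) has_vector_derivative line h y x) (at x within {- real n..real n})"
      by (simp add: line_def comp_def)
  next
    show "continuous_on {- real n..real n} (line h y)" by (rule continuous_on_line[OF cont]) (use y in auto)
  qed simp
  have side: "cmod (\<Phi> (Complex x d) - \<Phi> (Complex x c)) \<le> K / x\<^sup>2 * (d - c)" if x: "x \<noteq> 0" for x
  proof -
    let ?L = "closed_segment (Complex x c) (Complex x d)"
    have L: "Re z = x \<and> c \<le> Im z \<and> Im z \<le> d" if "z \<in> ?L" for z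
      using that cd by (auto simp: closed_segment_same_Re closed_segment_eq_real_ivl)
    have "cmod (\<Phi> (Complex x d) - \<Phi> (Complex x c)) \<le> K / x\<^sup>2 * cmod (Complex x d - Complex x c)"
    proof (rule field_differentiable_bound[of ?L])
      fix z assume z: "z \<in> ?L"
      show "(\<Phi> has_field_derivative h z) (at z within ?L)"
        by (rule DERIV_subset[OF \<Phi>]) (use L[OF z] L in auto)
      show "cmod (h z) \<le> K / x\<^sup>2" using decay[of z] L[OF z] x by simp
    qed auto
    also have "cmod (Complex x d - Complex x c) = d - c" using cd by (simp add: cmod_def)
    finally show ?thesis .
  qed
  have inv: "(\<lambda>n. K / (real n)\<^sup>2 * (d - c)) \<longlonglongrightarrow> 0"
  proof -
    have "(\<lambda>n. K * (1 / real n) * (1 / real n) * (d - c)) \<longlonglongrightarrow> K * 0 * 0 * (d - c)"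
      by (intro tendsto_intros lim_1_over_n)
    thus ?thesis by (simp add: power2_eq_square)
  qed
  have side0: "(\<lambda>n. \<Phi> (Complex (real n) d) - \<Phi> (Complex (real n) c)) \<longlonglongrightarrow> 0"
    "(\<lambda>n. \<Phi> (Complex (- real n) d) - \<Phi> (Complex (- real n) c)) \<longlonglongrightarrow> 0"
  proof -
    show "(\<lambda>n. \<Phi> (Complex (real n) d) - \<Phi> (Complex (real n) c)) \<longlonglongrightarrow> 0"
      by (rule Lim_null_comparison[OF _ inv], rule eventually_mono[OF eventually_gt_at_top[of 0]])
         (use side in force)
    show "(\<lambda>n. \<Phi> (Complex (- real n) d) - \<Phi> (Complex (- real n) c)) \<longlonglongrightarrow> 0"
      by (rule Lim_null_comparison[OF _ inv], rule eventually_mono[OF eventually_gt_at_top[of 0]])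
         (use side[of "- real _"] in force)
  qed
  have "(\<lambda>n. (LINT x|lborel. indicator {- real n..real n} x *\<^sub>R line h d x)
      - (LINT x|lborel. indicator {- real n..real n} x *\<^sub>R line h c x)) \<longlonglongrightarrow> 0 - 0"
    using tendsto_diff[OF side0] cd by (simp add: FTC algebra_simps)
  moreover have "(\<lambda>n. (LINT x|lborel. indicator {- real n..real n} x *\<^sub>R line h d x)
      - (LINT x|lborel. indicator {- real n..real n} x *\<^sub>R line h c x))
      \<longlonglongrightarrow> (LINT x|lborel. line h d x) - (LINT x|lborel. line h c x)"
    by (intro tendsto_diff integral_indicator_LIMSEQ ic id)
  ultimately show ?thesis using LIMSEQ_unique by fastforce
qed

text \<open>The damped functions h q_n fall under \<open>strip_integral_eq_decay\<close>, and |q_n|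
  <= 2 lets dominated convergence remove the damping. Boundedness is the form of hypothesis that
  functions in \<open>H2\<close> satisfy away from the real line.\<close>

lemma strip_integral_eq:
  assumes cd: "c < d" and cont: "continuous_on {z. c \<le> Im z \<and> Im z \<le> d} h"
    and hol: "h holomorphic_on {z. c < Im z \<and> Im z < d}"
    and bd: "\<And>z. \<lbrakk>c \<le> Im z; Im z \<le> d\<rbrakk> \<Longrightarrow> cmod (h z) \<le> K"
    and ic: "integrable lborel (line h c)" and id: "integrable lborel (line h d)"
  shows "(LINT x|lborel. line h c x) = (LINT x|lborel. line h d x)"
proof -
  \<comment> \<open>At least twice the width of the strip, which keeps the denominator of
    \<open>q\<close> away from 0 by \<open>strip_decay_factor_bound\<close>.\<close>
  define N where "N n = 2 * (d - c) + real n" for n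
  define q where "q n z = 1 / (1 + ((z - \<i> * of_real c) / of_real (N n))\<^sup>2)" for n z
  define hq where "hq n z = h z * q n z" for n z
  have N: "N n > 0" "d - c \<le> N n / 2" for n using cd by (auto simp: N_def)
  have K: "K \<ge> 0" using bd[of "Complex 0 c"] cd norm_ge_zero[of "h (Complex 0 c)"] by (simp del: norm_ge_zero)
  have den: "1/2 + (Re z)\<^sup>2 / (N n)\<^sup>2 \<le> cmod (1 + ((z - \<i> * of_real c) / of_real (N n))\<^sup>2)"
    if "c \<le> Im z" "Im z \<le> d" for z n
    by (rule strip_decay_factor_bound) (use N[of n] that in auto)
  have den0: "1 + ((z - \<i> * of_real c) / of_real (N n))\<^sup>2 \<noteq> 0" if "c \<le> Im z" "Im z \<le> d" for z n
  proof -
    have "0 < 1/2 + (Re z)\<^sup>2 / (N n)\<^sup>2" by (simp add: add_pos_nonneg)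
    thus ?thesis using den[OF that, of n] by force
  qed
  have q2: "cmod (q n z) \<le> 2" if "c \<le> Im z" "Im z \<le> d" for z n
  proof -
    have "0 \<le> (Re z)\<^sup>2 / (N n)\<^sup>2" by simp
    hence "1/2 \<le> cmod (1 + ((z - \<i> * of_real c) / of_real (N n))\<^sup>2)" using den[OF that, of n] by linarith
    thus ?thesis unfolding q_def norm_divide by (simp add: divide_simps)
  qed
  have qd: "cmod (q n z) \<le> (N n)\<^sup>2 / (Re z)\<^sup>2" if "c \<le> Im z" "Im z \<le> d" "Re z \<noteq> 0" for z n
  proof -
    have pos: "0 < (Re z)\<^sup>2 / (N n)\<^sup>2" using N(1)[of n] that by simp
    have "(Re z)\<^sup>2 / (N n)\<^sup>2 \<le> cmod (1 + ((z - \<i> * of_real c) / of_real (N n))\<^sup>2)"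
      using den[OF that(1,2), of n] by linarith
    hence "1 / cmod (1 + ((z - \<i> * of_real c) / of_real (N n))\<^sup>2) \<le> 1 / ((Re z)\<^sup>2 / (N n)\<^sup>2)"
      using pos by (intro divide_left_mono mult_pos_pos) auto
    thus ?thesis unfolding q_def norm_divide by simp
  qed
  have mq: "line (hq n) y \<in> borel_measurable lborel" and iq: "integrable lborel (line (hq n) y)"
      and bq: "cmod (line (hq n) y x) \<le> 2 * cmod (line h y x)"
    if y: "y = c \<or> y = d" for y n x
  proof -
    have bq: "cmod (line (hq n) y x) \<le> 2 * cmod (line h y x)" for x
      using mult_left_mono[OF q2[of "Complex x y" n], of "cmod (h (Complex x y))"] y cd
      by (auto simp: hq_def line_def norm_mult mult.commute)
    have "continuous_on {z. c \<le> Im z \<and> Im z \<le> d} (hq n)"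
      unfolding hq_def q_def using den0 N(1)[of n] by (intro continuous_intros cont) auto
    hence "continuous_on UNIV (line (hq n) y)" by (rule continuous_on_line) (use y cd in auto)
    thus "line (hq n) y \<in> borel_measurable lborel" by (simp add: borel_measurable_continuous_onI)
    note m = this
    have "integrable lborel (\<lambda>x. 2 * cmod (line h y x))" using ic id y by auto
    thus "integrable lborel (line (hq n) y)"
      by (rule Bochner_Integration.integrable_bound[OF _ m]) (simp add: bq)
    show "cmod (line (hq n) y x) \<le> 2 * cmod (line h y x)" by (rule bq)
  qed
  have eq: "(LINT x|lborel. line (hq n) c x) = (LINT x|lborel. line (hq n) d x)" for n
  proof (rule strip_integral_eq_decay[OF cd])
    show "continuous_on {z. c \<le> Im z \<and> Im z \<le> d} (hq n)"
      unfolding hq_def q_def using den0 N(1)[of n] by (intro continuous_intros cont) auto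
    show "hq n holomorphic_on {z. c < Im z \<and> Im z < d}"
      unfolding hq_def q_def using den0 N(1)[of n] by (intro holomorphic_intros hol) auto
    show "cmod (hq n z) \<le> (K * (N n)\<^sup>2) / (Re z)\<^sup>2" if "c \<le> Im z" "Im z \<le> d" "Re z \<noteq> 0" for z
      using mult_mono[OF bd[OF that(1,2)] qd[OF that] K] by (simp add: hq_def norm_mult)
  qed (auto intro: iq)
  have lim: "(\<lambda>n. LINT x|lborel. line (hq n) y x) \<longlonglongrightarrow> (LINT x|lborel. line h y x)" if y: "y = c \<or> y = d" for y
  proof (rule integral_dominated_convergence[where w = "\<lambda>x. 2 * cmod (line h y x)"])
    show "integrable lborel (\<lambda>x. 2 * cmod (line h y x))" "line h y \<in> borel_measurable lborel" using ic id y by auto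
    show "line (hq n) y \<in> borel_measurable lborel" for n by (rule mq[OF y])
    show "AE x in lborel. norm (line (hq n) y x) \<le> 2 * cmod (line h y x)" for n by (intro AE_I2 bq[OF y])
    have Ninv: "(\<lambda>n. 1 / N n) \<longlonglongrightarrow> 0"
      unfolding N_def by (intro real_tendsto_divide_at_top[OF tendsto_const] filterlim_tendsto_add_at_top[OF tendsto_const] filterlim_real_sequentially)
    have "(\<lambda>n. line (hq n) y x) \<longlonglongrightarrow> line h y x" for x
    proof -
      let ?v = "Complex x y - \<i> * of_real c"
      have "(\<lambda>n. h (Complex x y) * (1 / (1 + (?v * of_real (1 / N n))\<^sup>2))) \<longlonglongrightarrow> h (Complex x y) * (1 / (1 + (?v * of_real 0)\<^sup>2))"
        by (intro tendsto_intros Ninv) auto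
      thus ?thesis by (simp add: line_def hq_def q_def)
    qed
    thus "AE x in lborel. (\<lambda>n. line (hq n) y x) \<longlonglongrightarrow> line h y x" by simp
  qed
  have "(\<lambda>n. LINT x|lborel. line (hq n) c x) \<longlonglongrightarrow> (LINT x|lborel. line h d x)" unfolding eq by (rule lim) simp
  thus ?thesis using LIMSEQ_unique[OF lim[of c]] by simp
qed

subsection \<open>The Hardy space \<open>H\<^sup>2\<close>\<close>

text \<open>The norm as a supremum over lines, usable before boundary values are known to exist;
  \<open>H2_norm_eq_sup\<close> later identifies it with \<open>H2_norm\<close>.\<close>

definition H2_sup :: "(complex \<Rightarrow> complex) \<Rightarrow> real" where
  "H2_sup f = sqrt (enn2real (SUP y\<in>{0<..}. \<integral>\<^sup>+x. ennreal ((cmod (f (Complex x y)))\<^sup>2) \<partial>lborel))"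

lemma H2_holomorphic: "f \<in> H2 \<Longrightarrow> f holomorphic_on UHP"
  by (simp add: H2_def)

lemma H2_off: "f \<in> H2 \<Longrightarrow> \<not> Im z > 0 \<Longrightarrow> f z = 0"
  by (simp add: H2_def)

lemma H2_sup_nonneg [simp]: "0 \<le> H2_sup f"
  by (simp add: H2_sup_def)

lemma H2_line:
  assumes f: "f \<in> H2" and y: "y > 0"
  shows "square_integrable (line f y)" "L2_norm (line f y) \<le> H2_sup f"
proof -
  let ?S = "SUP y\<in>{0<..}. \<integral>\<^sup>+x. ennreal ((cmod (f (Complex x y)))\<^sup>2) \<partial>lborel"
  have fin: "?S < \<infinity>" using f by (simp add: H2_def)
  have "(\<integral>\<^sup>+x. ennreal ((cmod (line f y x))\<^sup>2) \<partial>lborel) \<le> ?S"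
    unfolding line_def by (rule SUP_upper) (use y in simp)
  also have "?S = ennreal ((H2_sup f)\<^sup>2)" using fin by (simp add: H2_sup_def)
  finally have "(\<integral>\<^sup>+x. ennreal ((cmod (line f y x))\<^sup>2) \<partial>lborel) \<le> ennreal ((H2_sup f)\<^sup>2)" .
  from square_integrableI[OF measurable_line_UHP[OF H2_holomorphic[OF f] y] this]
  show "square_integrable (line f y)" "L2_norm (line f y) \<le> H2_sup f" by simp_all
qed

lemma H2I:
  assumes hol: "f holomorphic_on UHP" and off: "\<And>z. \<not> Im z > 0 \<Longrightarrow> f z = 0"
    and line: "\<And>y. y > 0 \<Longrightarrow> square_integrable (line f y) \<and> L2_norm (line f y) \<le> C"
  shows "f \<in> H2" "H2_sup f \<le> C"
proof -
  have C: "C \<ge> 0" using line[of 1] L2_norm_nonneg[of "line f 1"] by linarith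
  have le: "(SUP y\<in>{0<..}. \<integral>\<^sup>+x. ennreal ((cmod (f (Complex x y)))\<^sup>2) \<partial>lborel) \<le> ennreal (C\<^sup>2)"
  proof (rule SUP_least)
    fix y :: real assume "y \<in> {0<..}"
    hence l: "square_integrable (line f y)" "L2_norm (line f y) \<le> C" using line by auto
    have "(\<integral>\<^sup>+x. ennreal ((cmod (f (Complex x y)))\<^sup>2) \<partial>lborel) = ennreal ((L2_norm (line f y))\<^sup>2)"
      using nn_integral_square_integrable[OF l(1)] by (simp add: line_def)
    also have "\<dots> \<le> ennreal (C\<^sup>2)" using l(2) by (intro ennreal_leI power_mono) auto
    finally show "(\<integral>\<^sup>+x. ennreal ((cmod (f (Complex x y)))\<^sup>2) \<partial>lborel) \<le> ennreal (C\<^sup>2)" .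
  qed
  show "f \<in> H2" using hol off le_less_trans[OF le] by (auto simp: H2_def)
  have "enn2real (SUP y\<in>{0<..}. \<integral>\<^sup>+x. ennreal ((cmod (f (Complex x y)))\<^sup>2) \<partial>lborel) \<le> C\<^sup>2"
    using le by (intro enn2real_leI) auto
  thus "H2_sup f \<le> C" unfolding H2_sup_def using C by (metis real_sqrt_le_iff real_sqrt_unique)
qed

lemma line_simps:
  "line (\<lambda>z. f z + g z) y = (\<lambda>x. line f y x + line g y x)"
  "line (\<lambda>z. f z - g z) y = (\<lambda>x. line f y x - line g y x)"
  "line (\<lambda>z. c * f z) y = (\<lambda>x. c * line f y x)"
  "line (\<lambda>z. f z * g z) y = (\<lambda>x. line f y x * line g y x)"
  by (auto simp: line_def)

lemma H2_zero [simp]: "(\<lambda>z. 0) \<in> H2"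
  by (rule H2I[of _ 0]) (auto simp: line_def L2_norm_def)

lemma H2_add: assumes "f \<in> H2" "g \<in> H2" shows "(\<lambda>z. f z + g z) \<in> H2"
proof (rule H2I)
  fix y :: real assume y: "y > 0"
  show "square_integrable (line (\<lambda>z. f z + g z) y) \<and> L2_norm (line (\<lambda>z. f z + g z) y) \<le> H2_sup f + H2_sup g"
    unfolding line_simps
    using H2_line[OF assms(1) y] H2_line[OF assms(2) y] square_integrable_add L2_norm_triangle
    by (meson add_mono order_trans)
qed (use assms in \<open>auto intro!: holomorphic_on_add simp: H2_holomorphic H2_off\<close>)

lemma L2_norm_bounded_mult:
  assumes g: "square_integrable g" and p[measurable]: "p \<in> borel_measurable borel"
    and bd: "AE x in lborel. cmod (p x) \<le> K" and K: "K \<ge> 0"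
  shows "L2_norm (\<lambda>x. p x * g x) \<le> K * L2_norm g"
proof (rule power2_le_imp_le)
  have "(L2_norm (\<lambda>x. p x * g x))\<^sup>2 \<le> (LINT x|lborel. K\<^sup>2 * (cmod (g x))\<^sup>2)"
    unfolding L2_norm_power2
  proof (rule integral_mono_AE)
    show "integrable lborel (\<lambda>x. (cmod (p x * g x))\<^sup>2)"
      using square_integrable_bounded_mult[OF g p bd] by (simp add: square_integrable_def)
    show "integrable lborel (\<lambda>x. K\<^sup>2 * (cmod (g x))\<^sup>2)" using g by (simp add: square_integrable_def)
    show "AE x in lborel. (cmod (p x * g x))\<^sup>2 \<le> K\<^sup>2 * (cmod (g x))\<^sup>2"
      using bd by eventually_elim
        (simp add: norm_mult power_mult_distrib mult_right_mono power_mono)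
  qed
  thus "(L2_norm (\<lambda>x. p x * g x))\<^sup>2 \<le> (K * L2_norm g)\<^sup>2"
    by (simp add: L2_norm_power2 power_mult_distrib)
qed (use K in simp)

lemma H2_bounded_mult:
  assumes f: "f \<in> H2" and hol: "b holomorphic_on UHP" and bd: "\<And>z. Im z > 0 \<Longrightarrow> cmod (b z) \<le> K"
  shows "(\<lambda>z. b z * f z) \<in> H2"
proof (rule H2I)
  have K: "K \<ge> 0" using bd[of \<i>] norm_ge_zero[of "b \<i>"] by (simp del: norm_ge_zero)
  fix y :: real assume y: "y > 0"
  have m: "line b y \<in> borel_measurable borel" by (rule measurable_line_UHP[OF hol y])
  have bd': "AE x in lborel. cmod (line b y x) \<le> K" using bd y by (auto simp: line_def)
  have "L2_norm (\<lambda>x. line b y x * line f y x) \<le> K * L2_norm (line f y)"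
    by (rule L2_norm_bounded_mult[OF H2_line(1)[OF f y] m bd' K])
  also have "\<dots> \<le> K * H2_sup f" by (intro mult_left_mono H2_line f y K)
  finally show "square_integrable (line (\<lambda>z. b z * f z) y) \<and> L2_norm (line (\<lambda>z. b z * f z) y) \<le> K * H2_sup f"
    unfolding line_simps using square_integrable_bounded_mult[OF H2_line(1)[OF f y] m bd'] by blast
qed (use f hol in \<open>auto intro!: holomorphic_on_mult simp: H2_holomorphic H2_off\<close>)

lemma H2_cmult: "f \<in> H2 \<Longrightarrow> (\<lambda>z. c * f z) \<in> H2"
  by (rule H2_bounded_mult[of _ _ "cmod c"]) auto

lemma H2_diff: "\<lbrakk>f \<in> H2; g \<in> H2\<rbrakk> \<Longrightarrow> (\<lambda>z. f z - g z) \<in> H2"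
  using H2_add[OF _ H2_cmult[of g "-1"], of f] by simp

lemma H2_pointwise_bound: "f \<in> H2 \<Longrightarrow> Im w > 0 \<Longrightarrow> cmod (f w) \<le> 3 * H2_sup f / sqrt (Im w)"
  by (rule line_bound_imp_pointwise_bound) (auto intro: H2_holomorphic H2_line)

lemma H2_half_plane_bound:
  assumes f: "f \<in> H2" and a: "0 < a" and z: "a \<le> Im z"
  shows "cmod (f z) \<le> 3 * H2_sup f / sqrt a"
proof -
  have "cmod (f z) \<le> 3 * H2_sup f / sqrt (Im z)" using H2_pointwise_bound[OF f] z a by simp
  also have "\<dots> \<le> 3 * H2_sup f / sqrt a" using z a by (intro divide_left_mono) auto
  finally show ?thesis .
qed

subsection \<open>The Cauchy and Poisson formulas\<close>

lemma cmod_power2_line: "(cmod (Complex x a - w))\<^sup>2 = (x - Re w)\<^sup>2 + (a - Im w)\<^sup>2"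
  by (simp add: cmod_power2)

lemma Cauchy_kernel_L2:
  assumes "Im w \<noteq> a"
  shows "square_integrable (\<lambda>x. 1 / (Complex x a - w))"
    "L2_norm (\<lambda>x. 1 / (Complex x a - w)) = sqrt (pi / \<bar>a - Im w\<bar>)"
proof -
  let ?s = "\<bar>a - Im w\<bar>"
  have s: "?s > 0" using assms by simp
  have eq: "(cmod (1 / (Complex x a - w)))\<^sup>2 = 1 / ?s * (?s / ((x - Re w)\<^sup>2 + ?s\<^sup>2))" for x
    using s by (simp add: norm_divide power_divide cmod_power2_line)
  have h: "has_bochner_integral lborel (\<lambda>x. (cmod (1 / (Complex x a - w)))\<^sup>2) (1 / ?s * pi)"
    unfolding eq by (rule has_bochner_integral_mult_right[OF Poisson_kernel_has_bochner_integral[OF s]])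
  have ne: "Complex x a - w \<noteq> 0" for x using assms by (auto simp: complex_eq_iff)
  have "(\<lambda>x. 1 / (Complex x a - w)) \<in> borel_measurable borel"
    by (intro borel_measurable_continuous_onI continuous_intros continuous_on_Complex_line) (use ne in auto)
  thus "square_integrable (\<lambda>x. 1 / (Complex x a - w))"
    using h by (auto simp: square_integrable_def has_bochner_integral_iff)
  show "L2_norm (\<lambda>x. 1 / (Complex x a - w)) = sqrt (pi / ?s)"
    unfolding L2_norm_def using h by (simp add: has_bochner_integral_iff del: power_divide)
qed

lemma line_integral_bound:
  assumes "f \<in> H2" "a > 0" "Im w \<noteq> a"
  shows "integrable lborel (\<lambda>x. line f a x / (Complex x a - w))"
    "cmod (LINT x|lborel. line f a x / (Complex x a - w)) \<le> H2_sup f * sqrt (pi / \<bar>a - Im w\<bar>)"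
proof -
  note sq = H2_line(1)[OF assms(1,2)] Cauchy_kernel_L2(1)[OF assms(3)]
  show "integrable lborel (\<lambda>x. line f a x / (Complex x a - w))"
    using integrable_mult_square_integrable(2)[OF sq] by simp
  have "cmod (LINT x|lborel. line f a x / (Complex x a - w)) \<le> (LINT x|lborel. cmod (line f a x / (Complex x a - w)))"
    by (rule integral_norm_bound)
  also have "\<dots> = (LINT x|lborel. cmod (line f a x) * cmod (1 / (Complex x a - w)))"
    by (simp add: norm_divide)
  also have "\<dots> \<le> L2_norm (line f a) * L2_norm (\<lambda>x. 1 / (Complex x a - w))"
    by (rule L2_Cauchy_Schwarz_abs[OF sq])
  also have "\<dots> \<le> H2_sup f * sqrt (pi / \<bar>a - Im w\<bar>)"
    unfolding Cauchy_kernel_L2(2)[OF assms(3)] by (intro mult_right_mono H2_line assms) simp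
  finally show "cmod (LINT x|lborel. line f a x / (Complex x a - w)) \<le> H2_sup f * sqrt (pi / \<bar>a - Im w\<bar>)" .
qed

text \<open>For letting a horizontal line go to infinity: the L^2 norm of the Cauchy kernel on the
  line of height d decays like the inverse square root of d - v, so a quantity independent of d
  under such a bound must vanish.\<close>

lemma sqrt_decay_imp_zero:
  fixes L K v :: real
  assumes "\<And>d. d > v \<Longrightarrow> L \<le> K * sqrt (pi / (d - v))" and L: "L \<ge> 0"
  shows "L = 0"
proof -
  have "(\<lambda>n. K * sqrt (pi * (1 / real n))) \<longlonglongrightarrow> K * sqrt (pi * 0)"
    by (intro tendsto_intros lim_1_over_n)
  moreover have "eventually (\<lambda>n. L \<le> K * sqrt (pi * (1 / real n))) sequentially"
    using eventually_gt_at_top[of 0]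
  proof eventually_elim
    case (elim n)
    thus ?case using assms(1)[of "v + real n"] by simp
  qed
  ultimately have "L \<le> K * sqrt (pi * 0)" by (intro tendsto_lowerbound[of _ _ sequentially]) auto
  thus ?thesis using L by simp
qed

text \<open>The pole lies below the line, so the integral is unchanged when the line moves up, and
  it tends to 0 by \<open>line_integral_bound\<close>.\<close>

lemma Cauchy_line_below:
  assumes f: "f \<in> H2" and a: "0 < a" and w: "Im w < a"
  shows "(LINT x|lborel. line f a x / (Complex x a - w)) = 0"
proof -
  let ?h = "\<lambda>z. f z / (z - w)"
  have ln: "line ?h y = (\<lambda>x. line f y x / (Complex x y - w))" for y by (simp add: line_def)
  have "cmod (LINT x|lborel. line f a x / (Complex x a - w)) \<le> H2_sup f * sqrt (pi / (d - a))" if d: "d > a" for d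
  proof -
    have nz: "z - w \<noteq> 0" if "a \<le> Im z" for z using that w by auto
    have "(LINT x|lborel. line ?h a x) = (LINT x|lborel. line ?h d x)"
    proof (rule strip_integral_eq[OF d])
      have "?h holomorphic_on {z. Im z > Im w} \<inter> UHP"
        by (intro holomorphic_intros holomorphic_on_subset[OF H2_holomorphic[OF f]]) auto
      thus "continuous_on {z. a \<le> Im z \<and> Im z \<le> d} ?h" "?h holomorphic_on {z. a < Im z \<and> Im z < d}"
        using a w by (auto intro!: holomorphic_on_imp_continuous_on elim!: holomorphic_on_subset)
      show "cmod (?h z) \<le> (3 * H2_sup f / sqrt a) / (a - Im w)" if z: "a \<le> Im z" "Im z \<le> d" for z
      proof -
        have 1: "cmod (f z) \<le> 3 * H2_sup f / sqrt a" by (rule H2_half_plane_bound[OF f]) (use z a in auto)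
        have "a - Im w \<le> Im (z - w)" using z by simp
        also have "\<dots> \<le> cmod (z - w)" using abs_Im_le_cmod order_trans[OF abs_ge_self] by blast
        finally have 2: "a - Im w \<le> cmod (z - w)" .
        show ?thesis unfolding norm_divide by (rule frac_le[OF _ 1 _ 2]) (use w a in auto)
      qed
    qed (use line_integral_bound[OF f, of _ w] a w d in \<open>auto simp: ln\<close>)
    hence "cmod (LINT x|lborel. line f a x / (Complex x a - w)) \<le> H2_sup f * sqrt (pi / \<bar>d - Im w\<bar>)"
      using line_integral_bound(2)[OF f, of d w] a w d by (simp add: ln)
    also have "\<dots> \<le> H2_sup f * sqrt (pi / (d - a))"
      using w d by (intro mult_left_mono real_sqrt_le_mono divide_left_mono) auto
    finally show ?thesis .
  qed
  from sqrt_decay_imp_zero[OF this] show ?thesis by simp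
qed

text \<open>In place of a residue, a multiple of 1 / (z - w') that agrees with f at w is subtracted,
  where w' is the reflection of w in the line. The quotient by z - w is then holomorphic above the
  line and integrates to 0; the subtracted part gives a Poisson integral.\<close>

lemma Cauchy_line_above:
  assumes f: "f \<in> H2" and a: "0 < a" and w: "a < Im w"
  shows "(LINT x|lborel. line f a x / (Complex x a - w)) = 2 * of_real pi * \<i> * f w"
proof -
  define s where "s = Im w - a"
  define w' where "w' = Complex (Re w) (2 * a - Im w)"
  have s: "s > 0" using w by (simp add: s_def)
  have ww: "w - w' = 2 * \<i> * of_real s" by (simp add: complex_eq_iff w'_def s_def)
  have w'a: "Im w' < a" using w by (simp add: w'_def)
  define F where "F z = f z - f w * (w - w') / (z - w')" for z
  define h where "h z = (if z = w then deriv F w else (F z - F w) / (z - w))" for z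
  define S where "S = {z. Im z > Im w'} \<inter> UHP"
  have oS: "open S" unfolding S_def by (intro open_Int open_UHP open_halfspace_Im_gt)
  have S: "z \<in> S" if "a \<le> Im z" for z using that w'a a by (simp add: S_def)
  have hF: "F holomorphic_on S"
    unfolding F_def S_def
    by (intro holomorphic_intros holomorphic_on_subset[OF H2_holomorphic[OF f]]) auto
  have Fw: "F w = 0" using w by (simp add: F_def ww complex_eq_iff) (auto simp: w'_def s_def)
  have hh: "h holomorphic_on S" unfolding h_def by (rule pole_lemma_open[OF hF oS])
  define M where "M = 3 * H2_sup f / sqrt a + 2 * cmod (f w)"
  have FM: "cmod (F z) \<le> M" if z: "a \<le> Im z" for z
  proof -
    have 1: "cmod (f z) \<le> 3 * H2_sup f / sqrt a" by (rule H2_half_plane_bound[OF f]) (use z a in auto)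
    have "s \<le> Im (z - w')" using z by (simp add: w'_def s_def)
    also have "\<dots> \<le> cmod (z - w')" using abs_Im_le_cmod order_trans[OF abs_ge_self] by blast
    finally have "s \<le> cmod (z - w')" .
    hence "cmod ((w - w') / (z - w')) \<le> 2"
      using s by (simp add: ww norm_divide norm_mult divide_simps)
    hence "cmod (f w * (w - w') / (z - w')) \<le> cmod (f w) * 2"
      unfolding times_divide_eq_right[symmetric] norm_mult by (intro mult_left_mono) auto
    thus ?thesis unfolding F_def M_def using 1 norm_triangle_ineq4[of "f z" "f w * (w - w') / (z - w')"] by linarith
  qed
  \<comment> \<open>Boundedness of \<open>h\<close> in the strip: by compactness near the removable
    singularity, and by M / s at distance more than s from w.\<close>
  have "compact (h ` cball w s)"
  proof (rule compact_continuous_image[OF holomorphic_on_imp_continuous_on[OF holomorphic_on_subset[OF hh]]])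
    show "cball w s \<subseteq> S"
    proof
      fix z assume "z \<in> cball w s"
      hence "\<bar>Im (w - z)\<bar> \<le> s" by (metis abs_Im_le_cmod dist_norm mem_cball order_trans)
      thus "z \<in> S" by (intro S) (simp add: s_def)
    qed
  qed simp
  then obtain M' where M': "\<And>z. z \<in> cball w s \<Longrightarrow> cmod (h z) \<le> M'"
    by (metis bounded_iff compact_imp_bounded imageI)
  have lh: "line h y = (\<lambda>x. line f y x / (Complex x y - w) - f w * (w - w') * (1 / (Complex x y - w') * (1 / (Complex x y - w))))"
    if "y = a \<or> y > Im w" for y
  proof
    fix x
    have "Complex x y \<noteq> w" using that w by auto
    thus "line h y x = line f y x / (Complex x y - w) - f w * (w - w') * (1 / (Complex x y - w') * (1 / (Complex x y - w)))"
      by (simp add: line_def h_def Fw) (simp add: F_def diff_divide_distrib)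
  qed
  have int: "integrable lborel (\<lambda>x. 1 / (Complex x y - w') * (1 / (Complex x y - w)))"
    if "y = a \<or> y > Im w" for y
    using that w w'a by (intro integrable_mult_square_integrable Cauchy_kernel_L2) auto
  have ilh: "(LINT x|lborel. line h y x) = (LINT x|lborel. line f y x / (Complex x y - w))
       - f w * (w - w') * (LINT x|lborel. 1 / (Complex x y - w') * (1 / (Complex x y - w)))"
     and inth: "integrable lborel (line h y)"
    if y: "y = a \<or> y > Im w" for y
  proof -
    have i1: "integrable lborel (\<lambda>x. line f y x / (Complex x y - w))"
      by (rule line_integral_bound[OF f]) (use y a w in auto)
    have i2: "integrable lborel (\<lambda>x. f w * (w - w') * (1 / (Complex x y - w') * (1 / (Complex x y - w))))"
      by (intro integrable_mult_right int y)
    show "integrable lborel (line h y)" unfolding lh[OF y] by (intro Bochner_Integration.integrable_diff i1 i2)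
    show "(LINT x|lborel. line h y x) = (LINT x|lborel. line f y x / (Complex x y - w))
       - f w * (w - w') * (LINT x|lborel. 1 / (Complex x y - w') * (1 / (Complex x y - w)))"
      unfolding lh[OF y] Bochner_Integration.integral_diff[OF i1 i2] by (simp only: integral_mult_right_zero)
  qed
  define K where "K = H2_sup f + cmod (f w * (w - w')) * sqrt (pi / s)"
  have "cmod (LINT x|lborel. line h a x) \<le> K * sqrt (pi / (d - Im w))" if d: "d > Im w" for d
  proof -
    have ad: "a < d" using d w by simp
    have "(LINT x|lborel. line h a x) = (LINT x|lborel. line h d x)"
    proof (rule strip_integral_eq[OF ad])
      show "continuous_on {z. a \<le> Im z \<and> Im z \<le> d} h"
        by (rule holomorphic_on_imp_continuous_on[OF holomorphic_on_subset[OF hh]]) (auto intro: S)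
      show "h holomorphic_on {z. a < Im z \<and> Im z < d}" by (rule holomorphic_on_subset[OF hh]) (auto intro: S)
      show "cmod (h z) \<le> max M' (M / s)" if z: "a \<le> Im z" "Im z \<le> d" for z
      proof (cases "z \<in> cball w s")
        case False
        hence "s < cmod (z - w)" by (simp add: dist_norm norm_minus_commute)
        hence "cmod (F z) / cmod (z - w) \<le> M / s" by (intro frac_le FM z) (use s FM[OF z(1)] in \<open>auto intro: order_trans[OF norm_ge_zero]\<close>)
        moreover have "z \<noteq> w" using False s by auto
        ultimately show ?thesis by (simp add: h_def Fw norm_divide)
      qed (use M' in fastforce)
    qed (use inth d in auto)
    also have "cmod \<dots> \<le> H2_sup f * sqrt (pi / \<bar>d - Im w\<bar>)
        + cmod (f w * (w - w')) * (sqrt (pi / s) * sqrt (pi / \<bar>d - Im w\<bar>))"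
    proof -
      have "cmod (LINT x|lborel. 1 / (Complex x d - w') * (1 / (Complex x d - w)))
         \<le> (LINT x|lborel. cmod (1 / (Complex x d - w') * (1 / (Complex x d - w))))" by (rule integral_norm_bound)
      also have "\<dots> \<le> L2_norm (\<lambda>x. 1 / (Complex x d - w')) * L2_norm (\<lambda>x. 1 / (Complex x d - w))"
        unfolding norm_mult by (intro L2_Cauchy_Schwarz_abs Cauchy_kernel_L2) (use d ad w'a in auto)
      also have "\<dots> = sqrt (pi / \<bar>d - Im w'\<bar>) * sqrt (pi / \<bar>d - Im w\<bar>)"
        using d ad w'a by (simp add: Cauchy_kernel_L2)
      also have "\<dots> \<le> sqrt (pi / s) * sqrt (pi / \<bar>d - Im w\<bar>)"
        using s ad by (intro mult_right_mono real_sqrt_le_mono divide_left_mono) (auto simp: w'_def s_def)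
      finally have k: "cmod (LINT x|lborel. 1 / (Complex x d - w') * (1 / (Complex x d - w))) \<le> sqrt (pi / s) * sqrt (pi / \<bar>d - Im w\<bar>)" .
      have fd: "cmod (LINT x|lborel. line f d x / (Complex x d - w)) \<le> H2_sup f * sqrt (pi / \<bar>d - Im w\<bar>)"
        by (rule line_integral_bound[OF f]) (use d ad a in auto)
      have "d = a \<or> d > Im w" using d by simp
      show ?thesis unfolding ilh[OF \<open>d = a \<or> d > Im w\<close>]
        using norm_triangle_ineq4[of "LINT x|lborel. line f d x / (Complex x d - w)"
            "f w * (w - w') * (LINT x|lborel. 1 / (Complex x d - w') * (1 / (Complex x d - w)))"]
          mult_left_mono[OF k norm_ge_zero[of "f w * (w - w')"]] fd
        unfolding norm_mult[of "f w * (w - w')"] by linarith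
    qed
    also have "\<dots> = K * sqrt (pi / (d - Im w))" using d by (simp add: K_def algebra_simps)
    finally show ?thesis .
  qed
  from sqrt_decay_imp_zero[OF this] have "(LINT x|lborel. line h a x) = 0" by simp
  hence "(LINT x|lborel. line f a x / (Complex x a - w))
      = f w * ((w - w') * (LINT x|lborel. 1 / (Complex x a - w') * (1 / (Complex x a - w))))"
    using ilh[of a] by simp
  also have "(w - w') * (LINT x|lborel. 1 / (Complex x a - w') * (1 / (Complex x a - w)))
     = (LINT x|lborel. (w - w') * (1 / (Complex x a - w') * (1 / (Complex x a - w))))"
    by (simp only: integral_mult_right_zero)
  also have "\<dots> = (LINT x|lborel. 2 * \<i> * of_real (s / ((x - Re w)\<^sup>2 + s\<^sup>2)))"
  proof (rule Bochner_Integration.integral_cong)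
    fix x :: real
    \<comment> \<open>On the line, z - w' and z - w are complex conjugates.\<close>
    have "(Complex x a - w') * (Complex x a - w) = of_real ((x - Re w)\<^sup>2 + s\<^sup>2)"
      by (simp add: complex_eq_iff w'_def s_def power2_eq_square algebra_simps)
    thus "(w - w') * (1 / (Complex x a - w') * (1 / (Complex x a - w))) = 2 * \<i> * of_real (s / ((x - Re w)\<^sup>2 + s\<^sup>2))"
      by (simp add: ww)
  qed simp
  also have "\<dots> = 2 * \<i> * of_real pi"
    using Poisson_kernel_has_bochner_integral[OF s, of "Re w"]
    by (simp only: integral_mult_right_zero integral_complex_of_real has_bochner_integral_iff)
  finally show ?thesis by (simp add: mult.commute mult.left_commute)
qed

text \<open>The Cauchy integral at w minus the one at the reflected point w', which vanishes: the
  difference of the two kernels is 2 i times the Poisson kernel.\<close>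

lemma Poisson_line:
  assumes f: "f \<in> H2" and a: "0 < a" and w: "a < Im w"
  defines "s \<equiv> Im w - a"
  shows "(LINT x|lborel. line f a x * of_real (s / ((x - Re w)\<^sup>2 + s\<^sup>2))) = of_real pi * f w"
proof -
  define w' where "w' = Complex (Re w) (2 * a - Im w)"
  have w'a: "Im w' < a" using w by (simp add: w'_def)
  have s: "s > 0" using w by (simp add: s_def)
  have ww: "w - w' = 2 * \<i> * of_real s" by (simp add: complex_eq_iff w'_def s_def)
  have "2 * \<i> * (LINT x|lborel. line f a x * of_real (s / ((x - Re w)\<^sup>2 + s\<^sup>2)))
    = (LINT x|lborel. 2 * \<i> * (line f a x * of_real (s / ((x - Re w)\<^sup>2 + s\<^sup>2))))"
    by (simp only: integral_mult_right_zero)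
  also have "\<dots> = (LINT x|lborel. line f a x / (Complex x a - w) - line f a x / (Complex x a - w'))"
  proof (rule Bochner_Integration.integral_cong)
    fix x :: real
    have ne: "Complex x a - w \<noteq> 0" "Complex x a - w' \<noteq> 0" using w w'a by (auto simp: complex_eq_iff)
    have "(Complex x a - w') * (Complex x a - w) = of_real ((x - Re w)\<^sup>2 + s\<^sup>2)"
      by (simp add: complex_eq_iff w'_def s_def power2_eq_square algebra_simps)
    moreover have "line f a x / (Complex x a - w) - line f a x / (Complex x a - w')
        = line f a x * (w - w') / ((Complex x a - w') * (Complex x a - w))"
      using ne by (simp add: divide_simps) (simp add: algebra_simps)
    ultimately show "2 * \<i> * (line f a x * of_real (s / ((x - Re w)\<^sup>2 + s\<^sup>2)))
       = line f a x / (Complex x a - w) - line f a x / (Complex x a - w')"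
      by (simp add: ww)
  qed simp
  also have "\<dots> = 2 * of_real pi * \<i> * f w"
    using Cauchy_line_above[OF f a w] Cauchy_line_below[OF f a w'a]
      line_integral_bound(1)[OF f a, of w] line_integral_bound(1)[OF f a, of w'] w w'a by simp
  finally show ?thesis by simp
qed

subsection \<open>Boundary values\<close>

text \<open>For 0 < Im z < s the product of f(z) with the conjugate of g(cnj z + i s) is
  holomorphic, and at height y it is the integrand pairing f at height y with g at height s - y. A
  contour shift then changes y.\<close>

lemma H2_inner_line_shift_less:
  assumes f: "f \<in> H2" and g: "g \<in> H2" and pos: "0 < a" "a < a'" "a' < s"
  shows "L2_inner (line f a) (line g (s - a)) = L2_inner (line f a') (line g (s - a'))"
proof -
  define G where "G = cnj \<circ> (\<lambda>z. g (z + \<i> * of_real s)) \<circ> cnj"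
  define h where "h z = f z * G z" for z
  let ?S = "{z. 0 < Im z \<and> Im z < s}"
  have oS: "open ?S" using open_Int[OF open_halfspace_Im_gt open_halfspace_Im_lt] by (simp add: Collect_conj_eq)
  have "(\<lambda>z. g (z + \<i> * of_real s)) holomorphic_on cnj ` ?S"
    by (rule holomorphic_on_compose_gen[OF _ H2_holomorphic[OF g], unfolded comp_def])
       (auto intro!: holomorphic_intros)
  hence "G holomorphic_on ?S" unfolding G_def by (rule holomorphic_on_compose_cnj_cnj[OF _ oS])
  hence hh: "h holomorphic_on ?S" unfolding h_def
    by (intro holomorphic_on_mult holomorphic_on_subset[OF H2_holomorphic[OF f]]) auto
  have lh: "line h y = (\<lambda>x. line f y x * cnj (line g (s - y) x))" for y
  proof
    fix x
    have "cnj (Complex x y) + \<i> * of_real s = Complex x (s - y)" by (simp add: complex_eq_iff)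
    thus "line h y x = line f y x * cnj (line g (s - y) x)" by (simp add: line_def h_def G_def)
  qed
  have "(LINT x|lborel. line h a x) = (LINT x|lborel. line h a' x)"
  proof (rule strip_integral_eq[OF pos(2)])
    show "continuous_on {z. a \<le> Im z \<and> Im z \<le> a'} h"
      by (rule holomorphic_on_imp_continuous_on[OF holomorphic_on_subset[OF hh]]) (use pos in auto)
    show "h holomorphic_on {z. a < Im z \<and> Im z < a'}"
      by (rule holomorphic_on_subset[OF hh]) (use pos in auto)
    show "cmod (h z) \<le> (3 * H2_sup f / sqrt a) * (3 * H2_sup g / sqrt (s - a'))" if z: "a \<le> Im z" "Im z \<le> a'" for z
    proof -
      have 1: "cmod (f z) \<le> 3 * H2_sup f / sqrt a" by (rule H2_half_plane_bound[OF f]) (use z pos in auto)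
      have 2: "cmod (G z) \<le> 3 * H2_sup g / sqrt (s - a')"
        using H2_half_plane_bound[OF g, of "s - a'" "cnj z + \<i> * of_real s"] z pos by (simp add: G_def)
      show ?thesis unfolding h_def norm_mult using pos by (intro mult_mono 1 2) auto
    qed
  qed (use pos f g in \<open>auto simp: lh intro!: integrable_mult_square_integrable H2_line\<close>)
  thus ?thesis by (simp add: L2_inner_def lh)
qed

lemma H2_inner_line_shift:
  assumes "f \<in> H2" "g \<in> H2" "0 < a" "0 < b" "0 < a'" "0 < b'" "a + b = a' + b'"
  shows "L2_inner (line f a) (line g b) = L2_inner (line f a') (line g b')"
proof -
  have b: "b = (a + b) - a" "b' = (a + b) - a'" using assms(7) by auto
  consider "a < a'" | "a = a'" | "a' < a" by linarith
  thus ?thesis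
  proof cases
    case 1
    show ?thesis by (subst (1) b(1), subst (1) b(2), rule H2_inner_line_shift_less) (use assms 1 in auto)
  next
    case 2
    thus ?thesis using b by simp
  next
    case 3
    show ?thesis by (subst (1) b(1), subst (1) b(2), rule H2_inner_line_shift_less[symmetric]) (use assms 3 in auto)
  qed
qed

text \<open>The cross term depends on a + b only, so it is the squared norm on the middle
  line.\<close>

lemma H2_line_diff_norm:
  assumes f: "f \<in> H2" and ab: "0 < a" "0 < b"
  shows "(L2_norm (\<lambda>x. line f a x - line f b x))\<^sup>2
    = (L2_norm (line f a))\<^sup>2 + (L2_norm (line f b))\<^sup>2 - 2 * (L2_norm (line f ((a + b) / 2)))\<^sup>2"
proof -
  have "L2_inner (line f a) (line f b) = L2_inner (line f ((a + b) / 2)) (line f ((a + b) / 2))"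
    by (rule H2_inner_line_shift) (use f ab in auto)
  hence "L2_inner (line f a) (line f b) = of_real ((L2_norm (line f ((a + b) / 2)))\<^sup>2)"
    by (simp add: L2_inner_self)
  hence "Re (L2_inner (line f a) (line f b)) = (L2_norm (line f ((a + b) / 2)))\<^sup>2" by (simp del: of_real_power)
  thus ?thesis by (simp add: L2_norm_diff_power2 H2_line f ab)
qed

text \<open>The squared line norm is midpoint convex and bounded, hence nonincreasing.\<close>

lemma H2_line_norm_antimono:
  assumes f: "f \<in> H2" and st: "0 < s" "s \<le> t"
  shows "L2_norm (line f t) \<le> L2_norm (line f s)"
proof (rule ccontr)
  define m where "m y = (L2_norm (line f y))\<^sup>2" for y
  define h where "h = t - s"
  define \<delta> where "\<delta> = m t - m s"
  assume *: "\<not> ?thesis"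
  hence \<delta>: "\<delta> > 0" by (simp add: \<delta>_def m_def power_strict_mono)
  have h: "h \<ge> 0" using st by (simp add: h_def)
  have convex: "2 * m (x + h) \<le> m x + m (x + 2 * h)" if "x > 0" for x
  proof -
    have "0 \<le> (L2_norm (\<lambda>u. line f x u - line f (x + 2 * h) u))\<^sup>2" by simp
    also have "\<dots> = m x + m (x + 2 * h) - 2 * m ((x + (x + 2 * h)) / 2)"
      using H2_line_diff_norm[OF f, of x "x + 2 * h"] that h by (simp add: m_def)
    also have "(x + (x + 2 * h)) / 2 = x + h" by (simp add: field_simps)
    finally show ?thesis by simp
  qed
  \<comment> \<open>By convexity the rise \<open>\<delta>\<close> over the first step of length
    \<open>h\<close> is repeated at every later step, so \<open>m\<close> would be
    unbounded.\<close>
  have "m (s + real n * h) + \<delta> \<le> m (s + real (Suc n) * h)" for n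
  proof (induction n)
    case 0
    show ?case by (simp add: \<delta>_def h_def)
  next
    case (Suc n)
    have "s + real n * h > 0" using st h by (simp add: add_pos_nonneg)
    from convex[OF this] Suc show ?case by (simp add: algebra_simps)
  qed
  note inc = this
  have "real n * \<delta> \<le> m (s + real n * h) - m s" for n
  proof (induction n)
    case (Suc n)
    have "real (Suc n) * \<delta> = real n * \<delta> + \<delta>" by (simp add: algebra_simps)
    thus ?case using Suc inc[of n] by linarith
  qed simp
  moreover have "m (s + real n * h) - m s \<le> (H2_sup f)\<^sup>2" for n
  proof -
    have "s + real n * h > 0" using st h by (simp add: add_pos_nonneg)
    hence "m (s + real n * h) \<le> (H2_sup f)\<^sup>2" unfolding m_def by (intro power_mono H2_line f) auto
    moreover have "0 \<le> m s" by (simp add: m_def)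
    ultimately show ?thesis by linarith
  qed
  ultimately have "real n * \<delta> \<le> (H2_sup f)\<^sup>2" for n by (meson order_trans)
  thus False using \<delta> by (metis reals_Archimedean3 not_less)
qed

lemma H2_sup_le_near_boundary:
  assumes f: "f \<in> H2" and "\<delta> > 0" and "\<And>y. \<lbrakk>0 < y; y < \<delta>\<rbrakk> \<Longrightarrow> L2_norm (line f y) \<le> C"
  shows "H2_sup f \<le> C"
proof (rule H2I(2)[OF H2_holomorphic[OF f] H2_off[OF f]])
  fix y :: real assume y: "y > 0"
  define u where "u = min y (\<delta> / 2)"
  have u: "0 < u" "u \<le> y" "u < \<delta>" using y assms(2) by (auto simp: u_def)
  show "square_integrable (line f y) \<and> L2_norm (line f y) \<le> C"
    using H2_line(1)[OF f y] H2_line_norm_antimono[OF f u(1,2)] assms(3)[OF u(1,3)] by simp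
qed

lemma H2_line_norm_near_sup:
  assumes f: "f \<in> H2" and e: "e > 0"
  obtains \<delta> where "\<delta> > 0" "\<And>y. \<lbrakk>0 < y; y < \<delta>\<rbrakk> \<Longrightarrow> (H2_sup f)\<^sup>2 - e < (L2_norm (line f y))\<^sup>2"
proof -
  have "\<exists>\<delta>>0. (H2_sup f)\<^sup>2 - e < (L2_norm (line f \<delta>))\<^sup>2"
  proof (rule ccontr)
    assume no: "\<not> (\<exists>\<delta>>0. (H2_sup f)\<^sup>2 - e < (L2_norm (line f \<delta>))\<^sup>2)"
    have le: "(L2_norm (line f y))\<^sup>2 \<le> (H2_sup f)\<^sup>2 - e" if "y > 0" for y
      using no that not_less by blast
    have nn: "0 \<le> (H2_sup f)\<^sup>2 - e" using le[of 1] order_trans[OF zero_le_power2] by fastforce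
    have "H2_sup f \<le> sqrt ((H2_sup f)\<^sup>2 - e)"
      by (rule H2_sup_le_near_boundary[OF f zero_less_one]) (use le real_le_rsqrt in blast)
    hence "(H2_sup f)\<^sup>2 \<le> (H2_sup f)\<^sup>2 - e" using nn by (metis H2_sup_nonneg power_mono real_sqrt_pow2)
    thus False using e by simp
  qed
  then obtain \<delta> where d: "\<delta> > 0" "(H2_sup f)\<^sup>2 - e < (L2_norm (line f \<delta>))\<^sup>2" by blast
  show ?thesis
  proof (rule that[OF d(1)])
    fix y assume y: "0 < y" "y < \<delta>"
    have "(L2_norm (line f \<delta>))\<^sup>2 \<le> (L2_norm (line f y))\<^sup>2"
      by (intro power_mono H2_line_norm_antimono f) (use y in auto)
    thus "(H2_sup f)\<^sup>2 - e < (L2_norm (line f y))\<^sup>2" using d(2) by linarith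
  qed
qed

lemma H2_line_Cauchy:
  assumes f: "f \<in> H2" and e: "e > 0"
  obtains \<delta> where "\<delta> > 0"
    "\<And>a b. \<lbrakk>0 < a; a < \<delta>; 0 < b; b < \<delta>\<rbrakk> \<Longrightarrow> L2_norm (\<lambda>x. line f a x - line f b x) \<le> e"
proof -
  \<comment> \<open>With all squared line norms near the boundary within e^2 / 2 of the supremum,
    the right side of \<open>H2_line_diff_norm\<close> is at most e^2.\<close>
  have "e\<^sup>2 / 2 > 0" using e by simp
  from H2_line_norm_near_sup[OF f this] obtain \<delta> where d: "\<delta> > 0"
    "\<And>y. \<lbrakk>0 < y; y < \<delta>\<rbrakk> \<Longrightarrow> (H2_sup f)\<^sup>2 - e\<^sup>2 / 2 < (L2_norm (line f y))\<^sup>2" by blast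
  show ?thesis
  proof (rule that[OF d(1)])
    fix a b assume ab: "0 < a" "a < \<delta>" "0 < b" "b < \<delta>"
    have up: "(L2_norm (line f y))\<^sup>2 \<le> (H2_sup f)\<^sup>2" if "y > 0" for y
      by (intro power_mono H2_line f that) simp
    have "(H2_sup f)\<^sup>2 - e\<^sup>2 / 2 < (L2_norm (line f ((a + b) / 2)))\<^sup>2" by (rule d(2)) (use ab in auto)
    hence "(L2_norm (\<lambda>x. line f a x - line f b x))\<^sup>2 \<le> e\<^sup>2"
      unfolding H2_line_diff_norm[OF f ab(1,3)]
      using up[OF ab(1)] up[OF ab(3)] by linarith
    thus "L2_norm (\<lambda>x. line f a x - line f b x) \<le> e" using e by (auto intro: power2_le_imp_le)
  qed
qed

section \<open>Vertical maximal function and almost everywhere limits\<close>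

text \<open>For a > 0 the shifted function is holomorphic across the real line before it is cut off,
  which makes it the regular approximant in the almost everywhere argument. The value 0 outside is
  the normal form required by \<open>H2\<close>.\<close>

definition vshift :: "real \<Rightarrow> (complex \<Rightarrow> complex) \<Rightarrow> complex \<Rightarrow> complex" where
  "vshift a f = (\<lambda>z. if Im z > 0 then f (z + \<i> * of_real a) else 0)"

lemma line_vshift: "y > 0 \<Longrightarrow> line (vshift a f) y = line f (y + a)"
proof
  fix x assume "y > 0"
  have "Complex x y + \<i> * of_real a = Complex x (y + a)" by (simp add: complex_eq_iff)
  thus "line (vshift a f) y x = line f (y + a) x" using \<open>y > 0\<close> by (simp add: line_def vshift_def)
qed

lemma vshift_in_H2:
  assumes f: "f \<in> H2" and a: "a > 0"
  shows "vshift a f \<in> H2"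
proof (rule H2I)
  have "(\<lambda>z. f (z + \<i> * of_real a)) holomorphic_on UHP"
    by (rule holomorphic_on_compose_gen[OF _ H2_holomorphic[OF f], unfolded comp_def])
       (use a in \<open>auto intro!: holomorphic_intros\<close>)
  thus "vshift a f holomorphic_on UHP" by (rule holomorphic_transform) (auto simp: vshift_def)
  fix y :: real assume "y > 0"
  thus "square_integrable (line (vshift a f) y) \<and> L2_norm (line (vshift a f) y) \<le> H2_sup f"
    using H2_line[OF f, of "y + a"] a by (simp add: line_vshift)
qed (simp add: vshift_def)

lemma H2_vshift_tendsto:
  assumes f: "f \<in> H2" and e: "e > 0"
  obtains a where "a > 0" "H2_sup (\<lambda>z. f z - vshift a f z) \<le> e"
proof -
  obtain \<delta> where d: "\<delta> > 0"
    "\<And>a b. \<lbrakk>0 < a; a < \<delta>; 0 < b; b < \<delta>\<rbrakk> \<Longrightarrow> L2_norm (\<lambda>x. line f a x - line f b x) \<le> e"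
    using H2_line_Cauchy[OF f e] by blast
  show ?thesis
  proof (rule that[of "\<delta> / 2"])
    have g: "(\<lambda>z. f z - vshift (\<delta> / 2) f z) \<in> H2" using d(1) f by (intro H2_diff vshift_in_H2) auto
    show "H2_sup (\<lambda>z. f z - vshift (\<delta> / 2) f z) \<le> e"
    proof (rule H2_sup_le_near_boundary[OF g, of "\<delta> / 2"])
      fix y assume "0 < y" "y < \<delta> / 2"
      thus "L2_norm (line (\<lambda>z. f z - vshift (\<delta> / 2) f z) y) \<le> e"
        using d(2)[of y "y + \<delta> / 2"] d(1) by (simp add: line_simps line_vshift)
    qed (use d(1) in simp)
  qed (use d(1) in simp)
qed

text \<open>A union of open sets over all heights, which settles measurability although the heights
  are uncountably many.\<close>

lemma open_vertical_exceed:
  assumes "f holomorphic_on UHP" "e \<ge> 0"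
  shows "open {x. \<exists>y>e. \<alpha> < cmod (f (Complex x y))}"
proof -
  have "{x. \<exists>y>e. \<alpha> < cmod (f (Complex x y))} = (\<Union>y\<in>{e<..}. {x. \<alpha> < cmod (line f y x)})"
    by (auto simp: line_def)
  moreover have "open {x. \<alpha> < cmod (line f y x)}" if "y > e" for y
    using that assms by (intro open_Collect_less continuous_intros continuous_line_UHP) auto
  ultimately show ?thesis by auto
qed

text \<open>Jensen's inequality for the Poisson kernel, of total mass pi: Cauchy-Schwarz with the
  kernel split into two square roots. The line at height a stands in for the real line, where
  boundary values are not yet available.\<close>

lemma Poisson_square_bound:
  assumes f: "f \<in> H2" and a: "0 < a" and w: "a < Im w"
  defines "s \<equiv> Im w - a"
  shows "pi * (cmod (f w))\<^sup>2 \<le> (LINT x|lborel. (cmod (line f a x))\<^sup>2 * (s / ((x - Re w)\<^sup>2 + s\<^sup>2)))"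
proof -
  have s: "s > 0" using w by (simp add: s_def)
  define P where "P x = s / ((x - Re w)\<^sup>2 + s\<^sup>2)" for x
  have P0: "P x \<ge> 0" for x using s by (simp add: P_def)
  have P1: "P x \<le> 1 / s" for x
  proof -
    have "s / ((x - Re w)\<^sup>2 + s\<^sup>2) \<le> s / s\<^sup>2" using s by (intro divide_left_mono mult_pos_pos) (auto simp: add_nonneg_pos)
    thus ?thesis using s by (simp add: P_def power2_eq_square)
  qed
  have hbP: "has_bochner_integral lborel P pi" unfolding P_def by (rule Poisson_kernel_has_bochner_integral[OF s])
  hence mP[measurable]: "P \<in> borel_measurable borel" by (auto simp: has_bochner_integral_iff dest: borel_measurable_integrable)
  define k where "k x = complex_of_real (sqrt (P x))" for x
  have mk[measurable]: "k \<in> borel_measurable borel" unfolding k_def by measurable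
  have k2: "(cmod (k x))\<^sup>2 = P x" for x using P0 by (simp add: k_def)
  have sk: "square_integrable k" "(L2_norm k)\<^sup>2 = pi"
    using hbP by (auto simp: square_integrable_def L2_norm_power2 k2 has_bochner_integral_iff)
  have sf: "square_integrable (\<lambda>x. k x * line f a x)"
  proof (rule square_integrable_bounded_mult[OF H2_line(1)[OF f a] mk])
    show "AE x in lborel. cmod (k x) \<le> sqrt (1 / s)" using P0 P1 by (auto simp: k_def)
  qed
  have "pi * cmod (f w) = cmod (of_real pi * f w)" by (simp add: norm_mult)
  also have "\<dots> = cmod (LINT x|lborel. line f a x * of_real (P x))"
    unfolding P_def s_def by (subst Poisson_line[OF f a w]) simp
  also have "\<dots> \<le> (LINT x|lborel. cmod (line f a x * of_real (P x)))" by (rule integral_norm_bound)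
  also have "\<dots> = (LINT x|lborel. cmod (k x * line f a x) * cmod (k x))"
  proof (rule Bochner_Integration.integral_cong)
    fix x
    have "cmod (k x) * cmod (k x) = P x" using k2[of x] by (simp add: power2_eq_square)
    hence "cmod (k x) * (cmod (k x) * cmod (line f a x)) = P x * cmod (line f a x)"
      by (simp flip: mult.assoc)
    thus "cmod (line f a x * of_real (P x)) = cmod (k x * line f a x) * cmod (k x)"
      using P0[of x] by (auto simp: norm_mult mult.commute mult.left_commute)
  qed simp
  also have "\<dots> \<le> L2_norm (\<lambda>x. k x * line f a x) * L2_norm k" by (rule L2_Cauchy_Schwarz_abs[OF sf sk(1)])
  finally have "(pi * cmod (f w))\<^sup>2 \<le> (L2_norm (\<lambda>x. k x * line f a x) * L2_norm k)\<^sup>2" by (intro power_mono) auto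
  moreover have "(pi * cmod (f w))\<^sup>2 = pi * (pi * (cmod (f w))\<^sup>2)" by (simp add: power2_eq_square)
  moreover have "(L2_norm (\<lambda>x. k x * line f a x) * L2_norm k)\<^sup>2 = pi * (L2_norm (\<lambda>x. k x * line f a x))\<^sup>2"
    by (simp add: power_mult_distrib sk(2))
  ultimately have "pi * (pi * (cmod (f w))\<^sup>2) \<le> pi * (L2_norm (\<lambda>x. k x * line f a x))\<^sup>2" by simp
  hence "pi * (cmod (f w))\<^sup>2 \<le> (L2_norm (\<lambda>x. k x * line f a x))\<^sup>2" by simp
  also have "\<dots> = (LINT x|lborel. (cmod (line f a x))\<^sup>2 * P x)"
    unfolding L2_norm_power2 norm_mult power_mult_distrib k2 by (simp add: mult.commute)
  finally show ?thesis unfolding P_def .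
qed

text \<open>If |f| exceeds \<alpha> somewhere above x at height more than a, then some average
  around x of |f|^2 on the line of height a exceeds \<open>\<mu>\<close>, and the weak type
  inequality applies. The bound is independent of a, so a may shrink to 0.\<close>

lemma H2_vertical_maximal_inequality:
  assumes f: "f \<in> H2" and l: "\<alpha> > 0"
  shows "emeasure lborel {x. \<exists>y>0. \<alpha> < cmod (f (Complex x y))} \<le> ennreal (80 / (pi * \<alpha>\<^sup>2) * (H2_sup f)\<^sup>2)"
proof -
  define E where "E e = {x. \<exists>y>e. \<alpha> < cmod (f (Complex x y))}" for e
  have oE: "open (E e)" if "e \<ge> 0" for e
    unfolding E_def by (rule open_vertical_exceed[OF H2_holomorphic[OF f] that])
  have bound: "emeasure lborel (E a) \<le> ennreal (80 / (pi * \<alpha>\<^sup>2) * (H2_sup f)\<^sup>2)" if a: "a > 0" for a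
  proof -
    define g where "g x = (cmod (line f a x))\<^sup>2" for x
    have int: "integrable lborel g" unfolding g_def using H2_line(1)[OF f a] by (simp add: square_integrable_def)
    \<comment> \<open>Chosen so that averages at most \<mu> give pi |f|^2 <= 16 \<mu> = pi
      \<alpha>^2; then 5 / \<mu> = 80 / (pi \<alpha>^2).\<close>
    define \<mu> where "\<mu> = pi * \<alpha>\<^sup>2 / 16"
    have mu: "\<mu> > 0" using l by (simp add: \<mu>_def)
    obtain U where U: "U \<in> sets borel"
      "{x. \<exists>r>0. 2 * r * \<mu> < (LINT t|lborel. indicator (cball x r) t * g t)} \<subseteq> U"
      "emeasure lborel U \<le> ennreal (5 / \<mu> * (LINT t|lborel. g t))"
      using Hardy_Littlewood_weak_type[OF int _ mu] by (auto simp: g_def)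
    have "E a \<subseteq> U"
    proof
      fix x assume "x \<in> E a"
      then obtain y where y: "y > a" "\<alpha> < cmod (f (Complex x y))" by (auto simp: E_def)
      have "\<exists>r>0. 2 * r * \<mu> < (LINT t|lborel. indicator (cball x r) t * g t)"
      proof (rule ccontr)
        assume no: "\<not> (\<exists>r>0. 2 * r * \<mu> < (LINT t|lborel. indicator (cball x r) t * g t))"
        have "(LINT t|lborel. g t * ((y - a) / ((t - x)\<^sup>2 + (y - a)\<^sup>2))) \<le> 16 * \<mu>"
        proof (rule Poisson_integral_le_averages[OF int])
          show "(LINT t|lborel. indicator (cball x r) t * g t) \<le> 2 * r * \<mu>" if "r > 0" for r
            using no that by (meson not_less)
        qed (use y mu in \<open>auto simp: g_def\<close>)
        moreover have "pi * (cmod (f (Complex x y)))\<^sup>2 \<le> (LINT t|lborel. g t * ((y - a) / ((t - x)\<^sup>2 + (y - a)\<^sup>2)))"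
          using Poisson_square_bound[OF f a, of "Complex x y"] y(1) by (simp add: g_def)
        ultimately have "pi * (cmod (f (Complex x y)))\<^sup>2 \<le> pi * \<alpha>\<^sup>2" unfolding \<mu>_def by linarith
        hence "(cmod (f (Complex x y)))\<^sup>2 \<le> \<alpha>\<^sup>2" by simp
        hence "cmod (f (Complex x y)) \<le> \<alpha>" using l by (auto intro: power2_le_imp_le)
        thus False using y by simp
      qed
      thus "x \<in> U" using U(2) by blast
    qed
    hence "emeasure lborel (E a) \<le> emeasure lborel U" using U(1) by (intro emeasure_mono) auto
    also note U(3)
    also have "5 / \<mu> * (LINT t|lborel. g t) \<le> 80 / (pi * \<alpha>\<^sup>2) * (H2_sup f)\<^sup>2"
    proof -
      have "(LINT t|lborel. g t) \<le> (H2_sup f)\<^sup>2"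
        unfolding g_def L2_norm_power2[symmetric] by (intro power_mono H2_line f a) simp
      moreover have "5 / \<mu> = 80 / (pi * \<alpha>\<^sup>2)" using l by (simp add: \<mu>_def)
      ultimately show ?thesis using l by (simp add: mult_left_mono divide_right_mono)
    qed
    finally show ?thesis by (simp add: ennreal_leI)
  qed
  have UE: "E 0 = (\<Union>n. E (1 / real (Suc n)))"
  proof (intro equalityI subsetI)
    fix x assume "x \<in> E 0"
    then obtain y where y: "y > 0" "\<alpha> < cmod (f (Complex x y))" by (auto simp: E_def)
    obtain n where "1 / real (Suc n) < y" using y(1) nat_approx_posE by blast
    thus "x \<in> (\<Union>n. E (1 / real (Suc n)))" using y by (auto simp: E_def)
  next
    fix x assume "x \<in> (\<Union>n. E (1 / real (Suc n)))"
    then obtain n y where "y > 1 / real (Suc n)" "\<alpha> < cmod (f (Complex x y))" by (auto simp: E_def)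
    moreover have "1 / real (Suc n) > 0" by simp
    ultimately show "x \<in> E 0" unfolding E_def by (blast intro: less_trans)
  qed
  have inc: "incseq (\<lambda>n. E (1 / real (Suc n)))"
  proof (rule incseq_SucI, rule subsetI)
    fix n x assume "x \<in> E (1 / real (Suc n))"
    moreover have "1 / real (Suc (Suc n)) \<le> 1 / real (Suc n)" by (intro divide_left_mono) auto
    ultimately show "x \<in> E (1 / real (Suc (Suc n)))" unfolding E_def by (blast intro: le_less_trans)
  qed
  have "emeasure lborel (E 0) = (SUP n. emeasure lborel (E (1 / real (Suc n))))"
    unfolding UE by (rule SUP_emeasure_incseq[symmetric, OF _ inc]) (auto intro!: borel_open oE)
  also have "\<dots> \<le> ennreal (80 / (pi * \<alpha>\<^sup>2) * (H2_sup f)\<^sup>2)" by (intro SUP_least bound) simp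
  finally show ?thesis by (simp add: E_def)
qed

text \<open>Cauchy's criterion in the form in which it arises: the 3 is that of the three-term
  triangle inequality in \<open>H2_vertical_limits\<close>.\<close>

lemma at_right_tendsto_of_Cauchy:
  fixes u :: "real \<Rightarrow> complex"
  assumes "\<And>k::nat. \<exists>\<delta>>0. \<forall>y y'. 0 < y \<and> y < \<delta> \<and> 0 < y' \<and> y' < \<delta> \<longrightarrow> cmod (u y - u y') \<le> 3 / real (Suc k)"
  shows "\<exists>l. (u \<longlongrightarrow> l) (at_right 0)"
proof -
  have C: "\<exists>\<delta>>0. \<forall>y y'. 0 < y \<and> y < \<delta> \<and> 0 < y' \<and> y' < \<delta> \<longrightarrow> cmod (u y - u y') < e" if e: "e > 0" for e
  proof -
    obtain k where "1 / real (Suc k) < e / 3" using e nat_approx_posE[of "e / 3"] by auto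
    hence "3 / real (Suc k) < e" by (simp add: field_simps)
    thus ?thesis using assms[of k] by (meson le_less_trans)
  qed
  have "Cauchy (\<lambda>n. u (1 / real (Suc n)))"
  proof (rule CauchyI)
    fix e :: real assume "e > 0"
    from C[OF this] obtain \<delta> where d: "\<delta> > 0" "\<And>y y'. \<lbrakk>0 < y; y < \<delta>; 0 < y'; y' < \<delta>\<rbrakk> \<Longrightarrow> cmod (u y - u y') < e" by blast
    obtain N where N: "1 / real (Suc N) < \<delta>" using d(1) nat_approx_posE by blast
    have le: "1 / real (Suc n) < \<delta>" if "n \<ge> N" for n
    proof -
      have "1 / real (Suc n) \<le> 1 / real (Suc N)" using that by (intro divide_left_mono) auto
      thus ?thesis using N by simp
    qed
    show "\<exists>M. \<forall>m\<ge>M. \<forall>n\<ge>M. norm (u (1 / real (Suc m)) - u (1 / real (Suc n))) < e"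
      by (intro exI[of _ N] allI impI d(2) le) auto
  qed
  then obtain l where l: "(\<lambda>n. u (1 / real (Suc n))) \<longlonglongrightarrow> l" using Cauchy_convergent convergent_def by blast
  have "(u \<longlongrightarrow> l) (at_right 0)"
  proof (rule tendstoI)
    fix e :: real assume "e > 0"
    hence "e / 2 > 0" by simp
    from C[OF this] obtain \<delta> where d: "\<delta> > 0" "\<And>y y'. \<lbrakk>0 < y; y < \<delta>; 0 < y'; y' < \<delta>\<rbrakk> \<Longrightarrow> cmod (u y - u y') < e / 2" by blast
    have ev: "eventually (\<lambda>n. 1 / real (Suc n) < \<delta>) sequentially"
      using order_tendstoD(2)[OF LIMSEQ_Suc[OF lim_1_over_n] d(1)] .
    have "cmod (u y - l) \<le> e / 2" if y: "0 < y" "y < \<delta>" for y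
    proof (rule tendsto_upperbound)
      show "(\<lambda>n. cmod (u y - u (1 / real (Suc n)))) \<longlonglongrightarrow> cmod (u y - l)" by (intro tendsto_intros l)
      show "\<forall>\<^sub>F n in sequentially. cmod (u y - u (1 / real (Suc n))) \<le> e / 2"
        using ev by eventually_elim (use d(2)[OF y] in \<open>force intro: less_imp_le\<close>)
    qed simp
    moreover have "eventually (\<lambda>y. 0 < y \<and> y < \<delta>) (at_right 0)" using eventually_at_right_real[OF d(1)] by simp
    ultimately show "eventually (\<lambda>y. dist (u y) l < e) (at_right 0)"
      using \<open>e > 0\<close> by (auto elim!: eventually_mono simp: dist_norm intro: le_less_trans[of _ "e / 2"])
  qed
  thus ?thesis by blast
qed

text \<open>The oscillation of \<open>f\<close> at a boundary point is controlled by the vertical maximal function of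
  \<open>f - vshift a f\<close>, since \<open>vshift a f\<close> is continuous up to the real line.\<close>

lemma H2_vertical_limits:
  assumes f: "f \<in> H2"
  shows "AE x in lborel. \<exists>l. ((\<lambda>y. f (Complex x y)) \<longlongrightarrow> l) (at_right 0)"
proof -
  define good where "good k x \<longleftrightarrow> (\<exists>\<delta>>0. \<forall>y y'. 0 < y \<and> y < \<delta> \<and> 0 < y' \<and> y' < \<delta> \<longrightarrow>
     cmod (f (Complex x y) - f (Complex x y')) \<le> 3 / real (Suc k))" for k x
  have "AE x in lborel. good k x" for k
  proof -
    let ?l = "1 / real (Suc k)"
    define E where "E a = {x. \<exists>y>0. ?l < cmod (f (Complex x y) - vshift a f (Complex x y))}" for a
    have gH2: "(\<lambda>z. f z - vshift a f z) \<in> H2" if "a > 0" for a using that by (intro H2_diff vshift_in_H2 f)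
    have E_sets: "E a \<in> sets lborel" if "a > 0" for a
      unfolding E_def using open_vertical_exceed[OF H2_holomorphic[OF gH2[OF that]], of 0 ?l] by simp
    \<comment> \<open>Off \<open>E a\<close>, replacing f(x + iy) by f(x + i(y + a)) costs at most
      \<open>?l\<close> at every height, and the shifted function oscillates little for small y by
      continuity at height a.\<close>
    have bad: "{x. \<not> good k x} \<subseteq> E a" if a: "a > 0" for a
    proof (rule subsetI, rule ccontr)
      fix x assume x: "x \<in> {x. \<not> good k x}" "x \<notin> E a"
      have small: "cmod (f (Complex x y) - f (Complex x (y + a))) \<le> ?l" if "y > 0" for y
      proof -
        have "vshift a f (Complex x y) = f (Complex x (y + a))"
          using that line_vshift[OF that, of a f] by (simp add: line_def fun_eq_iff)
        moreover have "cmod (f (Complex x y) - vshift a f (Complex x y)) \<le> ?l"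
          using x(2) that unfolding E_def mem_Collect_eq by (meson not_less)
        ultimately show ?thesis by simp
      qed
      have "continuous_on {0<..} (\<lambda>y. f (Complex x y))"
        by (rule continuous_on_compose2[OF holomorphic_on_imp_continuous_on[OF H2_holomorphic[OF f]]])
           (auto intro!: continuous_intros)
      hence "isCont (\<lambda>y. f (Complex x y)) a" using a by (simp add: continuous_on_eq_continuous_at)
      then obtain \<delta> where d: "\<delta> > 0" "\<And>y. dist y a < \<delta> \<Longrightarrow> dist (f (Complex x y)) (f (Complex x a)) < ?l / 2"
        unfolding continuous_at_eps_delta by (metis zero_less_divide_1_iff of_nat_0_less_iff zero_less_Suc half_gt_zero)
      have "cmod (f (Complex x y) - f (Complex x y')) \<le> 3 / real (Suc k)"
        if y: "0 < y" "y < \<delta>" "0 < y'" "y' < \<delta>" for y y'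
      proof -
        have 1: "dist (f (Complex x (y + a))) (f (Complex x a)) < ?l / 2" by (rule d(2)) (use y in \<open>simp add: dist_real_def\<close>)
        have 2: "dist (f (Complex x (y' + a))) (f (Complex x a)) < ?l / 2" by (rule d(2)) (use y in \<open>simp add: dist_real_def\<close>)
        have 3: "dist (f (Complex x (y + a))) (f (Complex x (y' + a))) < ?l" by (rule dist_triangle_half_l[OF 1 2])
        have "cmod (f (Complex x y) - f (Complex x y')) \<le> cmod (f (Complex x y) - f (Complex x (y + a)))
           + cmod (f (Complex x (y + a)) - f (Complex x (y' + a))) + cmod (f (Complex x y') - f (Complex x (y' + a)))"
          by norm
        also have "\<dots> \<le> ?l + ?l + ?l" using small[OF y(1)] small[OF y(3)] 3 by (intro add_mono) (auto simp: dist_norm)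
        finally show ?thesis by simp
      qed
      hence "good k x" unfolding good_def using d(1) by blast
      thus False using x by simp
    qed
    have "\<exists>a>0. emeasure lborel (E a) \<le> ennreal (1 / real (Suc n))" for n
    proof -
      \<comment> \<open>Makes the weak type bound for the approximation error equal to 1 / (n +
        1).\<close>
      define e where "e = sqrt (1 / real (Suc n) / (80 / (pi * ?l\<^sup>2)))"
      have c: "80 / (pi * ?l\<^sup>2) > 0" by (intro divide_pos_pos mult_pos_pos) auto
      have "e > 0" unfolding e_def using c by (intro real_sqrt_gt_zero divide_pos_pos) auto
      then obtain a where a: "a > 0" "H2_sup (\<lambda>z. f z - vshift a f z) \<le> e" using H2_vshift_tendsto[OF f] by blast
      have "emeasure lborel (E a) \<le> ennreal (80 / (pi * ?l\<^sup>2) * (H2_sup (\<lambda>z. f z - vshift a f z))\<^sup>2)"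
        unfolding E_def by (rule H2_vertical_maximal_inequality[OF gH2[OF a(1)]]) simp
      also have "\<dots> \<le> ennreal (80 / (pi * ?l\<^sup>2) * e\<^sup>2)"
        using a(2) c by (intro ennreal_leI mult_left_mono power_mono) (auto simp: less_imp_le)
      also have "e\<^sup>2 = 1 / real (Suc n) / (80 / (pi * ?l\<^sup>2))"
        unfolding e_def using c by (intro real_sqrt_pow2 divide_nonneg_nonneg) (auto simp: less_imp_le)
      also have "80 / (pi * ?l\<^sup>2) * (1 / real (Suc n) / (80 / (pi * ?l\<^sup>2))) = 1 / real (Suc n)"
        using c by (metis nonzero_mult_div_cancel_left times_divide_eq_right less_irrefl)
      finally show ?thesis using a(1) by blast
    qed
    then obtain a where a: "\<And>n. a n > 0" "\<And>n. emeasure lborel (E (a n)) \<le> ennreal (1 / real (Suc n))" by metis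
    define N where "N = (\<Inter>n. E (a n))"
    have N: "N \<in> sets lborel" unfolding N_def using E_sets a(1) by auto
    have "emeasure lborel N \<le> 0"
    proof (rule LIMSEQ_le_const)
      show "(\<lambda>n. ennreal (1 / real (Suc n))) \<longlonglongrightarrow> 0"
        using tendsto_ennrealI[OF LIMSEQ_Suc[OF lim_1_over_n]] by simp
      have "emeasure lborel N \<le> ennreal (1 / real (Suc n))" for n
        using emeasure_mono[of N "E (a n)" lborel] E_sets[OF a(1)] a(2)[of n] by (auto simp: N_def intro: order_trans)
      thus "\<exists>M. \<forall>n\<ge>M. emeasure lborel N \<le> ennreal (1 / real (Suc n))" by blast
    qed
    hence "N \<in> null_sets lborel" using N by (auto simp: null_sets_def)
    thus ?thesis by (rule AE_I') (use bad a(1) in \<open>auto simp: N_def\<close>)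
  qed
  hence "AE x in lborel. \<forall>k. good k x" by (simp add: AE_all_countable)
  thus ?thesis
  proof eventually_elim
    case (elim x)
    show ?case by (rule at_right_tendsto_of_Cauchy) (use elim in \<open>simp add: good_def\<close>)
  qed
qed

lemma bdry_eqI: "((\<lambda>y. f (Complex x y)) \<longlongrightarrow> l) (at_right 0) \<Longrightarrow> bdry f x = l"
  unfolding bdry_def by (rule tendsto_Lim[OF trivial_limit_at_right_real])

lemma H2_bdry_tendsto:
  "f \<in> H2 \<Longrightarrow> AE x in lborel. ((\<lambda>y. f (Complex x y)) \<longlongrightarrow> bdry f x) (at_right 0)"
  using H2_vertical_limits by (rule eventually_mono) (auto dest: bdry_eqI)

text \<open>By Cauchy's criterion the convergence set is a countable intersection of countable
  unions of closed sets; on it the boundary value is a sequential limit, elsewhere a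
  constant.\<close>

lemma measurable_bdry:
  assumes hol: "f holomorphic_on UHP"
  shows "bdry f \<in> borel_measurable borel"
proof -
  define C where "C k n = {x. \<forall>y y'. 0 < y \<and> y < 1 / real (Suc n) \<and> 0 < y' \<and> y' < 1 / real (Suc n) \<longrightarrow>
     cmod (f (Complex x y) - f (Complex x y')) \<le> 3 / real (Suc k)}" for k n :: nat
  define E where "E = {x. \<exists>l. ((\<lambda>y. f (Complex x y)) \<longlongrightarrow> l) (at_right 0)}"
  have "closed (C k n)" for k n
  proof -
    have "C k n = (\<Inter>y\<in>{0<..<1 / real (Suc n)}. \<Inter>y'\<in>{0<..<1 / real (Suc n)}. {x. cmod (line f y x - line f y' x) \<le> 3 / real (Suc k)})"
      by (auto simp: C_def line_def)
    moreover have "closed {x. cmod (line f y x - line f y' x) \<le> 3 / real (Suc k)}" if "y > 0" "y' > 0" for y y'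
      using that by (intro closed_Collect_le continuous_intros continuous_line_UHP hol)
    ultimately show ?thesis by (auto intro!: closed_INT)
  qed
  moreover have "E = (\<Inter>k. \<Union>n. C k n)"
  proof (intro equalityI subsetI)
    fix x assume "x \<in> E"
    then obtain l where l: "((\<lambda>y. f (Complex x y)) \<longlongrightarrow> l) (at_right 0)" by (auto simp: E_def)
    have "\<exists>n. x \<in> C k n" for k
    proof -
      have "eventually (\<lambda>y. dist (f (Complex x y)) l < 1 / real (Suc k)) (at_right 0)"
        by (rule tendstoD[OF l]) simp
      then obtain d where d: "d > 0" "\<And>y. 0 < y \<Longrightarrow> y < d \<Longrightarrow> dist (f (Complex x y)) l < 1 / real (Suc k)"
        unfolding eventually_at_right_field by auto
      obtain n where n: "1 / real (Suc n) < d" using d(1) nat_approx_posE by blast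
      have "x \<in> C k n" unfolding C_def
      proof (intro CollectI allI impI)
        fix y y' assume y: "0 < y \<and> y < 1 / real (Suc n) \<and> 0 < y' \<and> y' < 1 / real (Suc n)"
        hence "dist (f (Complex x y)) l < 1 / real (Suc k)" "dist (f (Complex x y')) l < 1 / real (Suc k)"
          using d(2) n by auto
        hence "cmod (f (Complex x y) - f (Complex x y')) < 1 / real (Suc k) + 1 / real (Suc k)"
          by (metis dist_norm dist_triangle_less_add dist_commute)
        also have "\<dots> \<le> 3 / real (Suc k)" by (simp add: divide_simps)
        finally show "cmod (f (Complex x y) - f (Complex x y')) \<le> 3 / real (Suc k)" by simp
      qed
      thus ?thesis by blast
    qed
    thus "x \<in> (\<Inter>k. \<Union>n. C k n)" by blast
  next
    fix x assume x: "x \<in> (\<Inter>k. \<Union>n. C k n)"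
    have "\<exists>l. ((\<lambda>y. f (Complex x y)) \<longlongrightarrow> l) (at_right 0)"
    proof (rule at_right_tendsto_of_Cauchy)
      fix k
      obtain n where "x \<in> C k n" using x by blast
      thus "\<exists>\<delta>>0. \<forall>y y'. 0 < y \<and> y < \<delta> \<and> 0 < y' \<and> y' < \<delta> \<longrightarrow> cmod (f (Complex x y) - f (Complex x y')) \<le> 3 / real (Suc k)"
        unfolding C_def by (intro exI[of _ "1 / real (Suc n)"]) simp
    qed
    thus "x \<in> E" by (simp add: E_def)
  qed
  ultimately have E[measurable]: "E \<in> sets borel" by auto
  \<comment> \<open>The value to which \<open>Lim\<close> unfolds where no limit exists; it is the
    same at all such points.\<close>
  define c where "c = (THE l::complex. False)"
  have eq: "bdry f = (\<lambda>x. if x \<in> E then lim (\<lambda>n. line f (1 / real (Suc n)) x) else c)"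
  proof
    fix x
    show "bdry f x = (if x \<in> E then lim (\<lambda>n. line f (1 / real (Suc n)) x) else c)"
    proof (cases "x \<in> E")
      case True
      then obtain l where l: "((\<lambda>y. f (Complex x y)) \<longlongrightarrow> l) (at_right 0)" by (auto simp: E_def)
      have "filterlim (\<lambda>n. 1 / real (Suc n)) (at_right 0) sequentially"
        unfolding filterlim_at using LIMSEQ_Suc[OF lim_1_over_n] by auto
      from filterlim_compose[OF l this] have "(\<lambda>n. line f (1 / real (Suc n)) x) \<longlonglongrightarrow> l" by (simp add: line_def)
      hence "lim (\<lambda>n. line f (1 / real (Suc n)) x) = l" by (rule limI)
      thus ?thesis using True bdry_eqI[OF l] by (simp only: if_True)
    next
      case False
      thus ?thesis by (simp add: E_def bdry_def Topological_Spaces.Lim_def c_def)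
    qed
  qed
  have [measurable]: "(\<lambda>x. lim (\<lambda>n. line f (1 / real (Suc n)) x)) \<in> borel_measurable borel"
    by (intro borel_measurable_lim_metric measurable_line_UHP hol) simp
  show ?thesis unfolding eq by measurable
qed

section \<open>Boundary functions as limits in L^2\<close>

lemma L2_Fatou:
  assumes g: "\<And>n. square_integrable (g n)" and m[measurable]: "h \<in> borel_measurable borel"
    and bd: "eventually (\<lambda>n. L2_norm (g n) \<le> C) sequentially"
    and lim: "AE x in lborel. (\<lambda>n. g n x) \<longlonglongrightarrow> h x" and C: "C \<ge> 0"
  shows "square_integrable h" "L2_norm h \<le> C"
proof -
  have [measurable]: "g n \<in> borel_measurable borel" for n using g by (rule square_integrable_measurable)
  have "(\<integral>\<^sup>+x. ennreal ((cmod (h x))\<^sup>2) \<partial>lborel) = (\<integral>\<^sup>+x. liminf (\<lambda>n. ennreal ((cmod (g n x))\<^sup>2)) \<partial>lborel)"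
  proof (rule nn_integral_cong_AE)
    show "AE x in lborel. ennreal ((cmod (h x))\<^sup>2) = liminf (\<lambda>n. ennreal ((cmod (g n x))\<^sup>2))"
      using lim
    proof eventually_elim
      case (elim x)
      have "(\<lambda>n. ennreal ((cmod (g n x))\<^sup>2)) \<longlonglongrightarrow> ennreal ((cmod (h x))\<^sup>2)"
        by (intro tendsto_intros tendsto_ennrealI elim)
      thus ?case by (rule lim_imp_Liminf[OF sequentially_bot, symmetric])
    qed
  qed
  also have "\<dots> \<le> liminf (\<lambda>n. \<integral>\<^sup>+x. ennreal ((cmod (g n x))\<^sup>2) \<partial>lborel)"
    by (rule nn_integral_liminf) measurable
  also have "\<dots> \<le> ennreal (C\<^sup>2)"
  proof (rule Liminf_le)
    show "\<forall>\<^sub>F n in sequentially. (\<integral>\<^sup>+x. ennreal ((cmod (g n x))\<^sup>2) \<partial>lborel) \<le> ennreal (C\<^sup>2)"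
      using bd by eventually_elim
        (simp add: nn_integral_square_integrable[OF g] ennreal_leI power_mono)
  qed simp
  finally have le: "(\<integral>\<^sup>+x. ennreal ((cmod (h x))\<^sup>2) \<partial>lborel) \<le> ennreal (C\<^sup>2)" .
  show "square_integrable h" "L2_norm h \<le> C" by (rule square_integrableI[OF m le C])+
qed

lemma filterlim_inverse_Suc_at_right: "filterlim (\<lambda>n. 1 / real (Suc n)) (at_right 0) sequentially"
  unfolding filterlim_at using LIMSEQ_Suc[OF lim_1_over_n] by auto

text \<open>Fatou for b -> 0 applied to \<open>line f a\<close> minus \<open>line f b\<close>, whose
  norm is small by \<open>H2_line_Cauchy\<close>: the pointwise boundary limit is also the limit in
  L^2.\<close>

lemma H2_line_tendsto_bdry:
  assumes f: "f \<in> H2" and e: "e > 0"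
  obtains \<delta> where "\<delta> > 0" "\<And>a. \<lbrakk>0 < a; a < \<delta>\<rbrakk> \<Longrightarrow> square_integrable (\<lambda>x. line f a x - bdry f x)"
    "\<And>a. \<lbrakk>0 < a; a < \<delta>\<rbrakk> \<Longrightarrow> L2_norm (\<lambda>x. line f a x - bdry f x) \<le> e"
proof -
  obtain \<delta> where d: "\<delta> > 0"
    "\<And>a b. \<lbrakk>0 < a; a < \<delta>; 0 < b; b < \<delta>\<rbrakk> \<Longrightarrow> L2_norm (\<lambda>x. line f a x - line f b x) \<le> e"
    using H2_line_Cauchy[OF f e] by blast
  have *: "square_integrable (\<lambda>x. line f a x - bdry f x) \<and> L2_norm (\<lambda>x. line f a x - bdry f x) \<le> e"
    if a: "0 < a" "a < \<delta>" for a
  proof -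
    let ?g = "\<lambda>n x. line f a x - line f (1 / real (Suc n)) x"
    have sq: "square_integrable (?g n)" for n
      by (intro square_integrable_diff H2_line f a) simp
    have m: "(\<lambda>x. line f a x - bdry f x) \<in> borel_measurable borel"
      by (intro borel_measurable_diff measurable_bdry measurable_line_UHP H2_holomorphic f a)
    have ev: "eventually (\<lambda>n. L2_norm (?g n) \<le> e) sequentially"
      using order_tendstoD(2)[OF LIMSEQ_Suc[OF lim_1_over_n] d(1)]
      by eventually_elim (use d(2) a in simp)
    have lim: "AE x in lborel. (\<lambda>n. ?g n x) \<longlonglongrightarrow> line f a x - bdry f x"
      using H2_bdry_tendsto[OF f]
    proof eventually_elim
      case (elim x)
      have "(\<lambda>n. line f (1 / real (Suc n)) x) \<longlonglongrightarrow> bdry f x"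
        using filterlim_compose[OF elim filterlim_inverse_Suc_at_right] by (simp add: line_def)
      thus ?case by (intro tendsto_intros)
    qed
    show ?thesis using L2_Fatou[OF sq m ev lim] e by simp
  qed
  show ?thesis by (rule that[OF d(1)]) (use * in auto)
qed

lemma square_integrable_bdry: assumes f: "f \<in> H2" shows "square_integrable (bdry f)"
proof -
  obtain \<delta> where d: "\<delta> > 0" "\<And>a. \<lbrakk>0 < a; a < \<delta>\<rbrakk> \<Longrightarrow> square_integrable (\<lambda>x. line f a x - bdry f x)"
    using H2_line_tendsto_bdry[OF f zero_less_one] by metis
  have "square_integrable (\<lambda>x. line f (\<delta>/2) x - (line f (\<delta>/2) x - bdry f x))"
    using d by (intro square_integrable_diff H2_line f d(2)) auto
  thus ?thesis by simp
qed

text \<open>One inequality is Fatou, the other the convergence of the lines in L^2.\<close>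

lemma L2_norm_bdry: assumes f: "f \<in> H2" shows "L2_norm (bdry f) = H2_sup f"
proof (rule antisym)
  have bd: "eventually (\<lambda>n. L2_norm (line f (1 / real (Suc n))) \<le> H2_sup f) sequentially"
    by (intro always_eventually allI H2_line f) simp
  have lim: "AE x in lborel. (\<lambda>n. line f (1 / real (Suc n)) x) \<longlonglongrightarrow> bdry f x"
    using H2_bdry_tendsto[OF f]
  proof eventually_elim
    case (elim x)
    show ?case using filterlim_compose[OF elim filterlim_inverse_Suc_at_right] by (simp add: line_def)
  qed
  show "L2_norm (bdry f) \<le> H2_sup f"
    by (rule L2_Fatou(2)[OF _ measurable_bdry[OF H2_holomorphic[OF f]] bd lim])
       (auto intro: H2_line f)
  show "H2_sup f \<le> L2_norm (bdry f)"
  proof (rule field_le_epsilon)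
    fix e :: real assume e: "e > 0"
    obtain \<delta> where d: "\<delta> > 0" "\<And>a. \<lbrakk>0 < a; a < \<delta>\<rbrakk> \<Longrightarrow> square_integrable (\<lambda>x. line f a x - bdry f x)"
      "\<And>a. \<lbrakk>0 < a; a < \<delta>\<rbrakk> \<Longrightarrow> L2_norm (\<lambda>x. line f a x - bdry f x) \<le> e"
      using H2_line_tendsto_bdry[OF f e] by metis
    show "H2_sup f \<le> L2_norm (bdry f) + e"
    proof (rule H2_sup_le_near_boundary[OF f d(1)])
      fix y assume y: "0 < y" "y < \<delta>"
      show "L2_norm (line f y) \<le> L2_norm (bdry f) + e"
        using L2_norm_triangle[OF d(2)[OF y] square_integrable_bdry[OF f]] d(3)[OF y] by simp
    qed
  qed
qed

lemma H2_norm_eq: "H2_norm f = L2_norm (bdry f)"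
  by (simp add: H2_norm_def H2_inner_def L2_inner_self del: of_real_power)

lemma H2_norm_eq_sup: "f \<in> H2 \<Longrightarrow> H2_norm f = H2_sup f"
  by (simp add: H2_norm_eq L2_norm_bdry)

lemma L2_inner_line_tendsto:
  assumes f: "f \<in> H2" and k: "square_integrable k"
  shows "((\<lambda>a. L2_inner (line f a) k) \<longlongrightarrow> L2_inner (bdry f) k) (at_right 0)"
proof (rule tendstoI)
  fix e :: real assume e: "e > 0"
  define e' where "e' = e / (L2_norm k + 1)"
  have e': "e' > 0" using e by (simp add: e'_def add_nonneg_pos)
  obtain \<delta> where d: "\<delta> > 0" "\<And>a. \<lbrakk>0 < a; a < \<delta>\<rbrakk> \<Longrightarrow> square_integrable (\<lambda>x. line f a x - bdry f x)"
    "\<And>a. \<lbrakk>0 < a; a < \<delta>\<rbrakk> \<Longrightarrow> L2_norm (\<lambda>x. line f a x - bdry f x) \<le> e'"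
    using H2_line_tendsto_bdry[OF f e'] by metis
  have "eventually (\<lambda>a. 0 < a \<and> a < \<delta>) (at_right 0)" using eventually_at_right_real[OF d(1)] by simp
  thus "eventually (\<lambda>a. dist (L2_inner (line f a) k) (L2_inner (bdry f) k) < e) (at_right 0)"
  proof eventually_elim
    case (elim a)
    have "L2_inner (line f a) k - L2_inner (bdry f) k = L2_inner (\<lambda>x. line f a x - bdry f x) k"
      by (rule L2_inner_diff_left[symmetric]) (use elim in \<open>auto intro: H2_line f square_integrable_bdry k\<close>)
    hence "dist (L2_inner (line f a) k) (L2_inner (bdry f) k) \<le> L2_norm (\<lambda>x. line f a x - bdry f x) * L2_norm k"
      using L2_Cauchy_Schwarz[OF d(2) k] elim by (simp add: dist_norm)
    also have "\<dots> \<le> e' * L2_norm k" using d(3) elim by (intro mult_right_mono) auto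
    also have "\<dots> < e' * (L2_norm k + 1)" using e' by (intro mult_strict_left_mono) auto
    also have "\<dots> = e" by (simp add: e'_def add_nonneg_eq_0_iff)
    finally show ?case .
  qed
qed

subsection \<open>Reproducing kernels\<close>

text \<open>The Szego kernel of the half plane, for the inner product with Lebesgue measure on the
  line; the value 0 outside is the normal form of \<open>H2\<close>.\<close>

definition cker :: "complex \<Rightarrow> complex \<Rightarrow> complex" where
  "cker w = (\<lambda>z. if Im z > 0 then \<i> / (2 * of_real pi) * (1 / (z - cnj w)) else 0)"

text \<open>The derivative of \<open>cker w\<close> with respect to the conjugate of w; pairing with
  it therefore yields the derivative at w.\<close>

definition dker :: "complex \<Rightarrow> complex \<Rightarrow> complex" where
  "dker w = (\<lambda>z. 1 / (z - cnj w) * cker w z)"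

lemma Im_le_cmod_diff_cnj: "Im z > 0 \<Longrightarrow> Im w \<le> cmod (z - cnj w)"
  using abs_Im_le_cmod[of "z - cnj w"] by simp

lemma cker_in_H2: assumes w: "Im w > 0" shows "cker w \<in> H2"
proof (rule H2I)
  have "(\<lambda>z. \<i> / (2 * of_real pi) * (1 / (z - cnj w))) holomorphic_on UHP"
    using w by (intro holomorphic_intros) (auto simp: complex_eq_iff)
  thus "cker w holomorphic_on UHP" by (rule holomorphic_transform) (auto simp: cker_def)
  fix y :: real assume y: "y > 0"
  have l: "line (cker w) y = (\<lambda>x. \<i> / (2 * of_real pi) * (1 / (Complex x y - cnj w)))"
    using y by (simp add: line_def cker_def)
  have ne: "Im (cnj w) \<noteq> y" using w y by simp
  note k = Cauchy_kernel_L2[OF ne]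
  have "L2_norm (line (cker w) y) \<le> cmod (\<i> / (2 * of_real pi)) * L2_norm (\<lambda>x. 1 / (Complex x y - cnj w))"
    unfolding l by (rule L2_norm_bounded_mult[OF k(1)]) auto
  also have "\<dots> \<le> cmod (\<i> / (2 * of_real pi)) * sqrt (pi / Im w)"
    unfolding k(2) using y w by (intro mult_left_mono real_sqrt_le_mono divide_left_mono) auto
  finally show "square_integrable (line (cker w) y) \<and> L2_norm (line (cker w) y) \<le> cmod (\<i> / (2 * of_real pi)) * sqrt (pi / Im w)"
    using square_integrable_cmult[OF k(1)] unfolding l by blast
qed (simp add: cker_def)

lemma Complex_tendsto_at_right: "((\<lambda>y. Complex x y) \<longlongrightarrow> of_real x) (at_right 0)"
  unfolding complex_of_real_def by (intro tendsto_intros)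

lemma bdry_continuous_eqI:
  assumes "\<And>z. Im z > 0 \<Longrightarrow> f z = g z" "isCont g (of_real x)"
  shows "bdry f x = g (of_real x)"
proof (rule bdry_eqI)
  have "((\<lambda>y. g (Complex x y)) \<longlongrightarrow> g (of_real x)) (at_right 0)"
    by (rule isCont_tendsto_compose[OF assms(2) Complex_tendsto_at_right])
  moreover have "eventually (\<lambda>y. f (Complex x y) = g (Complex x y)) (at_right 0)"
    using eventually_at_right_less[of 0] by eventually_elim (simp add: assms(1))
  ultimately show "((\<lambda>y. f (Complex x y)) \<longlongrightarrow> g (of_real x)) (at_right 0)"
    by (simp add: tendsto_cong)
qed

lemma of_real_minus_cnj_nonzero: "Im w > 0 \<Longrightarrow> of_real x - cnj w \<noteq> 0" "Im w > 0 \<Longrightarrow> of_real x - w \<noteq> 0"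
  by (auto simp: complex_eq_iff)

lemma bdry_cker:
  assumes "Im w > 0" shows "bdry (cker w) x = \<i> / (2 * of_real pi) * (1 / (of_real x - cnj w))"
  by (rule bdry_continuous_eqI[of _ "\<lambda>z. \<i> / (2 * of_real pi) * (1 / (z - cnj w))"])
     (use of_real_minus_cnj_nonzero(1)[OF assms] in \<open>auto simp: cker_def intro!: continuous_intros\<close>)

lemma dker_in_H2: assumes w: "Im w > 0" shows "dker w \<in> H2"
  unfolding dker_def
proof (rule H2_bounded_mult[OF cker_in_H2[OF w]])
  show "(\<lambda>z. 1 / (z - cnj w)) holomorphic_on UHP"
    using w by (intro holomorphic_intros) (auto simp: complex_eq_iff)
  show "cmod (1 / (z - cnj w)) \<le> 1 / Im w" if "Im z > 0" for z
  proof -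
    have "Im w \<le> cmod (z - cnj w)" by (rule Im_le_cmod_diff_cnj[OF that])
    thus ?thesis using w by (simp add: norm_divide frac_le)
  qed
qed

lemma bdry_dker:
  assumes "Im w > 0" shows "bdry (dker w) x = \<i> / (2 * of_real pi) * (1 / (of_real x - cnj w)\<^sup>2)"
  by (rule bdry_continuous_eqI[of _ "\<lambda>z. \<i> / (2 * of_real pi) * (1 / (z - cnj w)\<^sup>2)"])
     (use of_real_minus_cnj_nonzero(1)[OF assms] in \<open>auto simp: dker_def cker_def power2_eq_square intro!: continuous_intros\<close>)

lemma cnj_kernel_constant: "cnj (\<i> / (2 * of_real pi) * c) = 1 / (2 * of_real pi * \<i>) * cnj c"
  by (simp add: field_simps)

text \<open>On the line of height a, Cauchy's formula is taken at w + i a: seen from that line the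
  kernel is always the boundary function of \<open>cker w\<close>, so only f varies as a tends to
  0.\<close>

lemma H2_reproducing:
  assumes f: "f \<in> H2" and w: "Im w > 0"
  shows "H2_inner f (cker w) = f w"
proof -
  let ?k = "bdry (cker w)"
  have k: "square_integrable ?k" by (intro square_integrable_bdry cker_in_H2 w)
  have "L2_inner (line f a) ?k = f (w + \<i> * of_real a)" if a: "a > 0" for a
  proof -
    have "L2_inner (line f a) ?k = (LINT x|lborel. 1 / (2 * of_real pi * \<i>) * (line f a x / (Complex x a - (w + \<i> * of_real a))))"
      unfolding L2_inner_def
    proof (rule Bochner_Integration.integral_cong)
      fix x
      have "Complex x a - (w + \<i> * of_real a) = of_real x - w" by (simp add: complex_eq_iff)
      thus "line f a x * cnj (?k x) = 1 / (2 * of_real pi * \<i>) * (line f a x / (Complex x a - (w + \<i> * of_real a)))"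
        unfolding bdry_cker[OF w] cnj_kernel_constant by simp
    qed simp
    also have "\<dots> = 1 / (2 * of_real pi * \<i>) * (2 * of_real pi * \<i> * f (w + \<i> * of_real a))"
      using Cauchy_line_above[OF f a, of "w + \<i> * of_real a"] w by (simp only: integral_mult_right_zero) simp
    finally show ?thesis by simp
  qed
  hence "eventually (\<lambda>a. L2_inner (line f a) ?k = f (w + \<i> * of_real a)) (at_right 0)"
    using eventually_at_right_less[of 0] by (auto elim: eventually_mono)
  moreover have "((\<lambda>a. f (w + \<i> * of_real a)) \<longlongrightarrow> f w) (at_right 0)"
  proof (rule isCont_tendsto_compose[where g = f])
    show "isCont f w"
      using holomorphic_on_imp_continuous_on[OF H2_holomorphic[OF f]] w
      by (simp add: continuous_on_eq_continuous_at[OF open_UHP])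
    have "((\<lambda>a. w + \<i> * of_real a) \<longlongrightarrow> w + \<i> * of_real 0) (at_right 0)" by (intro tendsto_intros)
    thus "((\<lambda>a. w + \<i> * of_real a) \<longlongrightarrow> w) (at_right 0)" by simp
  qed
  ultimately have "((\<lambda>a. L2_inner (line f a) ?k) \<longlongrightarrow> f w) (at_right 0)" by (simp add: tendsto_cong)
  from tendsto_unique[OF trivial_limit_at_right_real L2_inner_line_tendsto[OF f k] this]
  show ?thesis by (simp add: H2_inner_def)
qed

text \<open>Difference quotients of the reproducing formula, by dominated convergence. The
  increments are real, so the shifted points keep their imaginary part and 1 / Im w bounds the extra
  factor uniformly.\<close>

lemma H2_deriv_reproducing:
  assumes f: "f \<in> H2" and w: "Im w > 0"
  shows "H2_inner f (dker w) = deriv f w"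
proof -
  define c where "c = 1 / (2 * of_real pi * \<i>)"
  define h where "h n = 1 / real (Suc n)" for n
  have h: "h n > 0" for n by (simp add: h_def)
  have hlim: "h \<longlonglongrightarrow> 0" unfolding h_def by (rule LIMSEQ_Suc[OF lim_1_over_n])
  have sb: "square_integrable (bdry f)" by (rule square_integrable_bdry[OF f])
  note mb[measurable] = square_integrable_measurable[OF sb]
  let ?g = "\<lambda>n x. bdry f x * (c * (1 / ((of_real x - (w + of_real (h n))) * (of_real x - w))))"
  let ?G = "\<lambda>x. bdry f x * (c * (1 / (of_real x - w)\<^sup>2))"
  have nz: "of_real x - (w + of_real t) \<noteq> 0" for x t using w by (simp add: complex_eq_iff)
  have "H2_inner f (dker w) = (LINT x|lborel. ?G x)"
    unfolding H2_inner_def L2_inner_def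
    by (intro Bochner_Integration.integral_cong refl) (simp only: bdry_dker[OF w] cnj_kernel_constant c_def
        complex_cnj_divide complex_cnj_one complex_cnj_power complex_cnj_diff complex_cnj_complex_of_real complex_cnj_cnj)
  have quot: "(f (w + of_real (h n)) - f w) / of_real (h n) = (LINT x|lborel. ?g n x)" for n
  proof -
    let ?v = "w + of_real (h n)"
    have v: "Im ?v > 0" using w by simp
    have i1: "integrable lborel (\<lambda>x. bdry f x * cnj (bdry (cker u) x))" if "Im u > 0" for u
      by (intro integrable_mult_square_integrable sb square_integrable_bdry cker_in_H2 that)
    have "f ?v - f w = (LINT x|lborel. bdry f x * cnj (bdry (cker ?v) x)) - (LINT x|lborel. bdry f x * cnj (bdry (cker w) x))"
      using H2_reproducing[OF f v] H2_reproducing[OF f w] by (simp add: H2_inner_def L2_inner_def)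
    also have "\<dots> = (LINT x|lborel. bdry f x * cnj (bdry (cker ?v) x) - bdry f x * cnj (bdry (cker w) x))"
      by (rule Bochner_Integration.integral_diff[OF i1[OF v] i1[OF w], symmetric])
    also have "\<dots> = (LINT x|lborel. of_real (h n) * ?g n x)"
    proof (rule Bochner_Integration.integral_cong)
      fix x
      have ne: "of_real x - ?v \<noteq> 0" "of_real x - w \<noteq> 0" using nz[of x "h n"] nz[of x 0] by auto
      have "1 / (of_real x - ?v) - 1 / (of_real x - w) = of_real (h n) * (1 / ((of_real x - ?v) * (of_real x - w)))"
        using ne by (simp add: divide_simps)
      hence "bdry f x * (c * (1 / (of_real x - ?v) - 1 / (of_real x - w))) = of_real (h n) * ?g n x" by (simp only: mult_ac)
      thus "bdry f x * cnj (bdry (cker ?v) x) - bdry f x * cnj (bdry (cker w) x) = of_real (h n) * ?g n x"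
        unfolding bdry_cker[OF v] bdry_cker[OF w] cnj_kernel_constant c_def[symmetric]
        by (simp add: right_diff_distrib)
    qed simp
    also have "\<dots> = of_real (h n) * (LINT x|lborel. ?g n x)" by (simp only: integral_mult_right_zero)
    finally show ?thesis using h[of n] by simp
  qed
  have "(\<lambda>n. LINT x|lborel. ?g n x) \<longlonglongrightarrow> (LINT x|lborel. ?G x)"
  proof (rule integral_dominated_convergence)
    let ?W = "\<lambda>x. cmod (bdry f x) * cmod (bdry (cker w) x)"
    show "integrable lborel (\<lambda>x. 1 / Im w * ?W x)"
      by (intro integrable_mult_right integrable_mult_square_integrable sb square_integrable_bdry cker_in_H2 w)
    show "?g n \<in> borel_measurable lborel" for n by measurable
    show "?G \<in> borel_measurable lborel" by measurable
    show "AE x in lborel. norm (?g n x) \<le> 1 / Im w * ?W x" for n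
    proof (rule AE_I2)
      fix x
      have "Im w \<le> cmod (of_real x - (w + of_real (h n)))" using abs_Im_le_cmod[of "of_real x - (w + of_real (h n))"] by simp
      hence "1 / cmod (of_real x - (w + of_real (h n))) \<le> 1 / Im w" using w by (intro frac_le) auto
      hence "cmod (bdry f x) * cmod c * (1 / cmod (of_real x - w)) * (1 / cmod (of_real x - (w + of_real (h n))))
        \<le> cmod (bdry f x) * cmod c * (1 / cmod (of_real x - w)) * (1 / Im w)"
        by (intro mult_left_mono) auto
      moreover have "cmod (bdry (cker w) x) = cmod c * (1 / cmod (of_real x - w))"
      proof -
        have "cmod (bdry (cker w) x) = cmod (cnj (bdry (cker w) x))" by simp
        also have "\<dots> = cmod c * (1 / cmod (of_real x - w))"
          unfolding bdry_cker[OF w] cnj_kernel_constant c_def[symmetric] by (simp add: norm_mult norm_divide)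
        finally show ?thesis .
      qed
      ultimately show "norm (?g n x) \<le> 1 / Im w * ?W x" by (simp add: norm_mult norm_divide mult_ac)
    qed
    show "AE x in lborel. (\<lambda>n. ?g n x) \<longlonglongrightarrow> ?G x"
    proof (rule AE_I2)
      fix x
      have "(\<lambda>n. ?g n x) \<longlonglongrightarrow> bdry f x * (c * (1 / ((of_real x - (w + of_real 0)) * (of_real x - w))))"
        using nz[of x 0] by (intro tendsto_intros hlim) auto
      thus "(\<lambda>n. ?g n x) \<longlonglongrightarrow> ?G x" by (simp add: power2_eq_square)
    qed
  qed
  moreover have "(\<lambda>n. (f (w + of_real (h n)) - f w) / of_real (h n)) \<longlonglongrightarrow> deriv f w"
  proof -
    have "(f has_field_derivative deriv f w) (at w)"
      using holomorphic_derivI[OF H2_holomorphic[OF f] open_UHP] w by simp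
    hence D: "((\<lambda>t. (f (w + t) - f w) / t) \<longlongrightarrow> deriv f w) (at 0)" by (simp add: DERIV_def)
    have "filterlim (\<lambda>n. complex_of_real (h n)) (at 0) sequentially"
      unfolding filterlim_at using tendsto_of_real[OF hlim] h by (auto simp: less_imp_neq[symmetric])
    from filterlim_compose[OF D this] show ?thesis .
  qed
  ultimately show ?thesis
    using LIMSEQ_unique \<open>H2_inner f (dker w) = (LINT x|lborel. ?G x)\<close> by (simp only: quot)
qed

subsection \<open>Multiplication by bounded functions\<close>

lemma Hinf_bound: "b \<in> Hinf \<Longrightarrow> Im z > 0 \<Longrightarrow> cmod (b z) \<le> Hinf_norm b"
proof -
  assume b: "b \<in> Hinf" and z: "Im z > 0"
  have "\<exists>a. \<forall>z\<in>UHP. cmod (b z) \<le> a" using b by (auto simp: Hinf_def bounded_iff)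
  then obtain a where "\<And>z. z \<in> UHP \<Longrightarrow> cmod (b z) \<le> a" by blast
  hence "bdd_above ((\<lambda>z. cmod (b z)) ` UHP)" by (intro bdd_aboveI2)
  thus ?thesis unfolding Hinf_norm_def using z by (intro cSUP_upper) simp_all
qed

lemma Hinf_holomorphic: "b \<in> Hinf \<Longrightarrow> b holomorphic_on UHP"
  by (simp add: Hinf_def)

lemma H2_Hinf_mult: "b \<in> Hinf \<Longrightarrow> f \<in> H2 \<Longrightarrow> (\<lambda>z. b z * f z) \<in> H2"
  by (rule H2_bounded_mult) (auto intro: Hinf_bound Hinf_holomorphic)

text \<open>Multiplication by \<open>cker \<i>\<close> brings b into \<open>H2\<close>, where limits
  are known; the kernel extends continuously and without zeros to the line, so it can be divided
  out.\<close>

lemma Hinf_bdry_tendsto: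
  assumes b: "b \<in> Hinf"
  shows "AE x in lborel. ((\<lambda>y. b (Complex x y)) \<longlongrightarrow> bdry b x) (at_right 0)"
proof -
  have H: "(\<lambda>z. b z * cker \<i> z) \<in> H2" by (intro H2_Hinf_mult b cker_in_H2) simp
  let ?c = "\<lambda>z. \<i> / (2 * of_real pi) * (1 / (z - cnj \<i>))"
  from H2_vertical_limits[OF H] show ?thesis
  proof eventually_elim
    case (elim x)
    then obtain l where l: "((\<lambda>y. b (Complex x y) * cker \<i> (Complex x y)) \<longlongrightarrow> l) (at_right 0)" by blast
    have nz: "?c (of_real x) \<noteq> 0" using of_real_minus_cnj_nonzero(1)[of \<i> x] by simp
    have "isCont ?c (of_real x)" using of_real_minus_cnj_nonzero(1)[of \<i> x] by (intro continuous_intros) auto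
    hence "((\<lambda>y. ?c (Complex x y)) \<longlongrightarrow> ?c (of_real x)) (at_right 0)"
      by (rule isCont_tendsto_compose[OF _ Complex_tendsto_at_right])
    from tendsto_divide[OF l this nz]
    have "((\<lambda>y. b (Complex x y) * cker \<i> (Complex x y) / ?c (Complex x y)) \<longlongrightarrow> l / ?c (of_real x)) (at_right 0)" .
    moreover have "eventually (\<lambda>y. b (Complex x y) * cker \<i> (Complex x y) / ?c (Complex x y) = b (Complex x y)) (at_right 0)"
      using eventually_at_right_less[of 0]
    proof eventually_elim
      case (elim y)
      have "Complex x y - cnj \<i> \<noteq> 0" using elim by (simp add: complex_eq_iff)
      hence "?c (Complex x y) \<noteq> 0" by simp
      moreover have "cker \<i> (Complex x y) = ?c (Complex x y)" using elim by (simp add: cker_def)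
      ultimately show ?case by (metis nonzero_mult_div_cancel_right)
    qed
    ultimately have "((\<lambda>y. b (Complex x y)) \<longlongrightarrow> l / ?c (of_real x)) (at_right 0)" by (simp add: tendsto_cong)
    thus ?case using bdry_eqI by fastforce
  qed
qed

lemma Hinf_bdry_bound:
  assumes b: "b \<in> Hinf" shows "AE x in lborel. cmod (bdry b x) \<le> Hinf_norm b"
  using Hinf_bdry_tendsto[OF b]
proof eventually_elim
  case (elim x)
  show ?case
  proof (rule tendsto_upperbound[OF tendsto_norm[OF elim]])
    show "\<forall>\<^sub>F y in at_right 0. cmod (b (Complex x y)) \<le> Hinf_norm b"
      using eventually_at_right_less[of 0] by eventually_elim (simp add: Hinf_bound[OF b])
  qed simp
qed

lemma measurable_bdry_Hinf: "b \<in> Hinf \<Longrightarrow> bdry b \<in> borel_measurable borel"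
  by (intro measurable_bdry Hinf_holomorphic)

lemma bdry_mult_AE:
  assumes b: "b \<in> Hinf" and f: "f \<in> H2"
  shows "AE x in lborel. bdry (\<lambda>z. b z * f z) x = bdry b x * bdry f x"
  using Hinf_bdry_tendsto[OF b] H2_bdry_tendsto[OF f]
  by eventually_elim (intro bdry_eqI tendsto_mult)

lemma bdry_add_AE:
  assumes f: "f \<in> H2" and g: "g \<in> H2"
  shows "AE x in lborel. bdry (\<lambda>z. f z + g z) x = bdry f x + bdry g x"
  using H2_bdry_tendsto[OF f] H2_bdry_tendsto[OF g]
  by eventually_elim (intro bdry_eqI tendsto_add)

lemma bdry_diff_AE:
  assumes f: "f \<in> H2" and g: "g \<in> H2"
  shows "AE x in lborel. bdry (\<lambda>z. f z - g z) x = bdry f x - bdry g x"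
  using H2_bdry_tendsto[OF f] H2_bdry_tendsto[OF g]
  by eventually_elim (intro bdry_eqI tendsto_diff)

lemma bdry_cmult_AE:
  assumes f: "f \<in> H2"
  shows "AE x in lborel. bdry (\<lambda>z. c * f z) x = c * bdry f x"
  using H2_bdry_tendsto[OF f]
  by eventually_elim (intro bdry_eqI tendsto_mult tendsto_const)

lemma measurable_bdry_H2: "f \<in> H2 \<Longrightarrow> bdry f \<in> borel_measurable borel"
  by (intro measurable_bdry H2_holomorphic)

lemma L2_inner_bdry_add:
  assumes f: "f \<in> H2" and g: "g \<in> H2" and h: "square_integrable h"
  shows "L2_inner (bdry (\<lambda>z. f z + g z)) h = L2_inner (bdry f) h + L2_inner (bdry g) h"
proof -
  note [measurable] = measurable_bdry_H2[OF f] measurable_bdry_H2[OF g]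
    measurable_bdry_H2[OF H2_add[OF f g]] square_integrable_measurable[OF h]
  have "L2_inner (bdry (\<lambda>z. f z + g z)) h = L2_inner (\<lambda>x. bdry f x + bdry g x) h"
    by (rule L2_inner_AE_cong) (use bdry_add_AE[OF f g] in auto)
  also have "\<dots> = L2_inner (bdry f) h + L2_inner (bdry g) h"
    by (intro L2_inner_add_left square_integrable_bdry f g h)
  finally show ?thesis .
qed

lemma L2_inner_bdry_diff:
  assumes f: "f \<in> H2" and g: "g \<in> H2" and h: "square_integrable h"
  shows "L2_inner (bdry (\<lambda>z. f z - g z)) h = L2_inner (bdry f) h - L2_inner (bdry g) h"
proof -
  note [measurable] = measurable_bdry_H2[OF f] measurable_bdry_H2[OF g]
    measurable_bdry_H2[OF H2_diff[OF f g]] square_integrable_measurable[OF h]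
  have "L2_inner (bdry (\<lambda>z. f z - g z)) h = L2_inner (\<lambda>x. bdry f x - bdry g x) h"
    by (rule L2_inner_AE_cong) (use bdry_diff_AE[OF f g] in auto)
  also have "\<dots> = L2_inner (bdry f) h - L2_inner (bdry g) h"
    by (intro L2_inner_diff_left square_integrable_bdry f g h)
  finally show ?thesis .
qed

lemma L2_inner_bdry_cmult:
  assumes f: "f \<in> H2" and h: "square_integrable h"
  shows "L2_inner (bdry (\<lambda>z. c * f z)) h = c * L2_inner (bdry f) h"
proof -
  note [measurable] = measurable_bdry_H2[OF f] measurable_bdry_H2[OF H2_cmult[OF f, of c]]
    square_integrable_measurable[OF h]
  have "L2_inner (bdry (\<lambda>z. c * f z)) h = L2_inner (\<lambda>x. c * bdry f x) h"
    by (rule L2_inner_AE_cong) (use bdry_cmult_AE[OF f] in auto)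
  thus ?thesis by (simp add: L2_inner_cmult_left)
qed

lemma H2_inner_add_left:
  "\<lbrakk>f \<in> H2; g \<in> H2; h \<in> H2\<rbrakk> \<Longrightarrow> H2_inner (\<lambda>z. f z + g z) h = H2_inner f h + H2_inner g h"
  unfolding H2_inner_def by (intro L2_inner_bdry_add square_integrable_bdry)

lemma H2_inner_diff_left:
  "\<lbrakk>f \<in> H2; g \<in> H2; h \<in> H2\<rbrakk> \<Longrightarrow> H2_inner (\<lambda>z. f z - g z) h = H2_inner f h - H2_inner g h"
  unfolding H2_inner_def by (intro L2_inner_bdry_diff square_integrable_bdry)

lemma H2_inner_cmult_left:
  "\<lbrakk>f \<in> H2; h \<in> H2\<rbrakk> \<Longrightarrow> H2_inner (\<lambda>z. c * f z) h = c * H2_inner f h"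
  unfolding H2_inner_def by (intro L2_inner_bdry_cmult square_integrable_bdry)

lemma H2_inner_cnj: "cnj (H2_inner f g) = H2_inner g f"
  by (simp add: H2_inner_def L2_inner_cnj)

lemma H2_inner_cmult_right:
  "\<lbrakk>f \<in> H2; h \<in> H2\<rbrakk> \<Longrightarrow> H2_inner f (\<lambda>z. c * h z) = cnj c * H2_inner f h"
  by (metis H2_inner_cmult_left H2_inner_cnj complex_cnj_cnj complex_cnj_mult)

lemma H2_inner_diff_right:
  "\<lbrakk>f \<in> H2; g \<in> H2; h \<in> H2\<rbrakk> \<Longrightarrow> H2_inner h (\<lambda>z. f z - g z) = H2_inner h f - H2_inner h g"
  using arg_cong[OF H2_inner_diff_left, of f g h cnj] by (simp add: H2_inner_cnj)

lemma H2_inner_self: "H2_inner f f = of_real ((H2_norm f)\<^sup>2)"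
  by (simp add: H2_inner_def L2_inner_self H2_norm_eq del: of_real_power)

lemma H2_Cauchy_Schwarz: "\<lbrakk>f \<in> H2; g \<in> H2\<rbrakk> \<Longrightarrow> cmod (H2_inner f g) \<le> H2_norm f * H2_norm g"
  unfolding H2_inner_def H2_norm_eq by (intro L2_Cauchy_Schwarz square_integrable_bdry)

lemma H2_norm_nonneg [simp]: "0 \<le> H2_norm f"
  by (simp add: H2_norm_eq)

lemma H2_norm_eq_0: assumes f: "f \<in> H2" and "H2_norm f = 0" shows "f = (\<lambda>z. 0)"
proof
  fix z show "f z = 0"
  proof (cases "Im z > 0")
    case True
    thus ?thesis using H2_pointwise_bound[OF f True] assms H2_norm_eq_sup[OF f] by simp
  qed (use H2_off[OF f] in simp)
qed

text \<open>The pointwise bound makes the sequence locally uniformly Cauchy, which gives a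
  holomorphic limit; Fatou on each line turns estimates for f_m - f_n into estimates for f_m -
  g.\<close>

lemma H2_complete:
  assumes f: "\<And>n. f n \<in> H2"
    and C: "\<And>e. e > 0 \<Longrightarrow> \<exists>N. \<forall>m\<ge>N. \<forall>n\<ge>N. H2_norm (\<lambda>z. f m z - f n z) < e"
  obtains g where "g \<in> H2" "(\<lambda>n. H2_norm (\<lambda>z. f n z - g z)) \<longlonglongrightarrow> 0"
proof -
  have dH2: "(\<lambda>z. f m z - f n z) \<in> H2" for m n by (intro H2_diff f)
  have pw: "cmod (f m z - f n z) \<le> 3 * H2_norm (\<lambda>z. f m z - f n z) / sqrt (Im z)" if "Im z > 0" for m n z
    using H2_pointwise_bound[OF dH2 that] H2_norm_eq_sup[OF dH2] by simp
  have conv: "convergent (\<lambda>n. f n z)" for z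
  proof (cases "Im z > 0")
    case True
    show ?thesis
    proof (rule Cauchy_convergent, rule CauchyI)
      fix e :: real assume "e > 0"
      hence "e * sqrt (Im z) / 3 > 0" using True by simp
      from C[OF this] obtain N where N: "\<And>m n. m \<ge> N \<Longrightarrow> n \<ge> N \<Longrightarrow> H2_norm (\<lambda>z. f m z - f n z) < e * sqrt (Im z) / 3" by blast
      show "\<exists>M. \<forall>m\<ge>M. \<forall>n\<ge>M. norm (f m z - f n z) < e"
      proof (intro exI allI impI)
        fix m n assume "N \<le> m" "N \<le> n"
        from N[OF this] have "3 * H2_norm (\<lambda>z. f m z - f n z) / sqrt (Im z) < e" using True by (simp add: field_simps)
        thus "norm (f m z - f n z) < e" using pw[OF True, of m n] by linarith
      qed
    qed
  next
    case False
    thus ?thesis using H2_off[OF f] by (simp add: convergent_const)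
  qed
  define g where "g z = lim (\<lambda>n. f n z)" for z
  have lim: "(\<lambda>n. f n z) \<longlonglongrightarrow> g z" for z unfolding g_def using conv by (simp add: convergent_LIMSEQ_iff)
  have goff: "g z = 0" if "\<not> Im z > 0" for z
    using lim[of z] H2_off[OF f that] LIMSEQ_unique[OF lim[of z], of 0] by simp
  have ghol: "g holomorphic_on UHP"
  proof (rule holomorphic_uniform_sequence[OF open_UHP H2_holomorphic[OF f]])
    fix z assume z: "z \<in> UHP"
    define d where "d = Im z / 2"
    have d: "d > 0" using z by (simp add: d_def)
    have sub: "cball z d \<subseteq> UHP" using z by (intro cball_subset_UHP) (simp add: d_def)
    have Imd: "Im v \<ge> d" if "v \<in> cball z d" for v
    proof -
      have "\<bar>Im (z - v)\<bar> \<le> d" using that by (metis abs_Im_le_cmod dist_norm mem_cball order_trans)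
      hence "Im (z - v) \<le> d" by linarith
      thus ?thesis by (simp add: d_def)
    qed
    have "uniform_limit (cball z d) f g sequentially"
    proof (rule uniform_limitI)
      fix e :: real assume e: "e > 0"
      hence "e / 2 * sqrt d / 3 > 0" using d by simp
      from C[OF this] obtain N where N: "\<And>m n. m \<ge> N \<Longrightarrow> n \<ge> N \<Longrightarrow> H2_norm (\<lambda>z. f m z - f n z) < e / 2 * sqrt d / 3" by blast
      have "dist (f m v) (g v) < e" if m: "m \<ge> N" and v: "v \<in> cball z d" for m v
      proof -
        have "cmod (f m v - g v) \<le> e / 2"
        proof (rule tendsto_upperbound)
          show "(\<lambda>n. cmod (f m v - f n v)) \<longlonglongrightarrow> cmod (f m v - g v)" by (intro tendsto_intros lim)
          show "\<forall>\<^sub>F n in sequentially. cmod (f m v - f n v) \<le> e / 2"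
            using eventually_ge_at_top[of N]
          proof eventually_elim
            case (elim n)
            have "cmod (f m v - f n v) \<le> 3 * H2_norm (\<lambda>z. f m z - f n z) / sqrt (Im v)"
              using Imd[OF v] d by (intro pw) simp
            also have "\<dots> \<le> 3 * (e / 2 * sqrt d / 3) / sqrt d"
              using N[OF m elim] Imd[OF v] d e by (intro frac_le mult_left_mono) auto
            also have "\<dots> = e / 2" using d by simp
            finally show ?case .
          qed
        qed simp
        thus ?thesis using e by (simp add: dist_norm)
      qed
      thus "\<forall>\<^sub>F n in sequentially. \<forall>x\<in>cball z d. dist (f n x) (g x) < e"
        using eventually_sequentially by blast
    qed
    thus "\<exists>d>0. cball z d \<subseteq> UHP \<and> uniform_limit (cball z d) f g sequentially" using d sub by blast
  qed
  have diff: "(\<lambda>z. f m z - g z) \<in> H2 \<and> H2_sup (\<lambda>z. f m z - g z) \<le> e"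
    if N: "\<And>n. n \<ge> N \<Longrightarrow> H2_norm (\<lambda>z. f m z - f n z) < e" for m N e
  proof -
    have e: "e > 0" using N[of N] H2_norm_nonneg le_less_trans by blast
    have hol: "(\<lambda>z. f m z - g z) holomorphic_on UHP" by (intro holomorphic_on_diff ghol H2_holomorphic f)
    have off: "f m z - g z = 0" if "\<not> Im z > 0" for z using H2_off[OF f that] goff[OF that] by simp
    have ln: "square_integrable (line (\<lambda>z. f m z - g z) y) \<and> L2_norm (line (\<lambda>z. f m z - g z) y) \<le> e" if y: "y > 0" for y
    proof -
      have sq: "square_integrable (line (\<lambda>z. f m z - f n z) y)" for n by (rule H2_line(1)[OF dH2 y])
      have ms: "line (\<lambda>z. f m z - g z) y \<in> borel_measurable borel" by (rule measurable_line_UHP[OF hol y])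
      have ev: "eventually (\<lambda>n. L2_norm (line (\<lambda>z. f m z - f n z) y) \<le> e) sequentially"
        using eventually_ge_at_top[of N]
      proof eventually_elim
        case (elim n)
        thus ?case using N[OF elim] H2_line(2)[OF dH2 y, of m n] H2_norm_eq_sup[OF dH2, of m n] by simp
      qed
      have lm: "AE x in lborel. (\<lambda>n. line (\<lambda>z. f m z - f n z) y x) \<longlonglongrightarrow> line (\<lambda>z. f m z - g z) y x"
        unfolding line_def by (intro AE_I2 tendsto_intros lim)
      show ?thesis using L2_Fatou[OF sq ms ev lm] e by simp
    qed
    show ?thesis using H2I[OF hol off ln] by blast
  qed
  show ?thesis
  proof (rule that)
    obtain N where N: "\<And>m n. m \<ge> N \<Longrightarrow> n \<ge> N \<Longrightarrow> H2_norm (\<lambda>z. f m z - f n z) < 1" using C[of 1] by auto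
    have "(\<lambda>z. f N z - g z) \<in> H2" using diff[of N N 1] N by auto
    from H2_diff[OF f[of N] this] show "g \<in> H2" by simp
    show "(\<lambda>n. H2_norm (\<lambda>z. f n z - g z)) \<longlonglongrightarrow> 0"
    proof (rule LIMSEQ_I)
      fix r :: real assume r: "r > 0"
      hence "r / 2 > 0" by simp
      from C[OF this] obtain N where N: "\<And>m n. m \<ge> N \<Longrightarrow> n \<ge> N \<Longrightarrow> H2_norm (\<lambda>z. f m z - f n z) < r / 2" by blast
      have "H2_norm (\<lambda>z. f n z - g z) < r" if "n \<ge> N" for n
        using diff[of N n "r / 2"] N that r by (auto simp: H2_norm_eq_sup)
      thus "\<exists>no. \<forall>n\<ge>no. norm (H2_norm (\<lambda>z. f n z - g z) - 0) < r" by auto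
    qed
  qed
qed

subsection \<open>\<open>H\<^sup>2\<close> as a Hilbert space\<close>

text \<open>A type of its own, so that the lemmas on real inner product spaces apply; the complex
  structure comes back as the bounded operator \<open>cmul \<i>\<close>.\<close>

typedef h2 = H2 morphisms h2_fun h2_of
  by (rule exI[of _ "\<lambda>z. 0"]) simp

declare h2_of_inverse [simp] h2_fun_inverse [simp] h2_fun [simp]

lemma h2_eqI: "(\<And>z. h2_fun x z = h2_fun y z) \<Longrightarrow> x = y"
  by (metis ext h2_fun_inverse)

instantiation h2 :: real_inner
begin

definition zero_h2 :: h2 where "0 = h2_of (\<lambda>z. 0)"
definition plus_h2 :: "h2 \<Rightarrow> h2 \<Rightarrow> h2" where "x + y = h2_of (\<lambda>z. h2_fun x z + h2_fun y z)"
definition minus_h2 :: "h2 \<Rightarrow> h2 \<Rightarrow> h2" where "x - y = h2_of (\<lambda>z. h2_fun x z - h2_fun y z)"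
definition uminus_h2 :: "h2 \<Rightarrow> h2" where "- x = h2_of (\<lambda>z. - 1 * h2_fun x z)"
definition scaleR_h2 :: "real \<Rightarrow> h2 \<Rightarrow> h2" where "r *\<^sub>R x = h2_of (\<lambda>z. of_real r * h2_fun x z)"
definition inner_h2 :: "h2 \<Rightarrow> h2 \<Rightarrow> real" where "inner x y = Re (H2_inner (h2_fun x) (h2_fun y))"
definition norm_h2 :: "h2 \<Rightarrow> real" where "norm x = sqrt (inner x (x :: h2))"
definition dist_h2 :: "h2 \<Rightarrow> h2 \<Rightarrow> real" where "dist x y = norm (x - y :: h2)"
definition sgn_h2 :: "h2 \<Rightarrow> h2" where "sgn x = inverse (norm x) *\<^sub>R (x :: h2)"
definition uniformity_h2 :: "(h2 \<times> h2) filter" where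
  "uniformity_h2 = (INF e\<in>{0<..}. principal {(x, y). dist x y < e})"
definition open_h2 :: "h2 set \<Rightarrow> bool" where
  "open_h2 U \<longleftrightarrow> (\<forall>x\<in>U. \<forall>\<^sub>F (x', y) in uniformity. x' = x \<longrightarrow> y \<in> U)"

lemma h2_fun_simps [simp]:
  "h2_fun 0 z = 0" "h2_fun (x + y) z = h2_fun x z + h2_fun y z"
  "h2_fun (x - y) z = h2_fun x z - h2_fun y z" "h2_fun (- x) z = - h2_fun x z"
  "h2_fun (r *\<^sub>R x) z = of_real r * h2_fun x z"
  using H2_cmult[OF h2_fun, of "- 1" x]
  by (simp_all add: zero_h2_def plus_h2_def minus_h2_def uminus_h2_def scaleR_h2_def H2_add H2_diff H2_cmult)

lemma h2_fun_ext:
  "h2_fun 0 = (\<lambda>z. 0)" "h2_fun (x + y) = (\<lambda>z. h2_fun x z + h2_fun y z)"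
  "h2_fun (x - y) = (\<lambda>z. h2_fun x z - h2_fun y z)"
  "h2_fun (r *\<^sub>R x) = (\<lambda>z. of_real r * h2_fun x z)"
  by (auto simp: fun_eq_iff)

instance
proof
  fix x y z :: h2 and r s :: real and U :: "h2 set"
  show "x + y + z = x + (y + z)" "x + y = y + x" "0 + x = x" "- x + x = 0" "x - y = x + - y"
    "r *\<^sub>R (x + y) = r *\<^sub>R x + r *\<^sub>R y" "(r + s) *\<^sub>R x = r *\<^sub>R x + s *\<^sub>R x"
    "r *\<^sub>R s *\<^sub>R x = (r * s) *\<^sub>R x" "1 *\<^sub>R x = x"
    by (rule h2_eqI; simp add: algebra_simps)+
  show "dist x y = norm (x - y)" "sgn x = inverse (norm x) *\<^sub>R x" "norm x = sqrt (inner x x)"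
    by (simp_all add: dist_h2_def sgn_h2_def norm_h2_def)
  show "(uniformity :: (h2 \<times> h2) filter) = (INF e\<in>{0<..}. principal {(x, y). dist x y < e})"
    by (rule uniformity_h2_def)
  show "open U = (\<forall>x\<in>U. \<forall>\<^sub>F (x', y) in uniformity. x' = x \<longrightarrow> y \<in> U)" by (rule open_h2_def)
  show "inner x y = inner y x" unfolding inner_h2_def by (subst H2_inner_cnj[symmetric]) simp
  show "inner (x + y) z = inner x z + inner y z"
    by (simp add: inner_h2_def h2_fun_ext H2_inner_add_left)
  show "inner (r *\<^sub>R x) y = r * inner x y"
    by (simp add: inner_h2_def h2_fun_ext H2_inner_cmult_left)
  show "0 \<le> inner x x" by (simp add: inner_h2_def H2_inner_self del: of_real_power)
  show "(inner x x = 0) = (x = 0)"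
  proof
    assume "inner x x = 0"
    hence "H2_norm (h2_fun x) = 0" by (simp add: inner_h2_def H2_inner_self del: of_real_power)
    hence "h2_fun x = (\<lambda>z. 0)" by (intro H2_norm_eq_0) auto
    thus "x = 0" by (intro h2_eqI) simp
  next
    have "bdry (\<lambda>z. 0) x = 0" for x by (rule bdry_eqI) simp
    moreover assume "x = 0"
    ultimately show "inner x x = 0" by (simp add: inner_h2_def H2_inner_def L2_inner_def h2_fun_ext)
  qed
qed

end

lemma norm_h2_eq: "norm x = H2_norm (h2_fun x)"
  by (simp add: norm_h2_def inner_h2_def H2_norm_def)

instance h2 :: complete_space
proof
  fix X :: "nat \<Rightarrow> h2" assume X: "Cauchy X"
  have "\<exists>N. \<forall>m\<ge>N. \<forall>n\<ge>N. H2_norm (\<lambda>z. h2_fun (X m) z - h2_fun (X n) z) < e" if "e > 0" for e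
    using X that unfolding Cauchy_iff norm_h2_eq h2_fun_ext by blast
  from H2_complete[OF h2_fun this] obtain g where g: "g \<in> H2"
    "(\<lambda>n. H2_norm (\<lambda>z. h2_fun (X n) z - g z)) \<longlonglongrightarrow> 0" by blast
  have "(\<lambda>n. norm (X n - h2_of g)) \<longlonglongrightarrow> 0" using g by (simp add: norm_h2_eq h2_fun_ext)
  hence "X \<longlonglongrightarrow> h2_of g" by (simp add: LIM_zero_iff tendsto_norm_zero_iff)
  thus "convergent X" by (auto simp: convergent_def)
qed

definition cmul :: "complex \<Rightarrow> h2 \<Rightarrow> h2" where
  "cmul c x = h2_of (\<lambda>z. c * h2_fun x z)"

lemma h2_fun_cmul: "h2_fun (cmul c x) = (\<lambda>z. c * h2_fun x z)"
  by (simp add: cmul_def H2_cmult)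

text \<open>The inner product is antilinear in its second argument, so its imaginary part is the
  real part after multiplying that argument by i.\<close>

lemma H2_inner_eq_inner:
  "H2_inner (h2_fun x) (h2_fun y) = Complex (inner x y) (inner x (cmul \<i> y))"
  by (simp add: complex_eq_iff inner_h2_def h2_fun_cmul H2_inner_cmult_right)

lemma inner_cmul_i: "inner (cmul \<i> x) y = - inner x (cmul \<i> y)"
  by (simp add: inner_h2_def h2_fun_cmul H2_inner_cmult_left H2_inner_cmult_right)

lemma bounded_linear_cmul: "bounded_linear (cmul c)"
proof (rule bounded_linear_intro[where K = "cmod c"])
  show "cmul c (x + y) = cmul c x + cmul c y" "cmul c (r *\<^sub>R x) = r *\<^sub>R cmul c x" for x y r
    by (rule h2_eqI; simp add: h2_fun_cmul algebra_simps)+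
  show "norm (cmul c x) \<le> norm x * cmod c" for x
  proof -
    have "complex_of_real ((norm (cmul c x))\<^sup>2) = c * cnj c * H2_inner (h2_fun x) (h2_fun x)"
      unfolding norm_h2_eq H2_inner_self[symmetric]
      by (simp add: h2_fun_cmul H2_inner_cmult_left H2_inner_cmult_right H2_cmult)
    also have "\<dots> = complex_of_real ((cmod c * norm x)\<^sup>2)"
      by (simp add: H2_inner_self norm_h2_eq complex_norm_square[symmetric] power_mult_distrib)
    finally have "(norm (cmul c x))\<^sup>2 = (cmod c * norm x)\<^sup>2" by (simp only: of_real_eq_iff)
    hence "norm (cmul c x) = cmod c * norm x" by (simp add: power2_eq_iff_nonneg)
    thus ?thesis by (simp add: mult.commute)
  qed
qed

subsection \<open>The projection and Toeplitz operators\<close>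

text \<open>Riesz for the real functional Re <x, g>; testing with i h as well recovers the imaginary
  part.\<close>

lemma L2_projection_exists:
  assumes g: "square_integrable g"
  shows "\<exists>v\<in>H2. \<forall>h\<in>H2. L2_inner (bdry v) (bdry h) = L2_inner g (bdry h)"
proof -
  define \<phi> where "\<phi> x = Re (L2_inner (bdry (h2_fun x)) g)" for x
  have "bounded_linear \<phi>"
  proof (rule bounded_linear_intro[where K = "L2_norm g"])
    show "\<phi> (x + y) = \<phi> x + \<phi> y" "\<phi> (r *\<^sub>R x) = r *\<^sub>R \<phi> x" for x y r
      by (simp_all add: \<phi>_def h2_fun_ext L2_inner_bdry_add L2_inner_bdry_cmult g)
    show "norm (\<phi> x) \<le> norm x * L2_norm g" for x
    proof -
      have "norm (\<phi> x) \<le> cmod (L2_inner (bdry (h2_fun x)) g)" unfolding \<phi>_def by (simp add: abs_Re_le_cmod)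
      also have "\<dots> \<le> L2_norm (bdry (h2_fun x)) * L2_norm g"
        by (intro L2_Cauchy_Schwarz square_integrable_bdry g) simp
      finally show ?thesis by (simp add: norm_h2_eq H2_norm_eq)
    qed
  qed
  then obtain v where v: "\<And>x. \<phi> x = inner v x" using Riesz_representation by blast
  have Re: "Re (L2_inner (bdry h) (bdry (h2_fun v))) = Re (L2_inner (bdry h) g)" if "h \<in> H2" for h
  proof -
    have "Re (L2_inner (bdry h) g) = inner v (h2_of h)" using v[of "h2_of h"] that by (simp add: \<phi>_def)
    also have "\<dots> = inner (h2_of h) v" by (rule inner_commute)
    finally show ?thesis using that by (simp add: inner_h2_def H2_inner_def)
  qed
  have "L2_inner (bdry (h2_fun v)) (bdry h) = L2_inner g (bdry h)" if h: "h \<in> H2" for h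
  proof -
    have "L2_inner (bdry h) (bdry (h2_fun v)) = L2_inner (bdry h) g"
    proof (rule complex_eqI)
      show "Re (L2_inner (bdry h) (bdry (h2_fun v))) = Re (L2_inner (bdry h) g)" by (rule Re[OF h])
      have "Re (\<i> * L2_inner (bdry h) (bdry (h2_fun v))) = Re (\<i> * L2_inner (bdry h) g)"
        using Re[OF H2_cmult[OF h, of \<i>]]
        by (simp only: L2_inner_bdry_cmult[OF h g] L2_inner_bdry_cmult[OF h square_integrable_bdry[OF h2_fun]])
      thus "Im (L2_inner (bdry h) (bdry (h2_fun v))) = Im (L2_inner (bdry h) g)" by simp
    qed
    thus ?thesis by (metis L2_inner_cnj)
  qed
  thus ?thesis using h2_fun by blast
qed

lemma P_plus_eqI:
  assumes g: "square_integrable g" and f: "f \<in> H2"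
    and eq: "\<And>h. h \<in> H2 \<Longrightarrow> L2_inner (bdry f) (bdry h) = L2_inner g (bdry h)"
  shows "P_plus g = f"
  unfolding P_plus_def
proof (rule the_equality)
  show "f \<in> H2 \<and> (\<forall>h\<in>H2. L2_inner (\<lambda>x. g x - bdry f x) (bdry h) = 0)"
    using f eq g by (simp add: L2_inner_diff_left square_integrable_bdry)
  fix v assume v: "v \<in> H2 \<and> (\<forall>h\<in>H2. L2_inner (\<lambda>x. g x - bdry v x) (bdry h) = 0)"
  have "H2_inner (\<lambda>z. v z - f z) h = 0" if h: "h \<in> H2" for h
  proof -
    have "L2_inner g (bdry h) - L2_inner (bdry v) (bdry h) = L2_inner (\<lambda>x. g x - bdry v x) (bdry h)"
      using v h g by (intro L2_inner_diff_left[symmetric] square_integrable_bdry) auto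
    also have "\<dots> = 0" using v h by blast
    finally have "L2_inner g (bdry h) - L2_inner (bdry v) (bdry h) = 0" .
    thus ?thesis using eq[OF h] v f h by (simp add: H2_inner_diff_left) (simp add: H2_inner_def)
  qed
  hence "H2_inner (\<lambda>z. v z - f z) (\<lambda>z. v z - f z) = 0" using v f H2_diff by blast
  hence "H2_norm (\<lambda>z. v z - f z) = 0" by (simp add: H2_inner_self)
  hence "(\<lambda>z. v z - f z) = (\<lambda>z. 0)" using v f by (intro H2_norm_eq_0 H2_diff) auto
  thus "v = f" by (simp add: fun_eq_iff)
qed

lemma P_plus:
  assumes g: "square_integrable g"
  shows "P_plus g \<in> H2" "h \<in> H2 \<Longrightarrow> L2_inner (bdry (P_plus g)) (bdry h) = L2_inner g (bdry h)"
  using L2_projection_exists[OF g] P_plus_eqI[OF g] by metis+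

text \<open>The product b f already lies in \<open>H2\<close> and its boundary function is the
  product of the boundary functions, so the projection changes nothing.\<close>

lemma toeplitz_analytic:
  assumes b: "b \<in> Hinf" and f: "f \<in> H2"
  shows "toeplitz (bdry b) f = (\<lambda>z. b z * f z)"
proof -
  note [measurable] = measurable_bdry_Hinf[OF b] measurable_bdry_H2[OF f] measurable_bdry_H2[OF H2_Hinf_mult[OF b f]]
  have sq: "square_integrable (\<lambda>x. bdry b x * bdry f x)"
    by (rule square_integrable_bounded_mult[OF square_integrable_bdry[OF f] measurable_bdry_Hinf[OF b] Hinf_bdry_bound[OF b]])
  show ?thesis unfolding toeplitz_def
  proof (rule P_plus_eqI[OF sq H2_Hinf_mult[OF b f]])
    fix h assume h: "h \<in> H2"
    note [measurable] = measurable_bdry_H2[OF h]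
    show "L2_inner (bdry (\<lambda>z. b z * f z)) (bdry h) = L2_inner (\<lambda>x. bdry b x * bdry f x) (bdry h)"
      by (rule L2_inner_AE_cong) (use bdry_mult_AE[OF b f] in auto)
  qed
qed

lemma toeplitz_coanalytic:
  assumes b: "b \<in> Hinf" and f: "f \<in> H2"
  shows "toeplitz (\<lambda>x. cnj (bdry b x)) f \<in> H2"
    "h \<in> H2 \<Longrightarrow> H2_inner (toeplitz (\<lambda>x. cnj (bdry b x)) f) h = H2_inner f (\<lambda>z. b z * h z)"
proof -
  note [measurable] = measurable_bdry_Hinf[OF b] measurable_bdry_H2[OF f]
  have bd: "AE x in lborel. cmod (cnj (bdry b x)) \<le> Hinf_norm b" using Hinf_bdry_bound[OF b] by simp
  have sq: "square_integrable (\<lambda>x. cnj (bdry b x) * bdry f x)"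
    by (rule square_integrable_bounded_mult[OF square_integrable_bdry[OF f] _ bd]) measurable
  show "toeplitz (\<lambda>x. cnj (bdry b x)) f \<in> H2" unfolding toeplitz_def by (rule P_plus(1)[OF sq])
  assume h: "h \<in> H2"
  note [measurable] = measurable_bdry_H2[OF h] measurable_bdry_H2[OF H2_Hinf_mult[OF b h]]
  have "H2_inner (toeplitz (\<lambda>x. cnj (bdry b x)) f) h = L2_inner (\<lambda>x. cnj (bdry b x) * bdry f x) (bdry h)"
    unfolding toeplitz_def H2_inner_def by (rule P_plus(2)[OF sq h])
  also have "\<dots> = L2_inner (bdry f) (\<lambda>x. bdry b x * bdry h x)" by (simp add: L2_inner_def mult_ac)
  also have "\<dots> = H2_inner f (\<lambda>z. b z * h z)" unfolding H2_inner_def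
    by (rule L2_inner_AE_cong) (use bdry_mult_AE[OF b h] in auto)
  finally show "H2_inner (toeplitz (\<lambda>x. cnj (bdry b x)) f) h = H2_inner f (\<lambda>z. b z * h z)" .
qed

subsection \<open>Square roots of operators on \<open>H\<^sup>2\<close>\<close>

definition h2_lift :: "((complex \<Rightarrow> complex) \<Rightarrow> complex \<Rightarrow> complex) \<Rightarrow> h2 \<Rightarrow> h2" where
  "h2_lift T x = h2_of (T (h2_fun x))"

text \<open>\<open>positive_operator\<close> asks for a real nonnegative quadratic form; symmetry
  follows from it by complex polarisation.\<close>

lemma positive_operator_lift:
  assumes "positive_operator T"
  shows "h2_fun (h2_lift T x) = T (h2_fun x)" "bounded_linear (h2_lift T)"
    "h2_lift T (cmul c x) = cmul c (h2_lift T x)"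
    "inner (h2_lift T x) y = inner x (h2_lift T y)" "0 \<le> inner (h2_lift T x) x"
proof -
  have in_H2: "\<And>f. f \<in> H2 \<Longrightarrow> T f \<in> H2"
    and add: "\<And>f g. \<lbrakk>f \<in> H2; g \<in> H2\<rbrakk> \<Longrightarrow> T (\<lambda>z. f z + g z) = (\<lambda>z. T f z + T g z)"
    and cm: "\<And>c f. f \<in> H2 \<Longrightarrow> T (\<lambda>z. c * f z) = (\<lambda>z. c * T f z)"
    and bd: "\<exists>C. \<forall>f\<in>H2. H2_norm (T f) \<le> C * H2_norm f"
    and real: "\<And>f. f \<in> H2 \<Longrightarrow> H2_inner (T f) f \<in> \<real> \<and> 0 \<le> Re (H2_inner (T f) f)"
    using assms unfolding positive_operator_def bounded_operator_def by blast+
  show lift: "h2_fun (h2_lift T x) = T (h2_fun x)" for x by (simp add: h2_lift_def in_H2)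
  show cmul: "h2_lift T (cmul c x) = cmul c (h2_lift T x)" for c x
    by (rule h2_eqI) (simp add: lift h2_fun_cmul cm)
  obtain C where C: "\<And>f. f \<in> H2 \<Longrightarrow> H2_norm (T f) \<le> C * H2_norm f" using bd by blast
  show bl: "bounded_linear (h2_lift T)"
  proof (rule bounded_linear_intro[where K = C])
    show "h2_lift T (x + y) = h2_lift T x + h2_lift T y" for x y
      by (rule h2_eqI) (simp add: lift h2_fun_ext add)
    show "h2_lift T (r *\<^sub>R x) = r *\<^sub>R h2_lift T x" for r x
      by (rule h2_eqI) (simp add: lift h2_fun_ext cm)
    show "norm (h2_lift T x) \<le> norm x * C" for x
      using C[of "h2_fun x"] by (simp add: norm_h2_eq lift mult.commute)
  qed
  interpret bounded_linear "h2_lift T" by (rule bl)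
  show "0 \<le> inner (h2_lift T x) x" using real[of "h2_fun x"] by (simp add: inner_h2_def lift)
  have im: "inner (h2_lift T u) (cmul \<i> u) = 0" for u
    using real[of "h2_fun u"] by (simp add: H2_inner_eq_inner lift[symmetric] complex_is_Real_iff)
  interpret c: bounded_linear "cmul \<i>" by (rule bounded_linear_cmul)
  have ii: "cmul \<i> (cmul \<i> u) = - u" for u by (rule h2_eqI) (simp add: h2_fun_cmul mult.assoc[symmetric])
  \<comment> \<open>Reality of the form at x + i y, expanded; the diagonal terms vanish by
    \<open>im\<close>, and the mixed terms are the two sides of the symmetry.\<close>
  have "0 = inner (h2_lift T (x + cmul \<i> y)) (cmul \<i> (x + cmul \<i> y))" by (simp only: im)
  also have "\<dots> = inner (h2_lift T x) (cmul \<i> x) - inner (h2_lift T x) y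
      + inner (cmul \<i> (h2_lift T y)) (cmul \<i> x) + inner (cmul \<i> (h2_lift T y)) (cmul \<i> (cmul \<i> y))"
    by (simp add: add cmul c.add ii inner_add_left inner_add_right inner_diff_right)
  also have "\<dots> = - inner (h2_lift T x) y + inner (h2_lift T y) x"
    by (simp add: im inner_cmul_i[of "h2_lift T y"] ii)
  finally show "inner (h2_lift T x) y = inner x (h2_lift T y)" by (simp add: inner_commute)
qed

text \<open>Existence is the iteration. A competitor R commutes with R^2 = I - B, hence with B and
  so with the constructed root, and \<open>positive_sqrt_unique\<close> applies.\<close>

lemma op_sqrt_exists_unique:
  fixes B :: "h2 \<Rightarrow> h2"
  assumes lin: "linear B" and nB: "\<And>x. norm (B x) \<le> norm x"
    and sym: "\<And>x y. inner (B x) y = inner x (B y)"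
    and cm: "\<And>c x. B (cmul c x) = cmul c (B x)"
    and A: "\<And>x. A (h2_fun x) = h2_fun (x - B x)"
  shows "\<exists>!S. S \<in> extensional H2 \<and> positive_operator S \<and> (\<forall>f\<in>H2. S (S f) = A f)"
proof (rule contraction_sqrt_exists[OF lin nB sym])
  fix S0 assume S0: "linear S0" "\<And>x. norm (S0 x) \<le> 2 * norm x" "\<And>x y. inner (S0 x) y = inner x (S0 y)"
    "\<And>x. 0 \<le> inner (S0 x) x" "\<And>x. S0 (S0 x) = x - B x"
    "\<And>T x. \<lbrakk>bounded_linear T; \<And>x. T (B x) = B (T x)\<rbrakk> \<Longrightarrow> T (S0 x) = S0 (T x)"
  interpret S0: linear S0 by fact
  interpret B: linear B by fact
  \<comment> \<open>Complex linearity of the root: multiplication by c commutes with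
    \<open>B\<close>, hence with \<open>S0\<close>.\<close>
  have S0c: "S0 (cmul c x) = cmul c (S0 x)" for c x
    by (rule S0(6)[OF bounded_linear_cmul, symmetric]) (simp add: cm)
  define S where "S f = (if f \<in> H2 then h2_fun (S0 (h2_of f)) else undefined)" for f
  have S: "S (h2_fun x) = h2_fun (S0 x)" for x by (simp add: S_def)
  have SH: "S f = h2_fun (S0 (h2_of f))" if "f \<in> H2" for f using that by (simp add: S_def)
  have spec: "S \<in> extensional H2 \<and> positive_operator S \<and> (\<forall>f\<in>H2. S (S f) = A f)"
  proof (intro conjI ballI)
    show "S \<in> extensional H2" by (simp add: extensional_def S_def)
    fix f assume f: "f \<in> H2"
    show "S (S f) = A f" using A[of "h2_of f"] f by (simp add: SH S S0(5))
  next
    show "positive_operator S" unfolding positive_operator_def bounded_operator_def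
    proof (intro conjI ballI allI exI[of _ 2])
      fix f assume f: "f \<in> H2"
      show "S f \<in> H2" using f by (simp add: SH)
      show "H2_norm (S f) \<le> 2 * H2_norm f"
        using S0(2)[of "h2_of f"] f by (simp add: SH norm_h2_eq)
      show "S (\<lambda>z. c * f z) = (\<lambda>z. c * S f z)" for c
      proof -
        have eq: "(\<lambda>z. c * f z) = h2_fun (cmul c (h2_of f))" using f by (simp add: h2_fun_cmul)
        show ?thesis unfolding eq S unfolding S0c h2_fun_cmul SH[OF f] ..
      qed
      have "inner (S0 x) (cmul \<i> x) = 0" for x
      proof -
        have "inner (S0 x) (cmul \<i> x) = inner x (cmul \<i> (S0 x))" by (simp add: S0(3) S0c)
        also have "\<dots> = - inner (cmul \<i> x) (S0 x)" by (simp add: inner_cmul_i)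
        finally show ?thesis by (simp add: inner_commute)
      qed
      thus "H2_inner (S f) f \<in> \<real>" "0 \<le> Re (H2_inner (S f) f)"
        using H2_inner_eq_inner[of "S0 (h2_of f)" "h2_of f"] S0(4)[of "h2_of f"] f
        by (auto simp: SH complex_is_Real_iff)
    next
      fix f g assume fg: "f \<in> H2" "g \<in> H2"
      have eq: "(\<lambda>z. f z + g z) = h2_fun (h2_of f + h2_of g)" using fg by (simp add: h2_fun_ext)
      show "S (\<lambda>z. f z + g z) = (\<lambda>z. S f z + S g z)"
        unfolding eq S unfolding S0.add h2_fun_ext SH[OF fg(1)] SH[OF fg(2)] ..
    qed
  qed
  show ?thesis
  proof (rule ex1I)
    show "S \<in> extensional H2 \<and> positive_operator S \<and> (\<forall>f\<in>H2. S (S f) = A f)" by (rule spec)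
    fix R assume R: "R \<in> extensional H2 \<and> positive_operator R \<and> (\<forall>f\<in>H2. R (R f) = A f)"
    hence pos: "positive_operator R" by blast
    note r = positive_operator_lift[OF pos]
    interpret r: bounded_linear "h2_lift R" by (rule r(2))
    have rr: "h2_lift R (h2_lift R x) = x - B x" for x
    proof -
      have "h2_fun (h2_lift R (h2_lift R x)) = h2_fun (x - B x)"
        using R A[of x] by (simp only: r(1)) simp
      thus ?thesis by (simp only: h2_fun_inject)
    qed
    have "h2_lift R (B x) = B (h2_lift R x)" for x
    proof -
      have Beq: "B y = y - h2_lift R (h2_lift R y)" for y by (simp add: rr)
      show ?thesis by (simp only: Beq r.diff)
    qed
    hence comm: "h2_lift R (S0 x) = S0 (h2_lift R x)" for x by (rule S0(6)[OF r(2)])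
    have "h2_lift R x = S0 x" for x
      by (rule positive_sqrt_unique[OF r.linear_axioms r(4,5) S0(1,3,4) comm]) (simp add: rr S0(5))
    hence "R (h2_fun x) = S (h2_fun x)" for x using r(1)[of x] by (simp add: S)
    hence "R f = S f" if "f \<in> H2" for f using that by (metis h2_of_inverse)
    moreover have "R f = S f" if "f \<notin> H2" for f using that R by (simp add: extensional_def S_def)
    ultimately show "R = S" by blast
  qed
qed

subsection \<open>The operator \<open>Id - T\<^sub>b T\<^sub>b\<^sup>*\<close>\<close>

definition mult_op :: "(complex \<Rightarrow> complex) \<Rightarrow> h2 \<Rightarrow> h2" where
  "mult_op b x = h2_of (\<lambda>z. b z * h2_fun x z)"

definition mult_adj :: "(complex \<Rightarrow> complex) \<Rightarrow> h2 \<Rightarrow> h2" where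
  "mult_adj b x = h2_of (toeplitz (\<lambda>x. cnj (bdry b x)) (h2_fun x))"

definition dBR_op :: "(complex \<Rightarrow> complex) \<Rightarrow> h2 \<Rightarrow> h2" where
  "dBR_op b x = x - mult_op b (mult_adj b x)"

lemma h2_fun_mult_op: "b \<in> Hinf \<Longrightarrow> h2_fun (mult_op b x) = (\<lambda>z. b z * h2_fun x z)"
  by (simp add: mult_op_def H2_Hinf_mult)

lemma mult_adj_inner:
  assumes "b \<in> Hinf"
  shows "H2_inner (h2_fun (mult_adj b x)) (h2_fun y) = H2_inner (h2_fun x) (h2_fun (mult_op b y))"
  using toeplitz_coanalytic[OF assms h2_fun] by (simp add: mult_adj_def h2_fun_mult_op assms)

lemma mult_adj_real_inner: "b \<in> Hinf \<Longrightarrow> inner (mult_adj b x) y = inner x (mult_op b y)"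
  by (simp add: inner_h2_def mult_adj_inner)

lemma Hinf_unit_ball_D:
  assumes "b \<in> Hinf_unit_ball"
  shows "b \<in> Hinf" "Im z > 0 \<Longrightarrow> cmod (b z) \<le> 1"
  using assms Hinf_bound[of b z] by (auto simp: Hinf_unit_ball_def)

lemma linear_mult_op: assumes b: "b \<in> Hinf" shows "linear (mult_op b)"
  by (rule linearI; rule h2_eqI; simp add: h2_fun_mult_op b algebra_simps)

lemma mult_op_cmul: "b \<in> Hinf \<Longrightarrow> mult_op b (cmul c x) = cmul c (mult_op b x)"
  by (rule h2_eqI) (simp add: h2_fun_mult_op h2_fun_cmul mult_ac)

lemma h2_inner_eqI: "(\<And>y. H2_inner (h2_fun u) (h2_fun y) = H2_inner (h2_fun v) (h2_fun y)) \<Longrightarrow> u = v"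
proof -
  assume *: "\<And>y. H2_inner (h2_fun u) (h2_fun y) = H2_inner (h2_fun v) (h2_fun y)"
  hence "inner u y = inner v y" for y by (simp add: inner_h2_def)
  thus "u = v" using vector_eq_rdot by blast
qed

lemma linear_mult_adj: assumes b: "b \<in> Hinf" shows "linear (mult_adj b)"
proof (rule linearI)
  show "mult_adj b (x + y) = mult_adj b x + mult_adj b y" for x y
    by (rule h2_inner_eqI) (simp add: mult_adj_inner b h2_fun_ext H2_inner_add_left)
  show "mult_adj b (r *\<^sub>R x) = r *\<^sub>R mult_adj b x" for r x
    by (rule h2_inner_eqI) (simp add: mult_adj_inner b h2_fun_ext H2_inner_cmult_left)
qed

lemma mult_adj_cmul: "b \<in> Hinf \<Longrightarrow> mult_adj b (cmul c x) = cmul c (mult_adj b x)"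
  by (rule h2_inner_eqI) (simp add: mult_adj_inner h2_fun_cmul H2_inner_cmult_left)

lemma mult_op_norm:
  assumes b: "b \<in> Hinf_unit_ball" shows "norm (mult_op b x) \<le> norm x"
proof -
  note bH = Hinf_unit_ball_D(1)[OF b]
  have bd: "AE x in lborel. cmod (bdry b x) \<le> 1"
    using Hinf_bdry_bound[OF bH] b by (auto simp: Hinf_unit_ball_def elim: eventually_mono)
  note [measurable] = measurable_bdry_Hinf[OF bH] measurable_bdry_H2[OF h2_fun]
  have "norm (mult_op b x) = L2_norm (bdry (\<lambda>z. b z * h2_fun x z))" by (simp add: norm_h2_eq H2_norm_eq h2_fun_mult_op bH)
  also have "\<dots> = L2_norm (\<lambda>t. bdry b t * bdry (h2_fun x) t)"
    by (rule L2_norm_AE_cong[OF measurable_bdry_H2[OF H2_Hinf_mult[OF bH h2_fun]] _ bdry_mult_AE[OF bH h2_fun]]) measurable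
  also have "\<dots> \<le> 1 * L2_norm (bdry (h2_fun x))"
    by (rule L2_norm_bounded_mult[OF square_integrable_bdry[OF h2_fun] measurable_bdry_Hinf[OF bH] bd]) simp
  finally show ?thesis by (simp add: norm_h2_eq H2_norm_eq)
qed

lemma mult_adj_norm:
  assumes b: "b \<in> Hinf_unit_ball" shows "norm (mult_adj b x) \<le> norm x"
proof -
  let ?y = "mult_adj b x"
  have "norm ?y * norm ?y = inner x (mult_op b ?y)"
    by (simp add: mult_adj_real_inner[OF Hinf_unit_ball_D(1)[OF b], symmetric] power2_norm_eq_inner[symmetric] power2_eq_square)
  also have "\<dots> \<le> norm x * norm (mult_op b ?y)" by (rule norm_cauchy_schwarz)
  also have "\<dots> \<le> norm x * norm ?y" by (intro mult_left_mono mult_op_norm b) simp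
  finally show ?thesis by (metis mult_right_le_imp_le norm_ge_zero order_le_less)
qed

lemma dBR_op_eq:
  assumes b: "b \<in> Hinf"
  shows "(\<lambda>z. h2_fun x z - toeplitz (bdry b) (toeplitz (\<lambda>x. cnj (bdry b x)) (h2_fun x)) z) = h2_fun (dBR_op b x)"
  using toeplitz_coanalytic(1)[OF b h2_fun, of x]
  by (simp add: dBR_op_def h2_fun_ext h2_fun_mult_op b toeplitz_analytic mult_adj_def)

lemma dBR_sqrt_exists_unique:
  assumes b: "b \<in> Hinf_unit_ball"
  shows "\<exists>!S. S \<in> extensional H2 \<and> positive_operator S \<and>
    (\<forall>f\<in>H2. S (S f) = (\<lambda>f z. f z - toeplitz (bdry b) (toeplitz (\<lambda>x. cnj (bdry b x)) f) z) f)"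
proof (rule op_sqrt_exists_unique[where B = "\<lambda>x. mult_op b (mult_adj b x)"])
  note bH = Hinf_unit_ball_D(1)[OF b]
  show "linear (\<lambda>x. mult_op b (mult_adj b x))"
    using linear_compose[OF linear_mult_adj[OF bH] linear_mult_op[OF bH]] by (simp add: comp_def)
  show "norm (mult_op b (mult_adj b x)) \<le> norm x" for x
    using mult_op_norm[OF b] mult_adj_norm[OF b] order_trans by blast
  show "inner (mult_op b (mult_adj b x)) y = inner x (mult_op b (mult_adj b y))" for x y
    by (metis mult_adj_real_inner[OF bH] inner_commute)
  show "mult_op b (mult_adj b (cmul c x)) = cmul c (mult_op b (mult_adj b x))" for c x
    by (simp add: mult_op_cmul mult_adj_cmul bH)
qed (simp add: dBR_op_eq Hinf_unit_ball_D(1)[OF b] dBR_op_def)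

lemma dBR_sqrt_spec:
  assumes b: "b \<in> Hinf_unit_ball"
  shows "positive_operator (dBR_sqrt b)" "dBR_sqrt b (dBR_sqrt b (h2_fun x)) = h2_fun (dBR_op b x)"
  using theI'[OF dBR_sqrt_exists_unique[OF b]] dBR_op_eq[OF Hinf_unit_ball_D(1)[OF b], of x]
  unfolding dBR_sqrt_def op_sqrt_def by auto

subsection \<open>The norm of de Branges--Rovnyak spaces\<close>

lemma dBR_sqrt_lift:
  assumes b: "b \<in> Hinf_unit_ball"
  shows "h2_lift (dBR_sqrt b) (h2_lift (dBR_sqrt b) x) = dBR_op b x"
  using dBR_sqrt_spec(2)[OF b, of x] positive_operator_lift(1)[OF dBR_sqrt_spec(1)[OF b]]
  by (metis h2_fun_inject)

lemma dBR_sqrt_symmetric: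
  assumes b: "b \<in> Hinf_unit_ball"
  shows "H2_inner (dBR_sqrt b (h2_fun x)) (h2_fun y) = H2_inner (h2_fun x) (dBR_sqrt b (h2_fun y))"
proof -
  note l = positive_operator_lift[OF dBR_sqrt_spec(1)[OF b]]
  show ?thesis unfolding l(1)[symmetric] H2_inner_eq_inner by (simp add: l(3,4) flip: l(3))
qed

text \<open>The difference of two admissible preimages lies in the kernel and is orthogonal to
  it.\<close>

lemma dBR_preimage_eqI:
  assumes b: "b \<in> Hinf_unit_ball" and u: "dBR_sqrt b (h2_fun x) = u"
    and perp: "\<And>k. dBR_sqrt b (h2_fun k) = (\<lambda>z. 0) \<Longrightarrow> H2_inner (h2_fun x) (h2_fun k) = 0"
  shows "dBR_preimage b u = h2_fun x"
  unfolding dBR_preimage_def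
proof (rule the_equality)
  note l = positive_operator_lift[OF dBR_sqrt_spec(1)[OF b]]
  interpret l: bounded_linear "h2_lift (dBR_sqrt b)" by (rule l(2))
  have perp': "H2_inner (h2_fun x) k = 0" if "k \<in> H2" "dBR_sqrt b k = (\<lambda>z. 0)" for k
    using perp[of "h2_of k"] that by simp
  thus "h2_fun x \<in> H2 \<and> dBR_sqrt b (h2_fun x) = u \<and>
      (\<forall>k\<in>H2. dBR_sqrt b k = (\<lambda>z. 0) \<longrightarrow> H2_inner (h2_fun x) k = 0)" using u by simp
  fix f assume f: "f \<in> H2 \<and> dBR_sqrt b f = u \<and> (\<forall>k\<in>H2. dBR_sqrt b k = (\<lambda>z. 0) \<longrightarrow> H2_inner f k = 0)"
  define d where "d = h2_of f - x"
  have "h2_lift (dBR_sqrt b) (h2_of f) = h2_lift (dBR_sqrt b) x"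
    using f u by (intro h2_fun_inject[THEN iffD1]) (simp add: l(1))
  hence "h2_lift (dBR_sqrt b) d = 0" by (simp add: d_def l.diff)
  hence d0: "dBR_sqrt b (h2_fun d) = (\<lambda>z. 0)" by (metis l(1) h2_fun_ext(1))
  have "H2_inner (h2_fun d) (h2_fun d) = H2_inner f (h2_fun d) - H2_inner (h2_fun x) (h2_fun d)"
    using f by (subst (1) d_def) (simp add: h2_fun_ext H2_inner_diff_left)
  also have "\<dots> = 0" using f d0 perp[OF d0] by simp
  finally have "norm d = 0" by (simp add: norm_h2_eq H2_inner_self)
  thus "f = h2_fun x" using f by (simp add: d_def) (metis h2_of_inverse)
qed

text \<open>With S the square root, S x is orthogonal to ker S by symmetry, so it is the preimage of
  S^2 x, and |S x|^2 = <S^2 x, x>. Norms in H(b) thus become computable without knowing S.\<close>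

lemma dBR_norm_dBR_op:
  assumes b: "b \<in> Hinf_unit_ball"
  shows "h2_fun (dBR_op b x) \<in> dBR_space b"
    "(dBR_norm b (h2_fun (dBR_op b x)))\<^sup>2 = inner (dBR_op b x) x"
proof -
  note l = positive_operator_lift[OF dBR_sqrt_spec(1)[OF b]]
  let ?y = "h2_lift (dBR_sqrt b) x"
  have sy: "dBR_sqrt b (h2_fun ?y) = h2_fun (dBR_op b x)" by (simp add: l(1) dBR_sqrt_spec(2)[OF b])
  show "h2_fun (dBR_op b x) \<in> dBR_space b" unfolding dBR_space_def sy[symmetric] by simp
  have "dBR_preimage b (h2_fun (dBR_op b x)) = h2_fun ?y"
  proof (rule dBR_preimage_eqI[OF b sy])
    fix k assume k: "dBR_sqrt b (h2_fun k) = (\<lambda>z. 0)"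
    have "H2_inner (h2_fun ?y) (h2_fun k) = H2_inner (h2_fun x) (dBR_sqrt b (h2_fun k))"
      by (simp add: l(1) dBR_sqrt_symmetric[OF b])
    \<comment> \<open>The zero function, written as a multiple so that
      \<open>H2_inner_cmult_right\<close> evaluates the inner product.\<close>
    also have "\<dots> = H2_inner (h2_fun x) (h2_fun (cmul 0 0))" by (simp add: k h2_fun_cmul)
    also have "\<dots> = 0" unfolding h2_fun_cmul by (subst H2_inner_cmult_right) auto
    finally show "H2_inner (h2_fun ?y) (h2_fun k) = 0" .
  qed
  hence "(dBR_norm b (h2_fun (dBR_op b x)))\<^sup>2 = inner ?y ?y"
    by (simp add: dBR_norm_def dBR_inner_def inner_h2_def[symmetric])
  also have "\<dots> = inner (dBR_op b x) x" by (simp add: l(4) dBR_sqrt_lift[OF b, symmetric] inner_commute)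
  finally show "(dBR_norm b (h2_fun (dBR_op b x)))\<^sup>2 = inner (dBR_op b x) x" .
qed

lemma dBR_norm_nonneg: "0 \<le> dBR_norm b u"
  by (simp add: dBR_norm_def dBR_inner_def H2_inner_self del: of_real_power)

lemma cker_diagonal: "Im w > 0 \<Longrightarrow> cker w w = of_real (1 / (4 * pi * Im w))"
  by (simp add: cker_def complex_diff_cnj field_simps)

text \<open>Kernels are eigenvectors of the adjoint: by the reproducing property
  \<open>mult_adj b\<close> multiplies \<open>cker w\<close> by the conjugate of
  \<open>b w\<close>.\<close>

lemma dBR_kernel:
  assumes b: "b \<in> Hinf_unit_ball" and w: "Im w > 0"
  shows "h2_fun (dBR_op b (h2_of (cker w))) z = (1 - cnj (b w) * b z) * cker w z"
proof -
  note bH = Hinf_unit_ball_D(1)[OF b]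
  let ?x = "h2_of (cker w)"
  have x: "h2_fun ?x = cker w" using cker_in_H2[OF w] by simp
  have rep: "H2_inner (cker w) f = cnj (f w)" if "f \<in> H2" for f
    using H2_reproducing[OF that w] H2_inner_cnj by metis
  have "mult_adj b ?x = cmul (cnj (b w)) ?x"
  proof (rule h2_inner_eqI)
    fix y
    show "H2_inner (h2_fun (mult_adj b ?x)) (h2_fun y) = H2_inner (h2_fun (cmul (cnj (b w)) ?x)) (h2_fun y)"
      by (simp add: mult_adj_inner bH x h2_fun_mult_op rep H2_Hinf_mult h2_fun_cmul H2_inner_cmult_left cker_in_H2 w)
  qed
  thus ?thesis by (simp add: dBR_op_def h2_fun_mult_op bH h2_fun_cmul x algebra_simps)
qed

subsection \<open>Bounded differentiation forces an inner function with bounded derivative\<close>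

lemma kernel_derivative_inequality:
  assumes b: "b \<in> Hinf_unit_ball" and w: "Im w > 0" and C: "C \<ge> 0"
    and D: "\<And>f. f \<in> dBR_space b \<Longrightarrow> hp_deriv f \<in> H2 \<and> H2_norm (hp_deriv f) \<le> C * dBR_norm b f"
  defines "u \<equiv> 1 - (cmod (b w))\<^sup>2"
  shows "cmod (of_real (u / (2 * Im w)) + \<i> * (cnj (b w) * deriv b w)) \<le> C * sqrt u"
proof -
  note bH = Hinf_unit_ball_D(1)[OF b]
  define y where "y = Im w"
  have y: "y > 0" using w by (simp add: y_def)
  have u: "u \<ge> 0" using Hinf_unit_ball_D(2)[OF b w] by (simp add: u_def power_le_one)
  let ?x = "h2_of (cker w)"
  define k where "k = h2_fun (dBR_op b ?x)"
  have x: "h2_fun ?x = cker w" using cker_in_H2[OF w] by simp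
  have kz: "k z = (1 - cnj (b w) * b z) * cker w z" for z unfolding k_def by (rule dBR_kernel[OF b w])
  have bb: "cnj (b w) * b w = of_real ((cmod (b w))\<^sup>2)"
    using complex_norm_square[of "b w"] by (simp add: mult.commute)
  have kw: "k w = of_real (u / (4 * pi * y))"
    by (simp add: kz cker_diagonal[OF w] bb u_def y_def)
  \<comment> \<open>The squared norm of a reproducing kernel is its value on the diagonal.\<close>
  have nk: "(dBR_norm b k)\<^sup>2 = u / (4 * pi * y)"
  proof -
    have "(dBR_norm b k)\<^sup>2 = Re (H2_inner k (cker w))"
      unfolding k_def dBR_norm_dBR_op(2)[OF b] inner_h2_def x ..
    also have "H2_inner k (cker w) = k w" by (rule H2_reproducing[OF _ w]) (simp add: k_def)
    finally show ?thesis by (simp add: kw)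
  qed
  have nc: "(H2_norm (cker w))\<^sup>2 = 1 / (4 * pi * y)"
  proof -
    have "of_real ((H2_norm (cker w))\<^sup>2) = cker w w"
      unfolding H2_inner_self[symmetric] by (rule H2_reproducing[OF cker_in_H2[OF w] w])
    hence "complex_of_real ((H2_norm (cker w))\<^sup>2) = of_real (1 / (4 * pi * y))"
      by (simp only: cker_diagonal[OF w] y_def)
    thus ?thesis by (simp only: of_real_eq_iff)
  qed
  have kD: "hp_deriv k \<in> H2" "H2_norm (hp_deriv k) \<le> C * dBR_norm b k"
    using D[of k] dBR_norm_dBR_op(1)[OF b] unfolding k_def by auto
  have "cmod (deriv k w) = cmod (H2_inner (hp_deriv k) (cker w))"
    using H2_reproducing[OF kD(1) w] w by (simp add: hp_deriv_def)
  also have "\<dots> \<le> H2_norm (hp_deriv k) * H2_norm (cker w)" by (rule H2_Cauchy_Schwarz[OF kD(1) cker_in_H2[OF w]])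
  also have "\<dots> \<le> C * dBR_norm b k * H2_norm (cker w)" by (intro mult_right_mono kD) simp
  also have "\<dots> = C * (sqrt (u / (4 * pi * y)) * sqrt (1 / (4 * pi * y)))"
    unfolding real_sqrt_unique[OF nk dBR_norm_nonneg] real_sqrt_unique[OF nc H2_norm_nonneg] by simp
  also have "sqrt (u / (4 * pi * y)) * sqrt (1 / (4 * pi * y)) = sqrt u / (4 * pi * y)"
    using y u by (simp add: real_sqrt_divide power2_eq_square[symmetric])
  finally have le: "cmod (deriv k w) \<le> C * (sqrt u / (4 * pi * y))" .
  have db: "(b has_field_derivative deriv b w) (at w)"
    using holomorphic_derivI[OF Hinf_holomorphic[OF bH] open_UHP] w by simp
  have wc: "w - cnj w = 2 * \<i> * of_real y" by (simp add: complex_eq_iff y_def)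
  have wc0: "w - cnj w \<noteq> 0" using y by (simp add: wc)
  have "((\<lambda>z. 1 - cnj (b w) * b z) has_field_derivative - (cnj (b w) * deriv b w)) (at w)"
    by (auto intro!: derivative_eq_intros db)
  moreover have "((\<lambda>z. \<i> / (2 * of_real pi) * (1 / (z - cnj w))) has_field_derivative
      \<i> / (2 * of_real pi) * (- 1 / (w - cnj w)\<^sup>2)) (at w)"
    using wc0 by (intro DERIV_cmult) (auto intro!: derivative_eq_intros simp: power2_eq_square)
  ultimately have D1: "((\<lambda>z. (1 - cnj (b w) * b z) * (\<i> / (2 * of_real pi) * (1 / (z - cnj w)))) has_field_derivative
     (- (cnj (b w) * deriv b w)) * (\<i> / (2 * of_real pi) * (1 / (w - cnj w)))
     + \<i> / (2 * of_real pi) * (- 1 / (w - cnj w)\<^sup>2) * (1 - cnj (b w) * b w)) (at w)"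
    by (rule DERIV_mult)
  have ev: "eventually (\<lambda>z. (1 - cnj (b w) * b z) * (\<i> / (2 * of_real pi) * (1 / (z - cnj w))) = k z) (nhds w)"
    using eventually_nhds_in_open[OF open_UHP, of w] w
    by (auto elim!: eventually_mono simp: kz cker_def)
  have "(k has_field_derivative
     (- (cnj (b w) * deriv b w)) * (\<i> / (2 * of_real pi) * (1 / (w - cnj w)))
     + \<i> / (2 * of_real pi) * (- 1 / (w - cnj w)\<^sup>2) * (1 - cnj (b w) * b w)) (at w)"
    by (rule iffD1[OF DERIV_cong_ev[OF refl ev refl] D1])
  hence "deriv k w = (- (cnj (b w) * deriv b w)) * (\<i> / (2 * of_real pi) * (1 / (w - cnj w)))
     + \<i> / (2 * of_real pi) * (- 1 / (w - cnj w)\<^sup>2) * (1 - cnj (b w) * b w)" by (rule DERIV_imp_deriv)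
  also have "1 - cnj (b w) * b w = of_real u" by (simp add: bb u_def)
  \<comment> \<open>The prefactor has modulus 1 / (4 pi y), which is also the factor in the bound
    \<open>le\<close> that comes from the two norms; it cancels.\<close>
  finally have dk: "deriv k w = \<i> / (4 * of_real pi * of_real y) * (of_real (u / (2 * y)) + \<i> * (cnj (b w) * deriv b w))"
    unfolding wc using y by (simp add: field_simps power2_eq_square)
  have "cmod (deriv k w) = 1 / (4 * pi * y) * cmod (of_real (u / (2 * y)) + \<i> * (cnj (b w) * deriv b w))"
    unfolding dk norm_mult using y by (simp add: norm_divide norm_mult)
  with le have "1 / (4 * pi * y) * cmod (of_real (u / (2 * y)) + \<i> * (cnj (b w) * deriv b w)) \<le> 1 / (4 * pi * y) * (C * sqrt u)"
    by simp
  thus ?thesis using y unfolding y_def by (simp add: divide_le_cancel)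
qed

text \<open>By the previous inequality, $\sqrt{u(y)/y} + 2C\sqrt{y}$ is nondecreasing, where
  $u(y) = 1 - |b(x+iy)|^2$; so $u(y) = O(y)$ uniformly in $x$.\<close>

lemma vertical_growth_bound:
  assumes b: "b \<in> Hinf_unit_ball" and C: "C \<ge> 0"
    and lt: "\<And>z. Im z > 0 \<Longrightarrow> cmod (b z) < 1"
    and K: "\<And>w. Im w > 0 \<Longrightarrow> cmod (of_real ((1 - (cmod (b w))\<^sup>2) / (2 * Im w)) + \<i> * (cnj (b w) * deriv b w))
        \<le> C * sqrt (1 - (cmod (b w))\<^sup>2)"
    and y: "0 < y0" "y0 \<le> 1"
  shows "1 - (cmod (b (Complex x y0)))\<^sup>2 \<le> (1 + 2 * C)\<^sup>2 * y0"
proof -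
  note bH = Hinf_unit_ball_D(1)[OF b]
  define u where "u y = 1 - (cmod (b (Complex x y)))\<^sup>2" for y
  define u' where "u' y = - 2 * Re (\<i> * (cnj (b (Complex x y)) * deriv b (Complex x y)))" for y
  \<comment> \<open>Strict positivity makes sqrt (u / y) differentiable along the whole
    line.\<close>
  have u: "u y > 0" "u y \<le> 1" if "y > 0" for y
    using lt[of "Complex x y"] that by (simp_all add: u_def power_less_one_iff abs_square_less_1)
  have du: "(u has_real_derivative u' y) (at y)" if y: "y > 0" for y
  proof -
    let ?B = "\<lambda>y. b (Complex x y)"
    let ?d = "\<i> * deriv b (Complex x y)"
    have "((\<lambda>y. Complex x y) has_vector_derivative \<i>) (at y)"
      unfolding Complex_eq by (auto intro!: derivative_eq_intros)
    from field_vector_diff_chain_at[OF this, of b "deriv b (Complex x y)"]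
    have dB: "(?B has_vector_derivative ?d) (at y)"
      using holomorphic_derivI[OF Hinf_holomorphic[OF bH] open_UHP, of "Complex x y"] y by (simp add: comp_def)
    define p q where "p y = Re (?B y)" and "q y = Im (?B y)" for y
    have pq: "(p has_real_derivative Re ?d) (at y)" "(q has_real_derivative Im ?d) (at y)"
      using bounded_linear.has_vector_derivative[OF bounded_linear_Re dB] bounded_linear.has_vector_derivative[OF bounded_linear_Im dB]
      by (simp_all only: has_real_derivative_iff_has_vector_derivative p_def[abs_def] q_def[abs_def])
    have "((\<lambda>y. 1 - ((p y)\<^sup>2 + (q y)\<^sup>2)) has_real_derivative - (2 * p y * Re ?d + 2 * q y * Im ?d)) (at y)"
      by (auto intro!: derivative_eq_intros pq)
    moreover have "- (2 * p y * Re ?d + 2 * q y * Im ?d) = u' y" by (simp add: u'_def p_def q_def algebra_simps)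
    moreover have "u = (\<lambda>y. 1 - ((p y)\<^sup>2 + (q y)\<^sup>2))" by (simp add: u_def cmod_power2 p_def q_def fun_eq_iff)
    ultimately show ?thesis by simp
  qed
  \<comment> \<open>Real part of the kernel inequality: \<open>u'\<close> is the derivative of
    \<open>u\<close> in y, and Re (i cnj b b') = - u' / 2.\<close>
  have ineq: "u y / y - u' y \<le> 2 * C * sqrt (u y)" if y: "y > 0" for y
  proof -
    have "u y / (2 * y) - u' y / 2 = Re (of_real (u y / (2 * y)) + \<i> * (cnj (b (Complex x y)) * deriv b (Complex x y)))"
      by (simp add: u'_def diff_divide_distrib)
    also have "\<dots> \<le> cmod (of_real (u y / (2 * y)) + \<i> * (cnj (b (Complex x y)) * deriv b (Complex x y)))"
      by (rule complex_Re_le_cmod)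
    also have "\<dots> \<le> C * sqrt (u y)" using K[of "Complex x y"] y by (simp add: u_def)
    finally show ?thesis by (simp add: field_simps)
  qed
  define s where "s y = sqrt (u y / y) + 2 * C * sqrt y" for y
  have "s y0 \<le> s 1"
  proof (rule DERIV_nonneg_imp_nondecreasing[OF y(2)])
    fix t assume "y0 \<le> t" "t \<le> 1"
    hence t: "t > 0" using y by simp
    note ut = u[OF t]
    have "((\<lambda>y. u y / y) has_real_derivative (u' t * t - u t) / t\<^sup>2) (at t)"
      using t by (auto intro!: derivative_eq_intros du[OF t] simp: power2_eq_square)
    moreover have "u t / t > 0" using ut t by simp
    ultimately have "(s has_real_derivative (u' t * t - u t) / t\<^sup>2 * (inverse (sqrt (u t / t)) / 2) + 2 * C * (inverse (sqrt t) / 2)) (at t)"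
      unfolding s_def using t
      by (intro DERIV_add DERIV_cmult DERIV_real_sqrt DERIV_chain2[of sqrt, OF DERIV_real_sqrt, THEN DERIV_cong]) auto
    \<comment> \<open>Multiplied by 1 / (2 sqrt (u / t)), the bound 2 C sqrt u / t becomes exactly C
      / sqrt t, the derivative of the second summand of \<open>s\<close>.\<close>
    moreover have "0 \<le> (u' t * t - u t) / t\<^sup>2 * (inverse (sqrt (u t / t)) / 2) + 2 * C * (inverse (sqrt t) / 2)"
    proof -
      have "(u' t * t - u t) / t\<^sup>2 = - (1 / t) * (u t / t - u' t)" using t by (simp add: field_simps power2_eq_square)
      moreover have "(1 / t) * (u t / t - u' t) \<le> (1 / t) * (2 * C * sqrt (u t))"
        using t by (intro mult_left_mono ineq) auto
      ultimately have "- ((1 / t) * (2 * C * sqrt (u t))) \<le> (u' t * t - u t) / t\<^sup>2" by linarith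
      hence "- ((1 / t) * (2 * C * sqrt (u t))) * (inverse (sqrt (u t / t)) / 2)
          \<le> (u' t * t - u t) / t\<^sup>2 * (inverse (sqrt (u t / t)) / 2)"
        using ut t by (intro mult_right_mono) auto
      moreover have "- ((1 / t) * (2 * C * sqrt (u t))) * (inverse (sqrt (u t / t)) / 2) = - (2 * C * (inverse (sqrt t) / 2))"
      proof -
        have "sqrt t * sqrt t = t" using t by simp
        thus ?thesis using ut t by (simp add: real_sqrt_divide field_simps)
      qed
      ultimately show ?thesis by linarith
    qed
    ultimately show "\<exists>z. (s has_real_derivative z) (at t) \<and> 0 \<le> z" by blast
  qed
  \<comment> \<open>At height 1 the trivial bound u <= 1 starts the estimate; hence the constant 1 +
    2 C.\<close>
  moreover have "s 1 \<le> 1 + 2 * C" using u[of 1] by (simp add: s_def)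
  moreover have "sqrt (u y0 / y0) \<le> s y0" using C y by (simp add: s_def)
  ultimately have "sqrt (u y0 / y0) \<le> 1 + 2 * C" by linarith
  hence "(sqrt (u y0 / y0))\<^sup>2 \<le> (1 + 2 * C)\<^sup>2" using u[OF y(1)] y by (intro power_mono) auto
  hence "u y0 / y0 \<le> (1 + 2 * C)\<^sup>2" using u[OF y(1)] y by simp
  thus ?thesis using y by (simp add: u_def divide_le_eq)
qed

lemma bounded_deriv_imp_inner:
  assumes b: "b \<in> Hinf_unit_ball"
    and B: "bounded_operator (dBR_space b) (dBR_norm b) H2 H2_norm hp_deriv"
  shows "inner_function b \<and> hp_deriv b \<in> Hinf"
proof -
  note bH = Hinf_unit_ball_D(1)[OF b]
  note hol = Hinf_holomorphic[OF bH]
  have bd: "AE x in lborel. cmod (bdry b x) \<le> 1"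
    using Hinf_bdry_bound[OF bH] b by (auto simp: Hinf_unit_ball_def elim: eventually_mono)
  have hd_hol: "hp_deriv b holomorphic_on UHP"
    by (rule holomorphic_transform[OF holomorphic_deriv[OF hol open_UHP]]) (auto simp: hp_deriv_def)
  show ?thesis
  \<comment> \<open>An interior point with |b| = 1 makes b constant by the maximum principle; this
    case is set apart because \<open>vertical_growth_bound\<close> assumes |b| < 1.\<close>
  proof (cases "\<exists>z. Im z > 0 \<and> cmod (b z) = 1")
    case True
    then obtain z0 where z0: "Im z0 > 0" "cmod (b z0) = 1" by blast
    have "b constant_on UHP"
      by (rule maximum_modulus_principle[OF hol open_UHP convex_connected[OF convex_UHP] open_UHP subset_refl])
         (use z0 Hinf_unit_ball_D(2)[OF b] in auto)
    then obtain c where c: "\<And>z. Im z > 0 \<Longrightarrow> b z = c" by (auto simp: constant_on_def)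
    have c1: "cmod c = 1" using c z0 by auto
    have "bdry b x = c" for x by (rule bdry_continuous_eqI[of b "\<lambda>z. c"]) (use c in auto)
    moreover have "deriv b z = 0" if "Im z > 0" for z
    proof -
      have "eventually (\<lambda>v. b v = c) (nhds z)"
        using eventually_nhds_in_open[OF open_UHP, of z] that by (auto elim!: eventually_mono simp: c)
      from deriv_cong_ev[OF this refl] show ?thesis by simp
    qed
    hence "hp_deriv b = (\<lambda>z. 0)" by (auto simp: hp_deriv_def)
    moreover have "(\<lambda>z. 0) \<in> Hinf" by (auto simp: Hinf_def bounded_iff)
    ultimately show ?thesis using b c1 by (simp add: inner_function_def)
  next
    case False
    hence lt: "cmod (b z) < 1" if "Im z > 0" for z using Hinf_unit_ball_D(2)[OF b that] that by fastforce
    obtain C0 where C0: "\<And>f. f \<in> dBR_space b \<Longrightarrow> hp_deriv f \<in> H2 \<and> H2_norm (hp_deriv f) \<le> C0 * dBR_norm b f"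
      using B unfolding bounded_operator_def by blast
    \<comment> \<open>\<open>bounded_operator\<close> does not fix the sign of its constant.\<close>
    define C where "C = max C0 0"
    have C: "C \<ge> 0" by (simp add: C_def)
    have D: "hp_deriv f \<in> H2 \<and> H2_norm (hp_deriv f) \<le> C * dBR_norm b f" if "f \<in> dBR_space b" for f
      using C0[OF that] mult_right_mono[of C0 C "dBR_norm b f"] dBR_norm_nonneg[of b f] by (auto simp: C_def intro: order_trans)
    note K = kernel_derivative_inequality[OF b _ C D]
    define M where "M = 1 + 2 * C"
    have M: "M \<ge> 1" using C by (simp add: M_def)
    have growth: "1 - (cmod (b z))\<^sup>2 \<le> M\<^sup>2 * Im z" if "0 < Im z" "Im z \<le> 1" for z
      using vertical_growth_bound[OF b C lt K that, of "Re z"] by (simp add: M_def)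
    have "AE x in lborel. cmod (bdry b x) = 1"
      using bd Hinf_bdry_tendsto[OF bH]
    proof eventually_elim
      case (elim x)
      have "1 \<le> (cmod (bdry b x))\<^sup>2 + M\<^sup>2 * 0"
      proof (rule tendsto_lowerbound)
        show "((\<lambda>y. (cmod (b (Complex x y)))\<^sup>2 + M\<^sup>2 * y) \<longlongrightarrow> (cmod (bdry b x))\<^sup>2 + M\<^sup>2 * 0) (at_right 0)"
          by (intro tendsto_intros elim(2))
        show "\<forall>\<^sub>F y in at_right 0. 1 \<le> (cmod (b (Complex x y)))\<^sup>2 + M\<^sup>2 * y"
          using eventually_at_right_real[of 0 1, OF zero_less_one] by eventually_elim (use growth[of "Complex x _"] in force)
      qed simp
      hence "1\<^sup>2 \<le> (cmod (bdry b x))\<^sup>2" by simp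
      hence "1 \<le> cmod (bdry b x)" by (rule power2_le_imp_le) simp
      thus ?case using elim(1) by simp
    qed
    moreover have "hp_deriv b \<in> Hinf"
    proof -
      \<comment> \<open>At heights up to \<open>y1\<close> the growth bound gives 1 - |b|^2 <= 3/4,
        so |b| >= 1/2, and control of cnj b * b' becomes control of b'.\<close>
      define y1 where "y1 = 3 / (4 * M\<^sup>2)"
      have M2: "M\<^sup>2 \<ge> 1" using M by (simp add: one_le_power)
      have y1: "0 < y1" "y1 \<le> 1" using M2 by (auto simp: y1_def divide_simps)
      have near: "cmod (deriv b z) \<le> M\<^sup>2 + 2 * (C * M)" if z: "0 < Im z" "Im z \<le> y1" for z
      proof -
        define u where "u = 1 - (cmod (b z))\<^sup>2"
        have u0: "u \<ge> 0" using lt[OF z(1)] by (simp add: u_def abs_square_le_1)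
        have u1: "u \<le> M\<^sup>2 * Im z" unfolding u_def by (rule growth) (use z y1 in auto)
        have "M\<^sup>2 * Im z \<le> M\<^sup>2 * y1" by (intro mult_left_mono z) simp
        also have "\<dots> = 3 / 4" using M by (simp add: y1_def)
        finally have "1 / 4 \<le> (cmod (b z))\<^sup>2" using u1 by (simp add: u_def)
        hence "(1 / 2)\<^sup>2 \<le> (cmod (b z))\<^sup>2" by (simp add: power2_eq_square)
        hence half: "1 / 2 \<le> cmod (b z)" by (rule power2_le_imp_le) simp
        have a: "u / (2 * Im z) \<le> M\<^sup>2 / 2" using u1 z by (simp add: field_simps)
        have "M\<^sup>2 * Im z \<le> M\<^sup>2 * 1" using z y1 by (intro mult_left_mono) auto
        hence "u \<le> M\<^sup>2" using u1 by simp
        hence "sqrt u \<le> M" using M by (auto intro: real_le_lsqrt)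
        hence c: "C * sqrt u \<le> C * M" using C by (intro mult_left_mono) auto
        have "cmod (cnj (b z) * deriv b z) = cmod (\<i> * (cnj (b z) * deriv b z))" by (simp add: norm_mult)
        also have "\<dots> \<le> cmod (of_real (u / (2 * Im z)) + \<i> * (cnj (b z) * deriv b z)) + cmod (complex_of_real (u / (2 * Im z)))"
          using norm_triangle_ineq4[of "of_real (u / (2 * Im z)) + \<i> * (cnj (b z) * deriv b z)" "of_real (u / (2 * Im z))"] by simp
        also have "cmod (complex_of_real (u / (2 * Im z))) = u / (2 * Im z)" using u0 z by (simp only: norm_of_real) simp
        also have "cmod (of_real (u / (2 * Im z)) + \<i> * (cnj (b z) * deriv b z)) \<le> C * sqrt u"
          unfolding u_def by (rule K[OF z(1)])
        finally have "cmod (b z) * cmod (deriv b z) \<le> C * M + M\<^sup>2 / 2" using a c by (simp add: norm_mult)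
        moreover have "1 / 2 * cmod (deriv b z) \<le> cmod (b z) * cmod (deriv b z)" by (intro mult_right_mono half) simp
        ultimately show ?thesis by simp
      qed
      \<comment> \<open>Above \<open>y1\<close> the discs of radius y1 / 2 stay in the half plane,
        where |b| <= 1, and Cauchy's inequality suffices.\<close>
      have far: "cmod (deriv b z) \<le> 1 / (y1 / 2)" if z: "Im z > y1" for z
      proof -
        have sub: "cball z (y1 / 2) \<subseteq> UHP" by (rule cball_subset_UHP) (use z y1 in simp)
        have "norm ((deriv ^^ 1) b z) \<le> fact 1 * 1 / (y1 / 2) ^ 1"
        proof (rule Cauchy_inequality)
          show "b holomorphic_on ball z (y1 / 2)" by (rule holomorphic_on_subset[OF hol]) (use sub in auto)
          show "continuous_on (cball z (y1 / 2)) b"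
            by (rule holomorphic_on_imp_continuous_on[OF holomorphic_on_subset[OF hol sub]])
          fix x assume "norm (z - x) = y1 / 2"
          hence "x \<in> UHP" using sub by (auto simp: dist_norm)
          thus "norm (b x) \<le> 1" using Hinf_unit_ball_D(2)[OF b] by simp
        qed (use y1 in simp)
        thus ?thesis by simp
      qed
      have "cmod (hp_deriv b z) \<le> max (M\<^sup>2 + 2 * (C * M)) (1 / (y1 / 2))" if "z \<in> UHP" for z
        using near[of z] far[of z] that by (cases "Im z \<le> y1") (auto simp: hp_deriv_def le_max_iff_disj)
      thus ?thesis using hd_hol unfolding Hinf_def bounded_iff by blast
    qed
    ultimately show ?thesis using b by (simp add: inner_function_def)
  qed
qed

subsection \<open>Inner functions with bounded derivative\<close>

text \<open>Since |b| = 1 almost everywhere on the line, multiplication by b preserves inner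
  products.\<close>

lemma inner_mult_adj_mult_op:
  assumes b: "inner_function b"
  shows "mult_adj b (mult_op b x) = x"
proof (rule h2_inner_eqI)
  fix y
  have bH: "b \<in> Hinf" and one: "AE t in lborel. cmod (bdry b t) = 1"
    using b by (auto simp: inner_function_def Hinf_unit_ball_def)
  have "H2_inner (h2_fun (mult_adj b (mult_op b x))) (h2_fun y) = L2_inner (bdry (\<lambda>z. b z * h2_fun x z)) (bdry (\<lambda>z. b z * h2_fun y z))"
    unfolding mult_adj_inner[OF bH] by (simp add: h2_fun_mult_op bH H2_inner_def)
  also have "\<dots> = L2_inner (bdry (h2_fun x)) (bdry (h2_fun y))"
    unfolding L2_inner_def
  proof (rule integral_cong_AE)
    note [measurable] = measurable_bdry_H2[OF H2_Hinf_mult[OF bH h2_fun]] measurable_bdry_H2[OF h2_fun]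
    show "(\<lambda>t. bdry (\<lambda>z. b z * h2_fun x z) t * cnj (bdry (\<lambda>z. b z * h2_fun y z) t)) \<in> borel_measurable lborel"
      "(\<lambda>t. bdry (h2_fun x) t * cnj (bdry (h2_fun y) t)) \<in> borel_measurable lborel" by measurable
    show "AE t in lborel. bdry (\<lambda>z. b z * h2_fun x z) t * cnj (bdry (\<lambda>z. b z * h2_fun y z) t)
        = bdry (h2_fun x) t * cnj (bdry (h2_fun y) t)"
      using bdry_mult_AE[OF bH h2_fun, of x] bdry_mult_AE[OF bH h2_fun, of y] one
    proof eventually_elim
      case (elim t)
      have "bdry b t * cnj (bdry b t) = 1" using elim(3) complex_norm_square[of "bdry b t"] by simp
      thus ?case unfolding elim(1,2) complex_cnj_mult
        by (metis (no_types, lifting) mult.assoc mult.commute mult.left_neutral)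
    qed
  qed
  finally show "H2_inner (h2_fun (mult_adj b (mult_op b x))) (h2_fun y) = H2_inner (h2_fun x) (h2_fun y)"
    by (simp add: H2_inner_def)
qed

text \<open>By \<open>inner_mult_adj_mult_op\<close> the operator \<open>dBR_op b\<close> is an
  orthogonal projection, hence its own positive square root. So H(b) is its range with the norm of
  \<open>H2\<close>, and \<open>mult_adj b\<close> annihilates this range, which is orthogonality to
  b H^2.\<close>

lemma inner_dBR:
  assumes b: "inner_function b" and u: "u \<in> dBR_space b"
  shows "u \<in> H2" "dBR_norm b u = H2_norm u" "h \<in> H2 \<Longrightarrow> H2_inner u (\<lambda>z. b z * h z) = 0"
proof -
  have bb: "b \<in> Hinf_unit_ball" using b by (simp add: inner_function_def)
  note bH = Hinf_unit_ball_D(1)[OF bb]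
  note l = positive_operator_lift[OF dBR_sqrt_spec(1)[OF bb]]
  interpret l: bounded_linear "h2_lift (dBR_sqrt b)" by (rule l(2))
  interpret M: linear "mult_op b" by (rule linear_mult_op[OF bH])
  interpret A: linear "mult_adj b" by (rule linear_mult_adj[OF bH])
  let ?Q = "dBR_op b"
  have AQ: "mult_adj b (?Q x) = 0" for x
    by (simp add: dBR_op_def A.diff inner_mult_adj_mult_op[OF b])
  have QQ: "?Q (?Q x) = ?Q x" for x
    using AQ[of x] by (simp add: dBR_op_def[of b "?Q x"] M.zero)
  have Qlin: "linear ?Q"
    by (rule linearI) (simp_all add: dBR_op_def A.add A.scale M.add M.scale algebra_simps)
  have Qsym: "inner (?Q x) y = inner x (?Q y)" for x y
  proof -
    have "inner (mult_op b (mult_adj b x)) y = inner (mult_adj b x) (mult_adj b y)"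
      by (metis mult_adj_real_inner[OF bH] inner_commute)
    moreover have "inner x (mult_op b (mult_adj b y)) = inner (mult_adj b x) (mult_adj b y)"
      by (simp add: mult_adj_real_inner[OF bH])
    ultimately show ?thesis by (simp add: dBR_op_def inner_diff_left inner_diff_right)
  qed
  have Qpos: "0 \<le> inner (?Q x) x" for x
  proof -
    have "inner (?Q x) x = inner (?Q (?Q x)) x" by (simp only: QQ)
    also have "\<dots> = inner (?Q x) (?Q x)" by (rule Qsym)
    finally show ?thesis by simp
  qed
  \<comment> \<open>Uniqueness of positive roots, against the projection itself; the two commute
    because \<open>dBR_op b\<close> is the square of the root.\<close>
  have sQ: "h2_lift (dBR_sqrt b) x = ?Q x" for x
  proof (rule positive_sqrt_unique[OF l.linear_axioms l(4,5) Qlin Qsym Qpos])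
    show "h2_lift (dBR_sqrt b) (?Q x) = ?Q (h2_lift (dBR_sqrt b) x)" for x
      by (simp only: dBR_sqrt_lift[OF bb, symmetric])
    show "h2_lift (dBR_sqrt b) (h2_lift (dBR_sqrt b) x) = ?Q (?Q x)" for x
      by (simp only: QQ dBR_sqrt_lift[OF bb])
  qed
  obtain x where "u = dBR_sqrt b (h2_fun x)" using u unfolding dBR_space_def by (metis h2_of_inverse image_iff)
  hence ux: "u = h2_fun (?Q x)" by (simp add: l(1)[symmetric] sQ)
  show uH: "u \<in> H2" by (simp add: ux)
  have "(dBR_norm b u)\<^sup>2 = (H2_norm u)\<^sup>2"
  proof -
    have "(dBR_norm b u)\<^sup>2 = inner (?Q (?Q x)) (?Q x)"
      using dBR_norm_dBR_op(2)[OF bb, of "?Q x"] by (simp only: ux QQ)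
    thus ?thesis by (simp add: QQ ux norm_h2_eq[symmetric] power2_norm_eq_inner)
  qed
  thus "dBR_norm b u = H2_norm u" by (simp add: power2_eq_iff_nonneg dBR_norm_nonneg)
  assume h: "h \<in> H2"
  have "H2_inner u (\<lambda>z. b z * h z) = H2_inner (h2_fun (mult_adj b (?Q x))) (h2_fun (h2_of h))"
    unfolding mult_adj_inner[OF bH] using h by (simp add: ux h2_fun_mult_op bH)
  also have "\<dots> = H2_inner (\<lambda>z. 0 * h z) h" using h by (simp add: AQ h2_fun_ext)
  also have "\<dots> = 0" by (subst H2_inner_cmult_left[OF h h]) simp
  finally show "H2_inner u (\<lambda>z. b z * h z) = 0" .
qed

lemma Hinf_affine: "f \<in> Hinf \<Longrightarrow> (\<lambda>z. c - d * f z) \<in> Hinf"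
proof -
  assume f: "f \<in> Hinf"
  have "cmod (c - d * f z) \<le> cmod c + cmod d * Hinf_norm f" if "z \<in> UHP" for z
  proof -
    have "cmod (f z) \<le> Hinf_norm f" using Hinf_bound f that by auto
    hence "cmod d * cmod (f z) \<le> cmod d * Hinf_norm f" by (intro mult_left_mono) auto
    thus ?thesis using norm_triangle_ineq4[of c "d * f z"] by (simp add: norm_mult)
  qed
  hence "bounded ((\<lambda>z. c - d * f z) ` UHP)" unfolding bounded_iff by blast
  thus ?thesis using f by (auto simp: Hinf_def intro!: holomorphic_intros)
qed

text \<open>Since \<open>f\<close> is orthogonal to $bH^2$, the kernel of \<open>f'(w)\<close> may be multiplied by
  $(1 - \overline{b(w)} b)^2$; this removes its singularity, as $|1 - \overline{b(w)} b(t)| = |b(t) - b(w)|$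
  is at most \<open>min (K |t - w|) 2\<close>.\<close>

lemma model_space_deriv_bound:
  assumes b: "inner_function b" and K: "K > 0" "\<And>z. Im z > 0 \<Longrightarrow> cmod (deriv b z) \<le> K"
    and f: "f \<in> H2" and perp: "\<And>h. h \<in> H2 \<Longrightarrow> H2_inner f (\<lambda>z. b z * h z) = 0" and w: "Im w > 0"
  shows "ennreal (cmod (deriv f w))
    \<le> (\<integral>\<^sup>+t. ennreal (cmod (bdry f t) * (2 * K / pi * (2 / K / ((t - Re w)\<^sup>2 + (2 / K)\<^sup>2)))) \<partial>lborel)"
proof -
  have bb: "b \<in> Hinf_unit_ball" and one: "AE t in lborel. cmod (bdry b t) = 1"
    using b by (auto simp: inner_function_def)
  note bH = Hinf_unit_ball_D(1)[OF bb]
  define c where "c = cnj (b w)"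
  \<comment> \<open>The derivative kernel times (1 - c b)^2; it differs from \<open>dker w\<close>
    by an element of b H^2, to which f is orthogonal.\<close>
  define e where "e z = (1 - c * b z) * ((1 - c * b z) * dker w z)" for z
  have eH: "e \<in> H2" unfolding e_def by (intro H2_Hinf_mult Hinf_affine bH dker_in_H2 w)
  \<comment> \<open>Mean value inequality on the convex half plane; a vertical limit later carries
    it to the boundary point t.\<close>
  have lip: "cmod (b z - b w) \<le> K * cmod (z - w)" if "Im z > 0" for z
    by (rule field_differentiable_bound[OF convex_UHP, of b "deriv b"])
       (use that w K Hinf_holomorphic[OF bH] in \<open>auto intro!: holomorphic_derivI[OF _ open_UHP, THEN has_field_derivative_at_within]\<close>)
  have pt: "AE t in lborel. cmod (bdry e t) \<le> 2 * K / pi * (2 / K / ((t - Re w)\<^sup>2 + (2 / K)\<^sup>2))"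
    using one Hinf_bdry_tendsto[OF bH]
      bdry_mult_AE[OF Hinf_affine[OF bH, of 1 c] H2_Hinf_mult[OF Hinf_affine[OF bH, of 1 c] dker_in_H2[OF w]]]
      bdry_mult_AE[OF Hinf_affine[OF bH, of 1 c] dker_in_H2[OF w]]
  proof eventually_elim
    case (elim t)
    define \<beta> where "\<beta> = bdry b t"
    have lim: "bdry (\<lambda>z. 1 - c * b z) t = 1 - c * \<beta>" unfolding \<beta>_def
      by (intro bdry_eqI tendsto_intros elim(2))
    have e: "bdry e t = (1 - c * \<beta>) * ((1 - c * \<beta>) * bdry (dker w) t)"
      unfolding e_def elim(3) elim(4) lim ..
    define r where "r = cmod (\<beta> - b w)"
    have "cmod (1 - c * \<beta>) = r"
    proof -
      have "\<beta> * cnj \<beta> = 1" using elim(1) complex_norm_square[of \<beta>] by (simp add: \<beta>_def)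
      hence "1 - c * \<beta> = \<beta> * cnj (\<beta> - b w)" by (simp add: c_def right_diff_distrib mult.commute)
      thus ?thesis using elim(1) unfolding r_def \<beta>_def[symmetric] by (simp only: norm_mult complex_mod_cnj)
    qed
    moreover have "cmod (bdry (dker w) t) = 1 / (2 * pi) * (1 / (cmod (of_real t - w))\<^sup>2)"
    proof -
      have "cmod (of_real t - cnj w) = cmod (cnj (of_real t - w))" by simp
      also have "\<dots> = cmod (of_real t - w)" by (rule complex_mod_cnj)
      finally show ?thesis by (simp add: bdry_dker[OF w] norm_mult norm_divide norm_power)
    qed
    ultimately have ce: "cmod (bdry e t) = r\<^sup>2 / (2 * pi * (cmod (of_real t - w))\<^sup>2)"
      unfolding e norm_mult by (simp add: power2_eq_square)
    have r2: "r \<le> 2"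
    proof -
      have "cmod (b w) \<le> 1" by (rule Hinf_unit_ball_D(2)[OF bb w])
      thus ?thesis unfolding r_def using norm_triangle_ineq4[of \<beta> "b w"] elim(1) by (simp add: \<beta>_def)
    qed
    have rK: "r \<le> K * cmod (of_real t - w)"
    proof (rule tendsto_le[OF trivial_limit_at_right_real])
      show "((\<lambda>y. K * cmod (Complex t y - w)) \<longlongrightarrow> K * cmod (of_real t - w)) (at_right 0)"
        by (intro tendsto_intros Complex_tendsto_at_right)
      show "((\<lambda>y. cmod (b (Complex t y) - b w)) \<longlongrightarrow> r) (at_right 0)"
        unfolding r_def \<beta>_def by (intro tendsto_intros elim(2))
      show "\<forall>\<^sub>F y in at_right 0. cmod (b (Complex t y) - b w) \<le> K * cmod (Complex t y - w)"
        using eventually_at_right_less[of 0] by eventually_elim (simp add: lip)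
    qed
    define q where "q = cmod (of_real t - w)"
    have q: "q > 0" using of_real_minus_cnj_nonzero(2)[OF w] by (simp add: q_def)
    have tq: "(t - Re w)\<^sup>2 \<le> q\<^sup>2" by (simp add: q_def cmod_power2)
    \<comment> \<open>The bounds r <= 2 and r <= K q serve one summand each and give r^2 / q^2 <= 8
      / ((t - Re w)^2 + (2 / K)^2): a multiple of the Poisson kernel of height 2 / K, the distance
      at which the two bounds balance.\<close>
    have "r\<^sup>2 * (t - Re w)\<^sup>2 \<le> 2\<^sup>2 * q\<^sup>2" 
      using r2 by (intro mult_mono[OF power_mono tq]) (auto simp: r_def)
    moreover have "r\<^sup>2 * (2 / K)\<^sup>2 \<le> 4 * q\<^sup>2"
    proof -
      have "r\<^sup>2 \<le> (K * q)\<^sup>2" using rK by (intro power_mono) (auto simp: q_def r_def)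
      hence "r\<^sup>2 * (2 / K)\<^sup>2 \<le> (K * q)\<^sup>2 * (2 / K)\<^sup>2" by (intro mult_right_mono) auto
      also have "\<dots> = 4 * q\<^sup>2" using K by (simp add: power_mult_distrib power_divide)
      finally show ?thesis .
    qed
    ultimately have "r\<^sup>2 * ((t - Re w)\<^sup>2 + (2 / K)\<^sup>2) \<le> 8 * q\<^sup>2" by (simp add: distrib_left)
    moreover have "(t - Re w)\<^sup>2 + (2 / K)\<^sup>2 > 0" using K by (simp add: add_nonneg_pos)
    ultimately have "r\<^sup>2 / q\<^sup>2 \<le> 8 / ((t - Re w)\<^sup>2 + (2 / K)\<^sup>2)" using q by (simp add: divide_simps mult.commute)
    hence "r\<^sup>2 / q\<^sup>2 / (2 * pi) \<le> 8 / ((t - Re w)\<^sup>2 + (2 / K)\<^sup>2) / (2 * pi)" by (intro divide_right_mono) auto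
    moreover have "8 / ((t - Re w)\<^sup>2 + (2 / K)\<^sup>2) / (2 * pi) = 2 * K / pi * (2 / K / ((t - Re w)\<^sup>2 + (2 / K)\<^sup>2))"
      using K by (simp del: power_divide)
    ultimately show ?case unfolding ce q_def[symmetric] by (simp add: mult.commute)
  qed
  have "H2_inner f e = H2_inner f (dker w) - H2_inner f (\<lambda>z. b z * ((2 * c - c * c * b z) * dker w z))"
  proof -
    have "e = (\<lambda>z. dker w z - b z * ((2 * c - c * c * b z) * dker w z))"
      by (simp add: e_def fun_eq_iff algebra_simps)
    thus ?thesis
      by (simp only:) (intro H2_inner_diff_right dker_in_H2 w f H2_Hinf_mult bH Hinf_affine)
  qed
  also have "H2_inner f (\<lambda>z. b z * ((2 * c - c * c * b z) * dker w z)) = 0"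
    by (intro perp H2_Hinf_mult Hinf_affine bH dker_in_H2 w)
  finally have "deriv f w = H2_inner f e" using H2_deriv_reproducing[OF f w] by simp
  hence "cmod (deriv f w) \<le> (LINT t|lborel. cmod (bdry f t * cnj (bdry e t)))"
    unfolding H2_inner_def L2_inner_def by simp
  also have "\<dots> = (LINT t|lborel. cmod (bdry f t) * cmod (bdry e t))" by (simp add: norm_mult)
  finally have "ennreal (cmod (deriv f w)) \<le> ennreal (LINT t|lborel. cmod (bdry f t) * cmod (bdry e t))"
    by (rule ennreal_leI)
  also have "\<dots> = (\<integral>\<^sup>+t. ennreal (cmod (bdry f t) * cmod (bdry e t)) \<partial>lborel)"
    by (intro nn_integral_eq_integral[symmetric] integrable_mult_square_integrable square_integrable_bdry f eH) auto
  also have "\<dots> \<le> (\<integral>\<^sup>+t. ennreal (cmod (bdry f t) * (2 * K / pi * (2 / K / ((t - Re w)\<^sup>2 + (2 / K)\<^sup>2)))) \<partial>lborel)"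
  proof (rule nn_integral_mono_AE)
    show "AE t in lborel. ennreal (cmod (bdry f t) * cmod (bdry e t))
      \<le> ennreal (cmod (bdry f t) * (2 * K / pi * (2 / K / ((t - Re w)\<^sup>2 + (2 / K)\<^sup>2))))"
      using pt by eventually_elim (rule ennreal_leI[OF mult_left_mono[OF _ norm_ge_zero]])
  qed
  finally show ?thesis .
qed

text \<open>Young's inequality: the majorant is a fixed kernel of mass 2 K / pi * pi = 2 K, the same
  for every height, so the lines of f' are bounded uniformly.\<close>

lemma model_space_deriv_in_H2:
  assumes b: "inner_function b" and K: "K > 0" "\<And>z. Im z > 0 \<Longrightarrow> cmod (deriv b z) \<le> K"
    and f: "f \<in> H2" and perp: "\<And>h. h \<in> H2 \<Longrightarrow> H2_inner f (\<lambda>z. b z * h z) = 0"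
  shows "hp_deriv f \<in> H2" "H2_norm (hp_deriv f) \<le> 2 * K * H2_norm f"
proof -
  have hol: "hp_deriv f holomorphic_on UHP"
    by (rule holomorphic_transform[OF holomorphic_deriv[OF H2_holomorphic[OF f] open_UHP]]) (auto simp: hp_deriv_def)
  define k where "k s = 2 * K / pi * (2 / K / ((s - 0)\<^sup>2 + (2 / K)\<^sup>2))" for s
  have k0: "k s \<ge> 0" for s using K by (simp add: k_def)
  have hk: "has_bochner_integral lborel k (2 * K)"
  proof -
    have "2 / K > 0" using K by simp
    from has_bochner_integral_mult_right[OF Poisson_kernel_has_bochner_integral[OF this, of 0], of "2 * K / pi"]
    show ?thesis unfolding k_def by simp
  qed
  have mk[measurable]: "k \<in> borel_measurable borel" using hk by (auto simp: has_bochner_integral_iff dest: borel_measurable_integrable)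
  have Ik: "(\<integral>\<^sup>+s. ennreal (k s) \<partial>lborel) = ennreal (2 * K)"
    using hk k0 by (subst nn_integral_eq_integral) (auto simp: has_bochner_integral_iff)
  note [measurable] = measurable_bdry_H2[OF f]
  have line: "square_integrable (line (hp_deriv f) y) \<and> L2_norm (line (hp_deriv f) y) \<le> 2 * K * H2_norm f" if y: "y > 0" for y
  proof -
    have m: "line (hp_deriv f) y \<in> borel_measurable borel" by (rule measurable_line_UHP[OF hol y])
    have "(\<integral>\<^sup>+x. ennreal ((cmod (line (hp_deriv f) y x))\<^sup>2) \<partial>lborel)
       \<le> (\<integral>\<^sup>+x. (\<integral>\<^sup>+t. ennreal (cmod (bdry f t) * k (t - x)) \<partial>lborel)\<^sup>2 \<partial>lborel)"
    proof (rule nn_integral_mono)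
      fix x
      have "ennreal (cmod (line (hp_deriv f) y x)) \<le> (\<integral>\<^sup>+t. ennreal (cmod (bdry f t) * k (t - x)) \<partial>lborel)"
        using model_space_deriv_bound[OF b K f perp, of "Complex x y"] y
        by (simp add: line_def hp_deriv_def k_def)
      hence "(ennreal (cmod (line (hp_deriv f) y x)))\<^sup>2 \<le> (\<integral>\<^sup>+t. ennreal (cmod (bdry f t) * k (t - x)) \<partial>lborel)\<^sup>2"
        by (intro power_mono) auto
      thus "ennreal ((cmod (line (hp_deriv f) y x))\<^sup>2) \<le> (\<integral>\<^sup>+t. ennreal (cmod (bdry f t) * k (t - x)) \<partial>lborel)\<^sup>2"
        by (simp add: ennreal_power)
    qed
    also have "\<dots> \<le> (\<integral>\<^sup>+t. ennreal (k t) \<partial>lborel)\<^sup>2 * (\<integral>\<^sup>+t. ennreal ((cmod (bdry f t))\<^sup>2) \<partial>lborel)"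
      by (rule convolution_L2_bound) (auto simp: k0)
    also have "\<dots> = ennreal ((2 * K * H2_norm f)\<^sup>2)"
      using K by (simp add: Ik nn_integral_square_integrable[OF square_integrable_bdry[OF f]] H2_norm_eq
          ennreal_power ennreal_mult[symmetric] power_mult_distrib)
    finally show ?thesis using square_integrableI[OF m, of "2 * K * H2_norm f"] K by simp
  qed
  have off: "hp_deriv f z = 0" if "\<not> Im z > 0" for z using that by (simp add: hp_deriv_def)
  show H: "hp_deriv f \<in> H2" by (rule H2I(1)[OF hol off line])
  show "H2_norm (hp_deriv f) \<le> 2 * K * H2_norm f"
    unfolding H2_norm_eq_sup[OF H] by (rule H2I(2)[OF hol off line])
qed

lemma inner_imp_bounded_deriv:
  assumes b: "inner_function b" and d: "hp_deriv b \<in> Hinf"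
  shows "bounded_operator (dBR_space b) (dBR_norm b) H2 H2_norm hp_deriv"
proof -
  \<comment> \<open>The maximum with 1 makes K positive, as the height 2 / K of the majorant
    requires.\<close>
  define K where "K = max 1 (Hinf_norm (hp_deriv b))"
  have K: "K > 0" by (simp add: K_def)
  have dK: "cmod (deriv b z) \<le> K" if "Im z > 0" for z
    using Hinf_bound[OF d that] that by (simp add: hp_deriv_def K_def)
  \<comment> \<open>\<open>deriv\<close> is linear only at points of differentiability, so linearity
    of \<open>hp_deriv\<close> rests on elements of H(b) being holomorphic.\<close>
  have diff: "f field_differentiable (at z)" if "f \<in> dBR_space b" "Im z > 0" for f z
    using holomorphic_on_imp_differentiable_at[OF H2_holomorphic[OF inner_dBR(1)[OF b that(1)]] open_UHP] that(2) by simp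
  show ?thesis unfolding bounded_operator_def
  proof (intro conjI ballI allI exI[of _ "2 * K"])
    fix f assume f: "f \<in> dBR_space b"
    show "hp_deriv f \<in> H2" by (rule model_space_deriv_in_H2(1)[OF b K dK inner_dBR(1,3)[OF b f]])
    show "H2_norm (hp_deriv f) \<le> 2 * K * dBR_norm b f"
      unfolding inner_dBR(2)[OF b f] by (rule model_space_deriv_in_H2(2)[OF b K dK inner_dBR(1,3)[OF b f]])
    show "hp_deriv (\<lambda>z. c * f z) = (\<lambda>z. c * hp_deriv f z)" for c
      using diff[OF f] by (auto simp: hp_deriv_def fun_eq_iff)
    show "hp_deriv (\<lambda>z. f z + g z) = (\<lambda>z. hp_deriv f z + hp_deriv g z)" if g: "g \<in> dBR_space b" for g
      using diff[OF f] diff[OF g] by (auto simp: hp_deriv_def fun_eq_iff)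
  qed
qed

theorem corollary4p2:
  fixes b1 :: "complex \<Rightarrow> complex"
  assumes "b1 \<in> Hinf_unit_ball"
  shows "bounded_operator (dBR_space b1) (dBR_norm b1) H2 H2_norm hp_deriv \<longleftrightarrow>
         inner_function b1 \<and> hp_deriv b1 \<in> Hinf"
  using bounded_deriv_imp_inner[OF assms] inner_imp_bounded_deriv by blast

end
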